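(* There exists a family of periodic wavelet sequences $\{(\psi_j^a)_j\}_{a>1}$ (with associated scaling sequences $(\varphi_j^a)_j$) such that for every fixed $a>1$ the system $$\{\varphi_0^a\}\cup\{\psi_{j,k}^a:\ j=0,1,\dots,\ k=0,\dots,2^j-1\},\qquad \psi^a_{j,k}(x):=\psi^a_j(x-2^{-j}k),$$ forms a Parseval frame in $L_2(0,1)$, and $$\lim_{j\to\infty}\sup_{a>1}UC(\varphi_j^a)=\frac12,\qquad \lim_{a\to\infty}\sup_{j\in\mathbb{N}}UC(\varphi_j^a)=\frac12,$$ $$\lim_{j\to\infty}UC(\psi_j^a)=\frac32\ \text{ for every fixed } a>1,\qquad \lim_{a\to\infty}UC(\psi_j^a)=\frac12\ \text{ for every fixed } j\in\mathbb{N}.$$ Explicitly, the following family has these properties. Put $\varphi_0^a=1$ (the constant function). Let $\nu^{1,a}_0=\nu^{1,a}_1=\sqrt{1/2}$, and for $j\ge 2$ let $$\nu^{j,a}_k:=\begin{cases}\exp\left(-\dfrac{k^2+a^2}{j(j-1)a}\right), & k=-2^{j-2}+1,\dots,2^{j-2},\\[2ex] \sqrt{1-\exp\left(-\dfrac{2((k-2^{j-1})^2+a^2)}{j(j-1)a}\right)}, & k=2^{j-2}+1,\dots,3\cdot 2^{j-2},\end{cases}$$ where for every $j\ge1$ the sequence $(\nu^{j,a}_k)_k$ is extended $2^j$-periodically with respect to $k\in\mathbb{Z}$. Put $\widehat{\xi}_j^a(k):=\prod_{r=j+1}^\infty \nu^{r,a}_k$. The scaling sequence, masks, wavelet masks and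 wavelet sequence are defined respectively by $$\widehat{\varphi_j^a}(k):=2^{-j/2}\,\widehat{\xi}_j^a(k)\ (j\ge 1),\qquad \mu^{j,a}_k:=\sqrt2\,\nu^{j,a}_k,\qquad \lambda^{j,a}_k:=e^{2\pi i2^{-j}k}\mu^{j,a}_{k+2^{j-1}}\ (j\ge1),\qquad \widehat{\psi}_j^a(k):=\lambda^{j+1,a}_k\,\widehat{\varphi}_{j+1}^a(k)\ (j\ge0),$$ for all $k\in\mathbb{Z}$.
   Context: $L_2(0,1)$ is the space of $1$-periodic square-integrable complex-valued functions with inner product $(f,g)=\int_0^1 f\overline{g}\,dx$ and norm $\|f\|=\sqrt{(f,f)}$; Fourier coefficients are $\widehat f(k)=\int_0^1 f(x)e^{-2\pi i kx}\,dx$. A sequence $(f_n)$ in a Hilbert space $H$ is a Parseval frame if $\sum_n|(f,f_n)|^2=\|f\|^2$ for all $f\in H$. $\mathbb{N}=\{1,2,\dots\}$. Periodic (Breitenberger) uncertainty constant: for $f(x)=\sum_{k\in\mathbb{Z}}c_ke^{2\pi i kx}\in L_2(0,1)$, the angular variance is $$\mathrm{var}_A(f):=\frac1{4\pi^2}\left(\frac{\left(\sum_k|c_k|^2\right)^2}{\left|\sum_k c_k\overline{c_{k+1}}\right|^2}-1\right),$$ the frequency variance is $$\mathrm{var}_F(f):=\frac{4\pi^2\sum_k k^2|c_k|^2}{\sum_k|c_k|^2}-\frac{4\pi^2\left(\sum_k k|c_k|^2\right)^2}{\left(\sum_k|c_k|^2\right)^2},$$ and $UC(f):=\sqrt{\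mathrm{var}_A(f)\,\mathrm{var}_F(f)}$.
   Formalization: The explicit family fails as printed: φ_0=1 breaks the Parseval property; the limits with sup over a>1 or a→∞ fail. Here φ_0 has coefficients ξ̂_0; all limits hold for masks equal to ν at j=1 and all but finitely many j; for ν itself: frame, limit 3/2, and sup over 1<a≤b→1/2. *)

theory Defs
  imports "HOL-Analysis.Analysis"
begin

definition periodic_L2 :: "(real \<Rightarrow> complex) set" where
  "periodic_L2 = {f. f \<in> borel_measurable lebesgue \<and> (\<forall>x. f (x + 1) = f x) \<and>
     set_integrable lebesgue {0..1} (\<lambda>x. (cmod (f x))\<^sup>2)}"

definition L2_inner :: "(real \<Rightarrow> complex) \<Rightarrow> (real \<Rightarrow> complex) \<Rightarrow> complex" where
  "L2_inner f g = (LINT x:{0..1}|lebesgue. f x * cnj (g x))"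

definition L2_norm :: "(real \<Rightarrow> complex) \<Rightarrow> real" where
  "L2_norm f = sqrt (Re (L2_inner f f))"

definition fourier_coeff :: "(real \<Rightarrow> complex) \<Rightarrow> int \<Rightarrow> complex" where
  "fourier_coeff f k = (LINT x:{0..1}|lebesgue. f x * exp (- 2 * pi * \<i> * of_int k * of_real x))"

definition parseval_frame :: "'i set \<Rightarrow> ('i \<Rightarrow> real \<Rightarrow> complex) \<Rightarrow> bool" where
  "parseval_frame I F \<longleftrightarrow> (\<forall>i\<in>I. F i \<in> periodic_L2) \<and>
     (\<forall>f\<in>periodic_L2. ((\<lambda>i. (cmod (L2_inner f (F i)))\<^sup>2) has_sum (L2_norm f)\<^sup>2) I)"


text \<open>
  Both variances take values in the extended reals: the angular variance is infinite when
  \<open>\<Sum>\<^sub>k c\<^sub>k cnj c\<^sub>k\<^sub>+\<^sub>1 = 0\<close>, and the frequency variance when \<open>\<Sum>\<^sub>k k\<^sup>2 |c\<^sub>k|\<^sup>2\<close> diverges.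
  If either is infinite, so is \<open>UC\<close>; in particular \<open>UC f = \<infinity>\<close> in the undefined case
  \<open>\<infinity> * 0\<close>, which for nonzero \<open>f\<close> occurs exactly for a single exponential.
\<close>

definition var_A :: "(real \<Rightarrow> complex) \<Rightarrow> ereal" where
  "var_A f = (let c = fourier_coeff f;
                  N = (\<Sum>\<^sub>\<infinity>k. (cmod (c k))\<^sup>2);
                  C = (\<Sum>\<^sub>\<infinity>k. c k * cnj (c (k + 1)))
     in if C = 0 then \<infinity> else ereal (1 / (4 * pi\<^sup>2) * (N\<^sup>2 / (cmod C)\<^sup>2 - 1)))"

definition var_F :: "(real \<Rightarrow> complex) \<Rightarrow> ereal" where
  "var_F f = (let c = fourier_coeff f;
                  N = (\<Sum>\<^sub>\<infinity>k. (cmod (c k))\<^sup>2);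
                  M1 = (\<Sum>\<^sub>\<infinity>k. of_int k * (cmod (c k))\<^sup>2);
                  M2 = (\<Sum>\<^sub>\<infinity>k. (of_int k)\<^sup>2 * (cmod (c k))\<^sup>2)
     in if (\<lambda>k. (of_int k)\<^sup>2 * (cmod (c k))\<^sup>2 :: real) summable_on UNIV
        then ereal (4 * pi\<^sup>2 * M2 / N - 4 * pi\<^sup>2 * M1\<^sup>2 / N\<^sup>2) else \<infinity>)"

definition UC :: "(real \<Rightarrow> complex) \<Rightarrow> ereal" where
  "UC f = (if var_A f = \<infinity> \<or> var_F f = \<infinity> then \<infinity>
           else ereal (sqrt (real_of_ereal (var_A f) * real_of_ereal (var_F f))))"


definition xi_hat :: "(nat \<Rightarrow> int \<Rightarrow> real) \<Rightarrow> nat \<Rightarrow> int \<Rightarrow> real" where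
  "xi_hat \<nu> j k = (\<Prod>r. \<nu> (j + 1 + r) k)"

definition phi_hat :: "(nat \<Rightarrow> int \<Rightarrow> real) \<Rightarrow> nat \<Rightarrow> int \<Rightarrow> real" where
  "phi_hat \<nu> j k = 2 powr (- real j / 2) * xi_hat \<nu> j k"

definition scaling_mask :: "(nat \<Rightarrow> int \<Rightarrow> real) \<Rightarrow> nat \<Rightarrow> int \<Rightarrow> real" where
  "scaling_mask \<nu> j k = sqrt 2 * \<nu> j k"

definition wavelet_mask :: "(nat \<Rightarrow> int \<Rightarrow> real) \<Rightarrow> nat \<Rightarrow> int \<Rightarrow> complex" where
  "wavelet_mask \<nu> j k =
     exp (2 * pi * \<i> * of_int k / 2 ^ j) * of_real (scaling_mask \<nu> j (k + 2 ^ (j - 1)))"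

definition psi_hat :: "(nat \<Rightarrow> int \<Rightarrow> real) \<Rightarrow> nat \<Rightarrow> int \<Rightarrow> complex" where
  "psi_hat \<nu> j k = wavelet_mask \<nu> (j + 1) k * of_real (phi_hat \<nu> (j + 1) k)"

text \<open>
  The quadrature mirror condition is \<open>|\<mu>\<^sub>k|\<^sup>2 + |\<mu>\<^sub>l|\<^sup>2 = 2\<close> for the scaling mask
  \<open>\<mu> = sqrt 2 * \<nu> j\<close> and \<open>l = k + 2 ^ (j - 1)\<close>. The formula for the coefficients of
  \<open>\<phi> j\<close> is imposed for \<open>j = 0\<close> too, which is the refinement equation between
  \<open>\<phi> 0\<close> and \<open>\<phi> 1\<close>. Level \<open>0\<close> of \<open>\<nu>\<close> is not used.
\<close>

definition periodic_wavelets ::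
    "(nat \<Rightarrow> int \<Rightarrow> real) \<Rightarrow> (nat \<Rightarrow> real \<Rightarrow> complex) \<Rightarrow> (nat \<Rightarrow> real \<Rightarrow> complex) \<Rightarrow> bool" where
  "periodic_wavelets \<nu> \<phi> \<psi> \<longleftrightarrow>
     (\<forall>j\<ge>1. \<forall>k. \<nu> j (k + 2 ^ j) = \<nu> j k) \<and>
     (\<forall>j\<ge>1. \<forall>k. (\<nu> j k)\<^sup>2 + (\<nu> j (k + 2 ^ (j - 1)))\<^sup>2 = 1) \<and>
     (\<forall>j k. convergent_prod (\<lambda>r. \<nu> (j + 1 + r) k)) \<and>
     (\<forall>j. \<phi> j \<in> periodic_L2 \<and> (\<forall>k. fourier_coeff (\<phi> j) k = of_real (phi_hat \<nu> j k))) \<and>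
     (\<forall>j. \<psi> j \<in> periodic_L2 \<and> (\<forall>k. fourier_coeff (\<psi> j) k = psi_hat \<nu> j k))"

text \<open>\<open>None\<close> indexes \<open>\<phi> 0\<close>, and \<open>Some (j, k)\<close> the \<open>k\<close>-th shift of \<open>\<psi> j\<close>.\<close>

definition system_index :: "(nat \<times> nat) option set" where
  "system_index = insert None (Some ` {(j, k). k < 2 ^ j})"

definition wavelet_system ::
    "(nat \<Rightarrow> real \<Rightarrow> complex) \<Rightarrow> (nat \<Rightarrow> real \<Rightarrow> complex) \<Rightarrow> (nat \<times> nat) option \<Rightarrow> real \<Rightarrow> complex" where
  "wavelet_system \<phi> \<psi> i =
     (case i of None \<Rightarrow> \<phi> 0 | Some (j, k) \<Rightarrow> (\<lambda>x. \<psi> j (x - real k / 2 ^ j)))"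


text \<open>\<open>m\<close> is the representative of \<open>k\<close> modulo \<open>2 ^ j\<close> in
  \<open>{- 2 ^ (j - 2) + 1..3 * 2 ^ (j - 2)}\<close>.\<close>

definition nu :: "real \<Rightarrow> nat \<Rightarrow> int \<Rightarrow> real" where
  "nu a j k =
     (if j \<le> 1 then sqrt (1 / 2)
      else let m = (k + 2 ^ (j - 2) - 1) mod 2 ^ j - 2 ^ (j - 2) + 1
        in if m \<le> 2 ^ (j - 2)
           then exp (- ((of_int m)\<^sup>2 + a\<^sup>2) / (real j * (real j - 1) * a))
           else sqrt (1 - exp (- 2 * ((of_int m - 2 ^ (j - 1))\<^sup>2 + a\<^sup>2)
                               / (real j * (real j - 1) * a))))"

end

theory Submission
  imports Defs "HOL-Probability.Sinc_Integral"
begin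

text \<open>
  The frame property comes from the quadrature mirror condition. Write \<open>Q\<^sub>j\<close> for the sum of
  \<open>\<bar>(f, \<phi>\<^sub>j (x - 2\<^sup>-\<^sup>j k))\<bar>\<^sup>2\<close> over the \<open>2 ^ j\<close> translates, called \<open>fold_energy j\<close> below. In terms of
  Fourier coefficients, grouped by residue classes, the step from level \<open>j + 1\<close> to level \<open>j\<close> is a
  rotation in each pair of classes, so the wavelets of level \<open>j\<close> carry exactly
  \<open>Q\<^sub>j\<^sub>+\<^sub>1 - Q\<^sub>j\<close> (\<open>fold_energy_step\<close>). Since \<open>Q\<^sub>j\<close> tends to \<open>\<parallel>f\<parallel>\<^sup>2\<close>
  (\<open>fold_energy_LIMSEQ\<close>, \<open>parseval\<close>), the energies telescope.

  For the uncertainty constants, the exponents of the masks telescope: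
  \<open>\<Sum>\<^sub>r\<^sub>>\<^sub>j 1 / (r (r - 1)) = 1 / j\<close>. On the window \<open>\<bar>k\<bar> < 2 ^ (j - 1)\<close> the coefficients of
  \<open>\<phi>\<^sub>j\<close> are therefore proportional to \<open>exp (- k\<^sup>2 / (a j))\<close>, samples of \<open>exp (- u\<^sup>2)\<close> at spacing
  \<open>1 / s\<close> with \<open>s = sqrt (a j)\<close>, and outside the window they are negligible as long as
  \<open>a \<le> j\<close> (\<open>xi_nu_tail\<close>). All sums in the uncertainty constant are Riemann sums, so it tends to
  \<open>sqrt ((\<integral>f'\<^sup>2) (\<integral>x\<^sup>2 f\<^sup>2)) / \<integral>f\<^sup>2\<close> for the limiting profile \<open>f\<close>
  (\<open>profile_UC_LIMSEQ\<close>). For \<open>exp (- u\<^sup>2)\<close> this is \<open>1 / 2\<close>. The wavelet coefficients carry the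
  additional factor \<open>sqrt (1 - exp (- 2 (k\<^sup>2 + a\<^sup>2) / (j (j + 1) a)))\<close>, which to leading order is
  proportional to \<open>\<bar>k\<bar>\<close>; the profile is \<open>\<bar>u\<bar> exp (- u\<^sup>2)\<close>, and the value is \<open>3 / 2\<close>.

  The limit \<open>1 / 2\<close> is uniform over \<open>1 < a \<le> j\<close> (\<open>phi_profile_UC_uniform\<close>), because convergence is
  shown along arbitrary sequences of such pairs. This settles bounded ranges of \<open>a\<close>. For the suprema
  over all \<open>a > 1\<close> or all \<open>j \<ge> 1\<close>, the masks of all levels up to \<open>J = \<lceil>a\<rceil>\<close> are replaced by the
  constant \<open>sqrt (1 / 2)\<close>, which still satisfies the quadrature mirror condition. Then \<open>\<phi>\<^sub>j\<close> with
  \<open>j < J\<close> is a multiple of \<open>\<phi>\<^sub>J\<close>, and \<open>\<psi>\<^sub>j\<close> with \<open>j < J\<close> is a multiple of a translate of \<open>\<phi>\<^sub>J\<close>. The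
  uncertainty constant is unaffected by multiples and translates, and \<open>a \<le> J\<close>, so every case reduces
  to the uniform estimate.
\<close>

section \<open>Exponentials and square integrable functions on the unit interval\<close>

abbreviation unit_leb :: "real measure" where
  "unit_leb \<equiv> lebesgue_on {0..1::real}"

definition char_exp :: "int \<Rightarrow> real \<Rightarrow> complex" where
  "char_exp k x = exp (2 * pi * \<i> * of_int k * of_real x)"

lemma char_exp_add: "char_exp (k + l) x = char_exp k x * char_exp l x"
  by (simp add: char_exp_def exp_add [symmetric] algebra_simps)

lemma cnj_char_exp: "cnj (char_exp k x) = char_exp (- k) x"
  by (simp add: char_exp_def exp_cnj)

lemma norm_char_exp [simp]: "cmod (char_exp k x) = 1"
  by (simp add: char_exp_def norm_exp_eq_Re)

lemma char_exp_0 [simp]: "char_exp 0 x = 1"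
  by (simp add: char_exp_def)

lemma char_exp_shift: "char_exp k (x - s) = char_exp k x * char_exp (- k) s"
  by (simp add: char_exp_def exp_add [symmetric] algebra_simps)

lemma char_exp_periodic: "char_exp k (x + 1) = char_exp k x"
proof -
  have "exp (2 * pi * \<i> * of_int k) = (1 :: complex)"
    by (auto simp: exp_eq_1 intro!: exI[of _ k])
  then show ?thesis
    by (simp add: char_exp_def exp_add ring_distribs)
qed

lemma continuous_on_char_exp [continuous_intros]: "continuous_on S (char_exp k)"
  unfolding char_exp_def [abs_def] by (intro continuous_intros)

lemma finite_measure_unit_leb: "finite_measure unit_leb"
  by (rule finite_measureI) (simp add: emeasure_restrict_space)

interpretation unit_leb: finite_measure unit_leb
  by (rule finite_measure_unit_leb)

lemma continuous_measurable_unit_leb: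
  fixes f :: "real \<Rightarrow> 'a::euclidean_space"
  assumes "continuous_on {0..1} f"
  shows "f \<in> borel_measurable unit_leb"
  using assms by (intro continuous_imp_measurable_on_sets_lebesgue) auto

lemma char_exp_measurable [measurable]: "char_exp k \<in> borel_measurable unit_leb"
  by (intro continuous_measurable_unit_leb continuous_intros)

lemma LINT_unit: "(LINT x:{0..1}|lebesgue. f x) = (\<integral>x. f x \<partial>unit_leb)"
  for f :: "real \<Rightarrow> 'a::{banach, second_countable_topology}"
  by (simp add: set_lebesgue_integral_def integral_restrict_space)

lemma L2_inner_unit: "L2_inner f g = (\<integral>x. f x * cnj (g x) \<partial>unit_leb)"
  by (simp add: L2_inner_def LINT_unit)

lemma fourier_coeff_unit: "fourier_coeff f k = (\<integral>x. f x * cnj (char_exp k x) \<partial>unit_leb)"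
  by (simp add: fourier_coeff_def LINT_unit cnj_char_exp) (simp add: char_exp_def)

abbreviation sq_dist :: "(real \<Rightarrow> complex) \<Rightarrow> (real \<Rightarrow> complex) \<Rightarrow> real" where
  "sq_dist f g \<equiv> (\<integral>x. (cmod (f x - g x))\<^sup>2 \<partial>unit_leb)"

definition sq_int :: "(real \<Rightarrow> complex) \<Rightarrow> bool" where
  "sq_int f \<longleftrightarrow> f \<in> borel_measurable unit_leb \<and> integrable unit_leb (\<lambda>x. (cmod (f x))\<^sup>2)"

lemma periodic_L2_sq_int: "f \<in> periodic_L2 \<Longrightarrow> sq_int f"
  unfolding periodic_L2_def sq_int_def set_integrable_def
  by (auto simp: integrable_restrict_space measurable_restrict_space1)

lemma borel_measurable_cnj [measurable]: "cnj \<in> borel_measurable borel"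
  by (intro borel_measurable_continuous_onI continuous_intros)

lemma sq_int_mult:
  assumes "sq_int f" "sq_int g"
  shows "integrable unit_leb (\<lambda>x. f x * cnj (g x))"
proof (rule Bochner_Integration.integrable_bound)
  show "integrable unit_leb (\<lambda>x. (cmod (f x))\<^sup>2 + (cmod (g x))\<^sup>2)"
    using assms by (auto simp: sq_int_def)
  have [measurable]: "f \<in> borel_measurable unit_leb" "g \<in> borel_measurable unit_leb"
    using assms by (auto simp: sq_int_def)
  have [measurable]: "(\<lambda>x. cnj (g x)) \<in> borel_measurable unit_leb"
    by (rule measurable_compose[OF _ borel_measurable_cnj]) fact
  show "(\<lambda>x. f x * cnj (g x)) \<in> borel_measurable unit_leb"
    by measurable
  have "a * b \<le> a\<^sup>2 + b\<^sup>2" if "a \<ge> 0" "b \<ge> 0" for a b :: real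
    using sum_squares_bound[of a b] mult_nonneg_nonneg[OF that] by linarith
  then show "AE x in unit_leb. norm (f x * cnj (g x)) \<le> norm ((cmod (f x))\<^sup>2 + (cmod (g x))\<^sup>2)"
    by (intro AE_I2) (simp add: norm_mult)
qed

lemma sq_int_bounded:
  assumes "f \<in> borel_measurable unit_leb" "\<And>x. x \<in> {0..1} \<Longrightarrow> cmod (f x) \<le> B"
  shows "sq_int f"
proof -
  have [measurable]: "f \<in> borel_measurable unit_leb" by fact
  have "(cmod (f x))\<^sup>2 \<le> B\<^sup>2" if "x \<in> {0..1}" for x
    using assms(2)[OF that] by (intro power_mono) auto
  then have "integrable unit_leb (\<lambda>x. (cmod (f x))\<^sup>2)"
    by (intro unit_leb.integrable_const_bound[where B = "B\<^sup>2"]) auto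
  then show ?thesis
    using assms by (simp add: sq_int_def)
qed

lemma sq_int_char_exp: "sq_int (char_exp k)"
  by (rule sq_int_bounded[where B = 1]) auto

lemma cmod_add_square_le: "(cmod (a + b))\<^sup>2 \<le> 2 * (cmod a)\<^sup>2 + 2 * (cmod b)\<^sup>2"
proof -
  have "(cmod (a + b))\<^sup>2 \<le> (cmod a + cmod b)\<^sup>2"
    by (intro power_mono norm_triangle_ineq) auto
  also have "\<dots> \<le> 2 * (cmod a)\<^sup>2 + 2 * (cmod b)\<^sup>2"
    using sum_squares_bound[of "cmod a" "cmod b"] by (simp add: power2_sum)
  finally show ?thesis .
qed

lemma sq_int_add:
  assumes "sq_int f" "sq_int g"
  shows "sq_int (\<lambda>x. f x + g x)"
proof -
  have [measurable]: "f \<in> borel_measurable unit_leb" "g \<in> borel_measurable unit_leb"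
    using assms by (auto simp: sq_int_def)
  have i: "integrable unit_leb (\<lambda>x. 2 * (cmod (f x))\<^sup>2 + 2 * (cmod (g x))\<^sup>2)"
    using assms by (auto simp: sq_int_def)
  have "integrable unit_leb (\<lambda>x. (cmod (f x + g x))\<^sup>2)"
    using cmod_add_square_le by (intro Bochner_Integration.integrable_bound[OF i] AE_I2) auto
  then show ?thesis by (simp add: sq_int_def)
qed

lemma sq_int_cmult: "sq_int f \<Longrightarrow> sq_int (\<lambda>x. c * f x)"
  by (auto simp: sq_int_def norm_mult power_mult_distrib)

lemma sq_int_diff: "sq_int f \<Longrightarrow> sq_int g \<Longrightarrow> sq_int (\<lambda>x. f x - g x)"
  using sq_int_add[OF _ sq_int_cmult[of g "-1"], of f] by simp

lemma sq_int_sum: "(\<And>i. i \<in> F \<Longrightarrow> sq_int (f i)) \<Longrightarrow> sq_int (\<lambda>x. \<Sum>i\<in>F. f i x)"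
proof (induction F rule: infinite_finite_induct)
  case (insert a F)
  then show ?case using sq_int_add[of "f a"] by auto
qed (auto intro: sq_int_bounded[where B = 0])

lemma integral_char_exp: "(\<integral>x. char_exp k x \<partial>unit_leb) = (if k = 0 then 1 else 0)"
proof (cases "k = 0")
  case True
  then show ?thesis by (simp add: measure_restrict_space)
next
  case False
  define a where "a = 2 * pi * \<i> * of_int k"
  have a0: "a \<noteq> 0" using False by (simp add: a_def)
  have "((\<lambda>x. exp (a * of_real x)) has_integral (exp (a * of_real 1) / a - exp (a * of_real 0) / a)) {0..1}"
  proof (rule fundamental_theorem_of_calculus)
    fix x :: real
    have "((\<lambda>z. exp (a * z) / a) has_field_derivative exp (a * of_real x)) (at (of_real x))"
      using a0 by (auto intro!: derivative_eq_intros)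
    from has_vector_derivative_real_field[OF this, of "{0..1}"]
    show "((\<lambda>x. exp (a * of_real x) / a) has_vector_derivative exp (a * of_real x)) (at x within {0..1})"
      by simp
  qed auto
  moreover have "exp a = 1"
    by (auto simp: a_def exp_eq_1 intro!: exI[of _ k])
  ultimately have "((\<lambda>x. exp (a * of_real x)) has_integral 0) {0..1}"
    by simp
  then have "integral {0..1} (char_exp k) = 0"
    unfolding char_exp_def [abs_def] a_def by (rule integral_unique)
  moreover have "integrable unit_leb (char_exp k)"
    by (intro unit_leb.integrable_const_bound[where B = 1]) auto
  ultimately show ?thesis
    using lebesgue_integral_eq_integral[of "{0..1}" "char_exp k"] False by auto
qed

lemma char_exp_ortho:
  "(\<integral>x. char_exp k x * cnj (char_exp l x) \<partial>unit_leb) = (if k = l then 1 else 0)"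
  by (simp add: cnj_char_exp char_exp_add[symmetric] integral_char_exp)

text \<open>
  Completing the square: only the last sum depends on \<open>t\<close>. Taking \<open>t\<close> to be the Fourier
  coefficients gives Bessel's inequality, and an arbitrary \<open>t\<close> shows that the Fourier partial sum is
  the best approximation.
\<close>

lemma L2_distance_trig_poly:
  assumes f: "sq_int f" and F: "finite F"
  shows "sq_dist f (\<lambda>x. \<Sum>k\<in>F. t k * char_exp k x) =
     (\<integral>x. (cmod (f x))\<^sup>2 \<partial>unit_leb) - (\<Sum>k\<in>F. (cmod (fourier_coeff f k))\<^sup>2)
       + (\<Sum>k\<in>F. (cmod (t k - fourier_coeff f k))\<^sup>2)" (is "?L = ?R")
proof -
  let ?T = "\<lambda>x. \<Sum>k\<in>F. t k * char_exp k x"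
  let ?c = "fourier_coeff f"
  have T: "sq_int ?T"
    by (intro sq_int_sum sq_int_cmult sq_int_char_exp)
  have fT: "(\<integral>x. f x * cnj (?T x) \<partial>unit_leb) = (\<Sum>k\<in>F. cnj (t k) * ?c k)"
  proof -
    have "(\<integral>x. f x * cnj (?T x) \<partial>unit_leb) =
        (\<integral>x. (\<Sum>k\<in>F. cnj (t k) * (f x * cnj (char_exp k x))) \<partial>unit_leb)"
      by (simp add: sum_distrib_left mult_ac)
    also have "\<dots> = (\<Sum>k\<in>F. cnj (t k) * ?c k)"
      using sq_int_mult[OF f sq_int_char_exp] by (simp add: fourier_coeff_unit)
    finally show ?thesis .
  qed
  have Te: "(\<integral>x. ?T x * cnj (char_exp l x) \<partial>unit_leb) = t l" if "l \<in> F" for l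
  proof -
    have "(\<integral>x. ?T x * cnj (char_exp l x) \<partial>unit_leb) =
        (\<integral>x. (\<Sum>k\<in>F. t k * (char_exp k x * cnj (char_exp l x))) \<partial>unit_leb)"
      by (simp add: sum_distrib_left mult_ac)
    also have "\<dots> = (\<Sum>k\<in>F. t k * (if k = l then 1 else 0))"
      using sq_int_mult[OF sq_int_char_exp sq_int_char_exp] by (simp add: char_exp_ortho)
    also have "\<dots> = t l" using F that by (simp add: if_distrib cong: if_cong)
    finally show ?thesis .
  qed
  have TT: "(\<integral>x. ?T x * cnj (?T x) \<partial>unit_leb) = (\<Sum>k\<in>F. cnj (t k) * t k)"
  proof -
    have "(\<integral>x. ?T x * cnj (?T x) \<partial>unit_leb) =
        (\<integral>x. (\<Sum>k\<in>F. cnj (t k) * (?T x * cnj (char_exp k x))) \<partial>unit_leb)"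
      by (simp add: sum_distrib_left mult_ac)
    also have "\<dots> = (\<Sum>k\<in>F. cnj (t k) * t k)"
      using sq_int_mult[OF T sq_int_char_exp] Te by simp
    finally show ?thesis .
  qed
  have Tf: "(\<integral>x. ?T x * cnj (f x) \<partial>unit_leb) = (\<Sum>k\<in>F. t k * cnj (?c k))"
  proof -
    have "(\<integral>x. ?T x * cnj (f x) \<partial>unit_leb) = (\<integral>x. cnj (f x * cnj (?T x)) \<partial>unit_leb)"
      by (simp add: mult_ac)
    also have "\<dots> = cnj (\<integral>x. f x * cnj (?T x) \<partial>unit_leb)"
      by (rule Bochner_Integration.integral_cnj)
    also have "\<dots> = (\<Sum>k\<in>F. t k * cnj (?c k))"
      unfolding fT by simp
    finally show ?thesis .
  qed
  have sq: "complex_of_real (\<integral>x. (cmod (g x))\<^sup>2 \<partial>unit_leb) = (\<integral>x. g x * cnj (g x) \<partial>unit_leb)" for g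
    by (simp only: integral_complex_of_real[symmetric] complex_norm_square)
  have "complex_of_real ?L = (\<integral>x. (f x - ?T x) * cnj (f x - ?T x) \<partial>unit_leb)"
    by (rule sq)
  also have "\<dots> = (\<integral>x. f x * cnj (f x) - f x * cnj (?T x) - ?T x * cnj (f x) + ?T x * cnj (?T x) \<partial>unit_leb)"
    by (simp add: algebra_simps)
  also have "\<dots> = (\<integral>x. f x * cnj (f x) \<partial>unit_leb) - (\<Sum>k\<in>F. cnj (t k) * ?c k)
       - (\<Sum>k\<in>F. t k * cnj (?c k)) + (\<Sum>k\<in>F. cnj (t k) * t k)"
    using sq_int_mult[OF f f] sq_int_mult[OF f T] sq_int_mult[OF T f] sq_int_mult[OF T T]
    by (simp add: fT Tf TT del: complex_cnj_mult cnj_sum)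
  also have "\<dots> = (\<integral>x. f x * cnj (f x) \<partial>unit_leb) - (\<Sum>k\<in>F. ?c k * cnj (?c k))
       + (\<Sum>k\<in>F. (t k - ?c k) * cnj (t k - ?c k))"
    by (simp add: algebra_simps sum.distrib sum_subtractf)
  also have "\<dots> = complex_of_real ?R"
    by (simp only: sq complex_norm_square of_real_add of_real_diff of_real_sum)
  finally show ?thesis
    using of_real_eq_iff by blast
qed

section \<open>Density of trigonometric polynomials and Parseval's identity\<close>

definition trig_poly :: "(real \<Rightarrow> complex) \<Rightarrow> bool" where
  "trig_poly T \<longleftrightarrow> (\<exists>F t. finite F \<and> T = (\<lambda>x. \<Sum>k\<in>F. t k * char_exp k x))"

lemma trig_poly_monomial: "trig_poly (\<lambda>x. c * char_exp k x)"
  unfolding trig_poly_def by (intro exI[of _ "{k}"] exI[of _ "\<lambda>_. c"]) auto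

lemma trig_poly_const: "trig_poly (\<lambda>x. c)"
  using trig_poly_monomial[of c 0] by simp

lemma trig_poly_add:
  assumes "trig_poly S" "trig_poly T"
  shows "trig_poly (\<lambda>x. S x + T x)"
proof -
  from assms obtain F s G t where F: "finite F" "S = (\<lambda>x. \<Sum>k\<in>F. s k * char_exp k x)"
    and G: "finite G" "T = (\<lambda>x. \<Sum>k\<in>G. t k * char_exp k x)"
    unfolding trig_poly_def by auto
  let ?u = "\<lambda>k. (if k \<in> F then s k else 0) + (if k \<in> G then t k else 0)"
  have "S x + T x = (\<Sum>k\<in>F \<union> G. ?u k * char_exp k x)" for x
  proof -
    have "(\<Sum>k\<in>F \<union> G. ?u k * char_exp k x) =
        (\<Sum>k\<in>F \<union> G. (if k \<in> F then s k * char_exp k x else 0)) +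
        (\<Sum>k\<in>F \<union> G. (if k \<in> G then t k * char_exp k x else 0))"
      unfolding sum.distrib[symmetric] by (intro sum.cong) (auto simp: ring_distribs)
    also have "\<dots> = S x + T x"
      using F(1) G(1) by (simp add: F(2) G(2) sum.If_cases Int_absorb1)
    finally show ?thesis by simp
  qed
  then show ?thesis
    unfolding trig_poly_def using F(1) G(1)
    by (intro exI[of _ "F \<union> G"] exI[of _ ?u]) auto
qed

lemma trig_poly_sum: "(\<And>i. i \<in> A \<Longrightarrow> trig_poly (f i)) \<Longrightarrow> trig_poly (\<lambda>x. \<Sum>i\<in>A. f i x)"
proof (induction A rule: infinite_finite_induct)
  case (insert a A)
  then show ?case using trig_poly_add[of "f a"] by auto
qed (auto intro: trig_poly_const)

lemma trig_poly_mult: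
  assumes "trig_poly S" "trig_poly T"
  shows "trig_poly (\<lambda>x. S x * T x)"
proof -
  from assms obtain F s G t where F: "finite F" "S = (\<lambda>x. \<Sum>k\<in>F. s k * char_exp k x)"
    and G: "finite G" "T = (\<lambda>x. \<Sum>k\<in>G. t k * char_exp k x)"
    unfolding trig_poly_def by auto
  have "S x * T x = (\<Sum>k\<in>F. \<Sum>l\<in>G. (s k * t l) * char_exp (k + l) x)" for x
    by (simp add: F(2) G(2) sum_product char_exp_add mult_ac)
  then show ?thesis
    by (simp add: trig_poly_sum trig_poly_monomial)
qed

lemma trig_poly_sq_int: "trig_poly T \<Longrightarrow> sq_int T"
  unfolding trig_poly_def by (auto intro!: sq_int_sum sq_int_cmult sq_int_char_exp)

lemma trig_poly_cos_sin:
  "trig_poly (\<lambda>x. complex_of_real (Re (char_exp 1 x)))"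
  "trig_poly (\<lambda>x. complex_of_real (Im (char_exp 1 x)))"
proof -
  have "complex_of_real (Re (char_exp 1 x)) = 1/2 * char_exp 1 x + 1/2 * char_exp (-1) x" for x
    by (simp add: cnj_char_exp[symmetric] complex_eq_iff)
  then show "trig_poly (\<lambda>x. complex_of_real (Re (char_exp 1 x)))"
    using trig_poly_add[OF trig_poly_monomial trig_poly_monomial] by presburger
  have "complex_of_real (Im (char_exp 1 x)) = -\<i>/2 * char_exp 1 x + \<i>/2 * char_exp (-1) x" for x
    by (simp add: cnj_char_exp[symmetric] complex_eq_iff)
  then show "trig_poly (\<lambda>x. complex_of_real (Im (char_exp 1 x)))"
    using trig_poly_add[OF trig_poly_monomial trig_poly_monomial] by presburger
qed

text \<open>
  A linear functional of \<open>char_exp 1 x\<close> combines its real and imaginary parts, and trigonometric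
  polynomials are closed under sums and products.
\<close>

lemma trig_poly_real_polynomial:
  fixes p :: "complex \<Rightarrow> real"
  assumes "real_polynomial_function p"
  shows "trig_poly (\<lambda>x. complex_of_real (p (char_exp 1 x)))"
  using assms
proof (induction p rule: real_polynomial_function.induct)
  case (linear f)
  then have lin: "linear f" by (rule bounded_linear.linear)
  have "f z = Re z * f 1 + Im z * f \<i>" for z
  proof -
    have "f z = f (Re z *\<^sub>R 1 + Im z *\<^sub>R \<i>)"
      by (rule arg_cong[of _ _ f]) (simp add: complex_eq_iff)
    then show ?thesis by (simp add: linear_add[OF lin] linear_scale[OF lin])
  qed
  then have "(\<lambda>x. complex_of_real (f (char_exp 1 x))) =
      (\<lambda>x. of_real (f 1) * of_real (Re (char_exp 1 x)) + of_real (f \<i>) * of_real (Im (char_exp 1 x)))"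
    by (metis (no_types, opaque_lifting) mult.commute of_real_add of_real_mult)
  then show ?case
    by (simp only: trig_poly_add[OF trig_poly_mult[OF trig_poly_const trig_poly_cos_sin(1)]
          trig_poly_mult[OF trig_poly_const trig_poly_cos_sin(2)]])
next
  case (const c)
  then show ?case by (rule trig_poly_const)
next
  case (add f g)
  then show ?case unfolding of_real_add by (intro trig_poly_add)
next
  case (mult f g)
  then show ?case unfolding of_real_mult by (intro trig_poly_mult)
qed

text \<open>
  By the boundary condition, \<open>g\<close> is a continuous function on the circle, where Stone--Weierstrass
  gives a real polynomial in the two coordinates, that is, in \<open>cos (2 \<pi> x)\<close> and \<open>sin (2 \<pi> x)\<close>.
\<close>

lemma trig_poly_uniformly_dense:
  fixes g :: "real \<Rightarrow> complex"
  assumes g: "continuous_on {0..1} g" "g 0 = g 1" and e: "e > 0"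
  obtains T where "trig_poly T" "\<And>x. x \<in> {0..1} \<Longrightarrow> cmod (g x - T x) < e"
proof -
  let ?G = "g \<circ> (\<lambda>z. Arg2pi z / (2 * pi))"
  have "homotopic_loops UNIV g g"
    using g by (simp add: homotopic_loops_refl path_def pathstart_def pathfinish_def)
  then have G: "continuous_on (sphere 0 1) ?G"
    by (rule homotopic_with_imp_continuous[OF homotopic_loops_imp_homotopic_circlemaps, THEN conjunct1])
  obtain P where P: "polynomial_function P" "\<And>z. z \<in> sphere 0 1 \<Longrightarrow> cmod (?G z - P z) < e"
    using Stone_Weierstrass_polynomial_function[OF compact_sphere G e] by metis
  have Re: "real_polynomial_function (\<lambda>z. Re (P z))" and Im: "real_polynomial_function (\<lambda>z. Im (P z))"
    using P(1) by (auto simp: polynomial_function_iff_Basis_inner Basis_complex_def)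
  define T where "T x = P (char_exp 1 x)" for x
  have "T = (\<lambda>x. of_real (Re (P (char_exp 1 x))) + \<i> * of_real (Im (P (char_exp 1 x))))"
    unfolding T_def fun_eq_iff using complex_eq by blast
  then have "trig_poly T"
    using trig_poly_add[OF trig_poly_real_polynomial[OF Re]
        trig_poly_mult[OF trig_poly_const[of \<i>] trig_poly_real_polynomial[OF Im]]]
    by simp
  moreover have "cmod (g x - T x) < e" if x: "x \<in> {0..1}" for x
  proof -
    have "?G (char_exp 1 x) = g x"
    proof (cases "x = 1")
      case True
      moreover have "Arg2pi (char_exp 1 1) = 0"
        using char_exp_periodic[of 1 0] Arg2pi_of_real[of 1] by (simp add: char_exp_def)
      ultimately show ?thesis using g(2) by simp
    next
      case False
      have "Arg2pi (char_exp 1 x) = 2 * pi * x"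
        using x False by (intro Arg2pi_unique[where r = 1]) (auto simp: char_exp_def mult_ac)
      then show ?thesis by simp
    qed
    then show ?thesis
      using P(2)[of "char_exp 1 x"] by (simp add: T_def)
  qed
  ultimately show ?thesis using that by blast
qed

lemma L2_triangle:
  assumes f: "sq_int f" and g: "sq_int g" and h: "sq_int h"
  shows "sq_dist f h \<le>
    2 * sq_dist f g + 2 * sq_dist g h"
proof -
  have i: "integrable unit_leb (\<lambda>x. (cmod (f x - h x))\<^sup>2)" "integrable unit_leb (\<lambda>x. (cmod (f x - g x))\<^sup>2)"
    "integrable unit_leb (\<lambda>x. (cmod (g x - h x))\<^sup>2)"
    using sq_int_diff f g h by (auto simp: sq_int_def)
  from cmod_add_square_le[of "f x - g x" "g x - h x" for x]
  have "sq_dist f h \<le>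
      (\<integral>x. 2 * (cmod (f x - g x))\<^sup>2 + 2 * (cmod (g x - h x))\<^sup>2 \<partial>unit_leb)"
    using i by (intro integral_mono) auto
  then show ?thesis using i by simp
qed

text \<open>The truncation errors tend to zero pointwise and are dominated by \<open>\<bar>f\<bar>\<close>.\<close>

lemma truncation_L2_dense:
  assumes f: "sq_int f" and e: "e > 0"
  obtains h B where "sq_int h" "B > 0" "\<And>x. cmod (h x) \<le> B" "sq_dist f h < e"
proof -
  have [measurable]: "f \<in> borel_measurable unit_leb" using f by (simp add: sq_int_def)
  define h where "h n x = (if cmod (f x) \<le> real n then f x else 0)" for n :: nat and x
  have hm [measurable]: "h n \<in> borel_measurable unit_leb" for n
    unfolding h_def [abs_def] by measurable
  have "(\<lambda>n. sq_dist f (h n)) \<longlonglongrightarrow> (\<integral>x. 0 \<partial>unit_leb)"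
  proof (rule integral_dominated_convergence[where w = "\<lambda>x. (cmod (f x))\<^sup>2"])
    show "integrable unit_leb (\<lambda>x. (cmod (f x))\<^sup>2)" using f by (simp add: sq_int_def)
    show "AE x in unit_leb. (\<lambda>n. (cmod (f x - h n x))\<^sup>2) \<longlonglongrightarrow> 0"
    proof (rule AE_I2)
      fix x
      have "\<forall>\<^sub>F n in sequentially. (cmod (f x - h n x))\<^sup>2 = 0"
        using eventually_ge_at_top[of "nat \<lceil>cmod (f x)\<rceil>"]
        by eventually_elim (auto simp: h_def nat_le_iff ceiling_le_iff)
      then show "(\<lambda>n. (cmod (f x - h n x))\<^sup>2) \<longlonglongrightarrow> 0" by (rule tendsto_eventually)
    qed
  qed (auto simp: h_def)
  then have "\<forall>\<^sub>F n in sequentially. sq_dist f (h n) < e"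
    using order_tendstoD(2)[of _ 0, OF _ e] by simp
  then obtain n where n: "sq_dist f (h n) < e"
    using eventually_happens'[OF sequentially_bot] by blast
  have b: "cmod (h n x) \<le> real n + 1" for x by (auto simp: h_def)
  show ?thesis
    using that[of "h n" "real n + 1"] n b sq_int_bounded[OF hm b] by auto
qed

text \<open>
  The approximants come from pointwise almost everywhere limits of continuous functions.
  Retracting onto a ball keeps them bounded, and the factor that vanishes at both end points makes
  them continuous on the circle.
\<close>

lemma continuous_L2_dense:
  assumes h: "sq_int h" "\<And>x. cmod (h x) \<le> B" and B: "B > 0" and e: "e > 0"
  obtains g where "continuous_on {0..1} g" "g 0 = 0" "g 1 = 0" "sq_int g"
    "sq_dist h g < e"
proof -
  have [measurable]: "h \<in> borel_measurable unit_leb" using h by (simp add: sq_int_def)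
  have "h measurable_on {0..1}"
    using measurable_on_iff_borel_measurable[of "{0..1}" h] by simp
  then obtain N u where N: "negligible N" and u: "\<And>n. continuous_on UNIV (u n)"
    "\<And>x. x \<notin> N \<Longrightarrow> (\<lambda>n. u n x) \<longlonglongrightarrow> (if x \<in> {0..1} then h x else 0)"
    unfolding measurable_on_def by blast
  define r where "r = closest_point (cball (0::complex) B)"
  have ne: "cball (0::complex) B \<noteq> {}" using B by simp
  have r_cont: "continuous_on UNIV r"
    unfolding r_def using ne by (intro continuous_on_closest_point) auto
  have r_bd: "cmod (r z) \<le> B" for z
    using closest_point_in_set[OF closed_cball ne, of z] by (simp add: r_def)
  have r_id: "r z = z" if "cmod z \<le> B" for z
    using that by (simp add: r_def closest_point_self)
  define w where "w n x = min 1 (real n * min x (1 - x))" for n :: nat and x :: real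
  define g where "g n x = of_real (w n x) * r (u n x)" for n x
  have g_cont: "continuous_on {0..1} (g n)" for n
    unfolding g_def w_def
    by (intro continuous_intros continuous_on_compose2[OF r_cont] continuous_on_subset[OF u(1)]) auto
  have g_bd: "cmod (g n x) \<le> B" if "x \<in> {0..1}" for n x
  proof -
    have "\<bar>w n x\<bar> \<le> 1" using that by (auto simp: w_def)
    then have "cmod (g n x) \<le> 1 * B"
      unfolding g_def norm_mult norm_of_real using r_bd by (intro mult_mono) auto
    then show ?thesis by simp
  qed
  have g_sq: "sq_int (g n)" for n
    by (rule sq_int_bounded[where B = B]) (auto intro: continuous_measurable_unit_leb g_cont g_bd)
  then have gm [measurable]: "g n \<in> borel_measurable unit_leb" for n
    by (simp add: sq_int_def)
  have lim: "(\<lambda>n. g n x) \<longlonglongrightarrow> h x" if x: "x \<in> {0<..<1}" "x \<notin> N" for x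
  proof -
    have "(\<lambda>n. u n x) \<longlonglongrightarrow> h x" using u(2)[OF x(2)] x(1) by auto
    then have r_lim: "(\<lambda>n. r (u n x)) \<longlonglongrightarrow> r (h x)"
      using r_cont by (intro continuous_on_tendsto_compose[OF r_cont]) auto
    define m where "m = min x (1 - x)"
    have "m > 0" using x by (auto simp: m_def)
    then have "\<forall>\<^sub>F n in sequentially. real n * m \<ge> 1"
      by real_asymp
    then have "\<forall>\<^sub>F n in sequentially. w n x = 1"
      by eventually_elim (auto simp: w_def m_def)
    then have "(\<lambda>n. complex_of_real (w n x)) \<longlonglongrightarrow> 1"
      by (intro tendsto_eventually) (auto elim: eventually_mono)
    from tendsto_mult[OF this r_lim] show ?thesis
      by (simp add: g_def r_id h)
  qed
  have AE: "AE x in unit_leb. (\<lambda>n. g n x) \<longlonglongrightarrow> h x"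
  proof -
    have "negligible (N \<union> {0, 1})" using N by (simp add: negligible_Un)
    then have "N \<union> {0, 1} \<in> null_sets lebesgue"
      by (simp only: negligible_iff_null_sets)
    then have "AE x in lebesgue. x \<notin> N \<union> {0, 1}"
      by (rule AE_not_in)
    then have "AE x in lebesgue. x \<in> {0..1} \<longrightarrow> (\<lambda>n. g n x) \<longlonglongrightarrow> h x"
      by eventually_elim (auto intro!: lim)
    then show ?thesis by (simp add: AE_restrict_space_iff)
  qed
  have "(\<lambda>n. sq_dist h (g n)) \<longlonglongrightarrow> (\<integral>x. 0 \<partial>unit_leb)"
  proof (rule integral_dominated_convergence[where w = "\<lambda>x. (2 * B)\<^sup>2"])
    show "AE x in unit_leb. (\<lambda>n. (cmod (h x - g n x))\<^sup>2) \<longlonglongrightarrow> 0"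
      using AE
    proof eventually_elim
      case (elim x)
      from tendsto_power[OF tendsto_norm[OF tendsto_diff[OF tendsto_const[of "h x"] elim]], of 2]
      show ?case by simp
    qed
    fix n
    show "AE x in unit_leb. norm ((cmod (h x - g n x))\<^sup>2) \<le> (2 * B)\<^sup>2"
    proof (rule AE_I2)
      fix x assume "x \<in> space unit_leb"
      then have "cmod (h x - g n x) \<le> 2 * B"
        using norm_triangle_ineq4[of "h x" "g n x"] h(2)[of x] g_bd[of x n] by simp
      then have "(cmod (h x - g n x))\<^sup>2 \<le> (2 * B)\<^sup>2" by (intro power_mono) auto
      then show "norm ((cmod (h x - g n x))\<^sup>2) \<le> (2 * B)\<^sup>2" by simp
    qed
  qed auto
  then have "\<forall>\<^sub>F n in sequentially. sq_dist h (g n) < e"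
    using order_tendstoD(2)[of _ 0, OF _ e] by simp
  then obtain n where n: "sq_dist h (g n) < e"
    using eventually_happens'[OF sequentially_bot] by blast
  show ?thesis
    using that[OF g_cont _ _ g_sq n] by (simp add: g_def w_def)
qed

lemma trig_poly_L2_dense:
  assumes f: "sq_int f" and e: "e > 0"
  obtains T where "trig_poly T" "sq_dist f T < e"
proof -
  \<comment> \<open>The two triangle inequalities below multiply the three errors by at most 4.\<close>
  have e16: "e / 16 > 0" using e by simp
  obtain h B where h: "sq_int h" "B > 0" "\<And>x. cmod (h x) \<le> B"
    "sq_dist f h < e / 16"
    using truncation_L2_dense[OF f e16] by blast
  obtain g where g: "continuous_on {0..1} g" "g 0 = 0" "g 1 = 0" "sq_int g"
    "sq_dist h g < e / 16"
    using continuous_L2_dense[OF h(1,3,2) e16] by blast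
  obtain T where T: "trig_poly T" "\<And>x. x \<in> {0..1} \<Longrightarrow> cmod (g x - T x) < sqrt (e / 16)"
    using trig_poly_uniformly_dense[of g "sqrt (e / 16)"] g e16 by auto
  have sqT: "sq_int T" using T(1) by (rule trig_poly_sq_int)
  have "sq_dist g T \<le> (\<integral>x. e / 16 \<partial>unit_leb)"
  proof (rule integral_mono)
    show "integrable unit_leb (\<lambda>x. (cmod (g x - T x))\<^sup>2)"
      using sq_int_diff[OF g(4) sqT] by (simp add: sq_int_def)
    fix x assume "x \<in> space unit_leb"
    then have "(cmod (g x - T x))\<^sup>2 \<le> (sqrt (e / 16))\<^sup>2"
      using T(2)[of x] by (intro power_mono) auto
    then show "(cmod (g x - T x))\<^sup>2 \<le> e / 16" using e by simp
  qed simp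
  also have "\<dots> = e / 16" by (simp add: measure_restrict_space)
  finally have gT: "sq_dist g T \<le> e / 16" .
  have "sq_dist f T < e"
    using L2_triangle[OF f h(1) sqT] L2_triangle[OF h(1) g(4) sqT] h(4) g(5) gT e by linarith
  then show ?thesis using that T(1) by blast
qed

text \<open>
  Bessel's inequality gives one direction. For the other one, the best approximation property turns
  the density of trigonometric polynomials into a lower bound for a finite partial sum.
\<close>

theorem parseval:
  assumes f: "sq_int f"
  shows "((\<lambda>k. (cmod (fourier_coeff f k))\<^sup>2) has_sum (\<integral>x. (cmod (f x))\<^sup>2 \<partial>unit_leb)) UNIV"
proof -
  let ?I = "\<integral>x. (cmod (f x))\<^sup>2 \<partial>unit_leb"
  have bessel: "(\<Sum>k\<in>F. (cmod (fourier_coeff f k))\<^sup>2) \<le> ?I" if "finite F" for F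
  proof -
    have "0 \<le> sq_dist f (\<lambda>x. \<Sum>k\<in>F. fourier_coeff f k * char_exp k x)"
      by (rule integral_nonneg_AE) auto
    then show ?thesis using L2_distance_trig_poly[OF f that, of "fourier_coeff f"] by simp
  qed
  have "(\<lambda>k. (cmod (fourier_coeff f k))\<^sup>2) summable_on UNIV"
    by (rule nonneg_bdd_above_summable_on) (auto intro!: bdd_aboveI2 bessel)
  then obtain S where S: "((\<lambda>k. (cmod (fourier_coeff f k))\<^sup>2) has_sum S) UNIV"
    unfolding summable_on_def by blast
  have "S \<le> ?I" by (rule has_sum_le_finite_sums[OF S]) (auto intro: bessel)
  moreover have "?I \<le> S"
  proof (rule field_le_epsilon)
    fix e :: real assume e: "e > 0"
    obtain T where T: "trig_poly T" "sq_dist f T < e"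
      using trig_poly_L2_dense[OF f e] by blast
    obtain F t where F: "finite F" "T = (\<lambda>x. \<Sum>k\<in>F. t k * char_exp k x)"
      using T(1) unfolding trig_poly_def by blast
    have "?I - (\<Sum>k\<in>F. (cmod (fourier_coeff f k))\<^sup>2) \<le> sq_dist f T"
      unfolding F(2) L2_distance_trig_poly[OF f F(1)] by (simp add: sum_nonneg)
    moreover have "(\<Sum>k\<in>F. (cmod (fourier_coeff f k))\<^sup>2) \<le> S"
      by (rule finite_sum_le_has_sum[OF S F(1)]) auto
    ultimately show "?I \<le> S + e" using T(2) by linarith
  qed
  ultimately show ?thesis using S by simp
qed

lemma parseval_norm:
  assumes "f \<in> periodic_L2"
  shows "((\<lambda>k. (cmod (fourier_coeff f k))\<^sup>2) has_sum (L2_norm f)\<^sup>2) UNIV"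
proof -
  have "L2_inner f f = of_real (\<integral>x. (cmod (f x))\<^sup>2 \<partial>unit_leb)"
    by (simp only: L2_inner_unit integral_complex_of_real[symmetric] complex_norm_square)
  then have "(L2_norm f)\<^sup>2 = (\<integral>x. (cmod (f x))\<^sup>2 \<partial>unit_leb)"
    by (simp add: L2_norm_def integral_nonneg_AE)
  then show ?thesis using parseval[OF periodic_L2_sq_int[OF assms]] by simp
qed

section \<open>Absolutely convergent Fourier series\<close>

definition trig_series :: "(int \<Rightarrow> complex) \<Rightarrow> real \<Rightarrow> complex" where
  "trig_series c x = (\<Sum>\<^sub>\<infinity>k. c k * char_exp k x)"

lemma trig_series_uniform_limit:
  assumes "(\<lambda>k. cmod (c k)) summable_on UNIV"
  shows "uniform_limit UNIV (\<lambda>F x. \<Sum>k\<in>F. c k * char_exp k x) (trig_series c) (finite_subsets_at_top UNIV)"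
  using Weierstrass_m_test_general[of UNIV UNIV "\<lambda>k x. c k * char_exp k x" "\<lambda>k. cmod (c k)"] assms
  by (simp add: trig_series_def [abs_def] norm_mult)

lemma continuous_trig_series:
  assumes "(\<lambda>k. cmod (c k)) summable_on UNIV"
  shows "continuous_on S (trig_series c)"
proof -
  have "continuous_on UNIV (trig_series c)"
    by (rule uniform_limit_theorem[OF _ trig_series_uniform_limit[OF assms]])
       (intro always_eventually allI continuous_intros, simp)
  then show ?thesis by (rule continuous_on_subset) auto
qed

lemma trig_series_shift: "trig_series c (x - s) = trig_series (\<lambda>k. c k * char_exp (- k) s) x"
  by (simp add: trig_series_def char_exp_shift mult_ac)

lemma continuous_sq_int: "continuous_on {0..1} f \<Longrightarrow> sq_int f" for f :: "real \<Rightarrow> complex"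
proof -
  assume f: "continuous_on {0..1} f"
  then have "bounded (f ` {0..1})"
    by (intro compact_imp_bounded compact_continuous_image) auto
  then obtain B where "\<And>x. x \<in> {0..1} \<Longrightarrow> cmod (f x) \<le> B"
    unfolding bounded_iff by blast
  then show "sq_int f"
    by (intro sq_int_bounded[where B = B] continuous_measurable_unit_leb f)
qed

lemma trig_series_periodic_L2:
  assumes "(\<lambda>k. cmod (c k)) summable_on UNIV"
  shows "trig_series c \<in> periodic_L2"
proof -
  have "trig_series c \<in> borel_measurable borel"
    by (intro borel_measurable_continuous_onI continuous_trig_series assms)
  then have "trig_series c \<in> borel_measurable lebesgue"
    by (auto intro: measurable_completion)
  moreover have "sq_int (trig_series c)"
    by (intro continuous_sq_int continuous_trig_series assms)
  moreover have "trig_series c (x + 1) = trig_series c x" for x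
    unfolding trig_series_def char_exp_periodic ..
  ultimately show ?thesis
    by (simp add: periodic_L2_def sq_int_def set_integrable_def integrable_restrict_space)
qed

text \<open>
  Since the series for the second factor converges uniformly, the inner product may be taken term by
  term.
\<close>

lemma L2_inner_trig_series:
  assumes f: "sq_int f" and c: "(\<lambda>k. cmod (c k)) summable_on UNIV"
  shows "((\<lambda>k. fourier_coeff f k * cnj (c k)) has_sum L2_inner f (trig_series c)) UNIV"
proof -
  let ?T = "\<lambda>F x. \<Sum>k\<in>F. c k * char_exp k x"
  have h: "sq_int (trig_series c)"
    by (intro continuous_sq_int continuous_trig_series c)
  have T: "sq_int (?T F)" for F
    by (intro sq_int_sum sq_int_cmult sq_int_char_exp)
  have fT: "(\<integral>x. f x * cnj (?T F x) \<partial>unit_leb) = (\<Sum>k\<in>F. fourier_coeff f k * cnj (c k))" for F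
  proof -
    have "(\<integral>x. f x * cnj (?T F x) \<partial>unit_leb) =
        (\<integral>x. (\<Sum>k\<in>F. cnj (c k) * (f x * cnj (char_exp k x))) \<partial>unit_leb)"
      by (simp add: sum_distrib_left mult_ac)
    also have "\<dots> = (\<Sum>k\<in>F. cnj (c k) * fourier_coeff f k)"
      using sq_int_mult[OF f sq_int_char_exp] by (simp add: fourier_coeff_unit)
    finally show ?thesis by (simp add: mult.commute)
  qed
  have [measurable]: "f \<in> borel_measurable unit_leb" using f by (simp add: sq_int_def)
  have "sq_int (\<lambda>_. 1)" by (rule sq_int_bounded[where B = 1]) auto
  from sq_int_mult[OF f this] have fi: "integrable unit_leb (\<lambda>x. cmod (f x))"
    by simp
  define A where "A = (\<integral>x. cmod (f x) \<partial>unit_leb)"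
  have A: "A \<ge> 0" by (simp add: A_def)
  have "((\<lambda>F. \<integral>x. f x * cnj (?T F x) \<partial>unit_leb) \<longlongrightarrow> L2_inner f (trig_series c)) (finite_subsets_at_top UNIV)"
  proof (rule tendstoI)
    fix e :: real assume e: "e > 0"
    have "e / (A + 1) > 0" using e A by simp
    from uniform_limitD[OF trig_series_uniform_limit[OF c] this]
    show "\<forall>\<^sub>F F in finite_subsets_at_top UNIV. dist (\<integral>x. f x * cnj (?T F x) \<partial>unit_leb) (L2_inner f (trig_series c)) < e"
    proof eventually_elim
      case (elim F)
      have "(\<integral>x. f x * cnj (?T F x) \<partial>unit_leb) - L2_inner f (trig_series c)
          = (\<integral>x. f x * cnj (?T F x) - f x * cnj (trig_series c x) \<partial>unit_leb)"
        unfolding L2_inner_unit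
        by (rule Bochner_Integration.integral_diff[symmetric]) (intro sq_int_mult f T h)+
      also have "cmod \<dots> \<le> (\<integral>x. cmod (f x * cnj (?T F x) - f x * cnj (trig_series c x)) \<partial>unit_leb)"
        by (rule integral_norm_bound)
      also have "\<dots> \<le> (\<integral>x. cmod (f x) * (e / (A + 1)) \<partial>unit_leb)"
      proof (rule integral_mono)
        show "integrable unit_leb (\<lambda>x. cmod (f x * cnj (?T F x) - f x * cnj (trig_series c x)))"
          by (intro integrable_norm Bochner_Integration.integrable_diff sq_int_mult f T h)
        fix x
        have "cmod (f x * cnj (?T F x) - f x * cnj (trig_series c x)) = cmod (f x) * cmod (?T F x - trig_series c x)"
          unfolding right_diff_distrib[symmetric] complex_cnj_diff[symmetric] norm_mult complex_mod_cnj ..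
        also have "\<dots> \<le> cmod (f x) * (e / (A + 1))"
        proof (intro mult_left_mono norm_ge_zero)
          have "dist (?T F x) (trig_series c x) < e / (A + 1)" using elim by blast
          then show "cmod (?T F x - trig_series c x) \<le> e / (A + 1)" by (simp add: dist_norm)
        qed
        finally show "cmod (f x * cnj (?T F x) - f x * cnj (trig_series c x)) \<le> cmod (f x) * (e / (A + 1))" .
      qed (use fi in auto)
      also have "\<dots> = A * (e / (A + 1))" by (simp add: A_def)
      also have "\<dots> < e" using e A by (simp add: field_simps)
      finally show ?case by (simp add: dist_norm)
    qed
  qed
  then show ?thesis
    unfolding has_sum_def fT .
qed

lemma fourier_coeff_trig_series:
  assumes c: "(\<lambda>k. cmod (c k)) summable_on UNIV"
  shows "fourier_coeff (trig_series c) k = c k"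
proof -
  have e: "fourier_coeff (char_exp k) l = (if l = k then 1 else 0)" for l
    by (auto simp: fourier_coeff_unit char_exp_ortho)
  have "((\<lambda>l. fourier_coeff (char_exp k) l * cnj (c l)) has_sum cnj (c k)) UNIV"
    unfolding e by (rule has_sum_finite_neutralI[of "{k}"]) auto
  with L2_inner_trig_series[OF sq_int_char_exp c]
  have "L2_inner (char_exp k) (trig_series c) = cnj (c k)"
    by (rule has_sum_unique)
  then have "cnj (L2_inner (char_exp k) (trig_series c)) = c k" by simp
  then show ?thesis
    unfolding L2_inner_unit fourier_coeff_unit Bochner_Integration.integral_cnj[symmetric]
    by (simp add: mult.commute)
qed

section \<open>Sums over residue classes\<close>

lemma summable_on_residue_class:
  fixes d :: "int \<Rightarrow> 'a::banach" and N :: int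
  assumes "d summable_on UNIV" "N > 0"
  shows "(\<lambda>l. d (r + N * l)) summable_on UNIV"
proof -
  have "inj (\<lambda>l. r + N * l)" using assms by (auto simp: inj_on_def)
  moreover have "d summable_on range (\<lambda>l. r + N * l)"
    using assms(1) summable_on_subset_banach by blast
  ultimately show ?thesis by (simp add: summable_on_reindex o_def)
qed

lemma has_sum_residue_classes:
  fixes d :: "int \<Rightarrow> 'a::banach" and N :: nat
  assumes d: "d summable_on UNIV" and N: "N > 0"
  shows "((\<lambda>k. d k) has_sum (\<Sum>r<N. \<Sum>\<^sub>\<infinity>l. d (int r + int N * l))) UNIV"
proof -
  have bij: "bij_betw (\<lambda>(r, l). int r + int N * l) ({..<N} \<times> UNIV) UNIV"
  proof (rule bij_betwI[where g = "\<lambda>k. (nat (k mod int N), k div int N)"])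
    show "(\<lambda>k. (nat (k mod int N), k div int N)) \<in> UNIV \<rightarrow> {..<N} \<times> UNIV"
      using N by (auto simp: nat_less_iff)
    show "(nat ((case x of (r, l) \<Rightarrow> int r + int N * l) mod int N), (case x of (r, l) \<Rightarrow> int r + int N * l) div int N) = x"
      if "x \<in> {..<N} \<times> UNIV" for x using that N by (auto simp: div_mult_self1 mod_mult_self1 split: prod.splits)
    show "(case (nat (y mod int N), y div int N) of (r, l) \<Rightarrow> int r + int N * l) = y" if "y \<in> UNIV" for y
      using N by simp
  qed auto
  obtain S where S: "(d has_sum S) UNIV" using d by (auto simp: summable_on_def)
  then have S': "((\<lambda>(r, l). d (int r + int N * l)) has_sum S) ({..<N} \<times> UNIV)"
    using has_sum_reindex_bij_betw[OF bij, of d S] by (simp add: case_prod_unfold)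
  have "((\<lambda>r. \<Sum>\<^sub>\<infinity>l. d (int r + int N * l)) has_sum S) {..<N}"
    using has_sum_SigmaD[OF S'[unfolded case_prod_unfold]] has_sum_infsum[OF summable_on_residue_class[OF d]] N by simp
  then have "S = (\<Sum>r<N. \<Sum>\<^sub>\<infinity>l. d (int r + int N * l))"
    by (simp add: has_sum_finite_iff)
  then show ?thesis using S by simp
qed

lemma infsum_split_parity:
  fixes d :: "int \<Rightarrow> 'a::banach" and N :: nat
  assumes d: "d summable_on UNIV" and N: "N > 0"
  shows "(\<Sum>\<^sub>\<infinity>l. d (r + int N * l)) =
    (\<Sum>\<^sub>\<infinity>l. d (r + 2 * int N * l)) + (\<Sum>\<^sub>\<infinity>l. d (r + int N + 2 * int N * l))"
proof -
  have "(\<lambda>l. d (r + int N * l)) summable_on UNIV"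
    using summable_on_residue_class[OF d, of "int N"] N by simp
  from has_sum_residue_classes[OF this, of 2]
  have "((\<lambda>l. d (r + int N * l)) has_sum (\<Sum>s<2. \<Sum>\<^sub>\<infinity>l. d (r + int N * (int s + 2 * l)))) UNIV"
    by simp
  from infsumI[OF this] show ?thesis
    by (simp add: numeral_2_eq_2 algebra_simps)
qed

text \<open>
  Expanding the square leaves a geometric sum over \<open>k\<close> with ratio a nontrivial \<open>N\<close>-th root of unity
  unless \<open>r = s\<close>.
\<close>

lemma finite_parseval:
  fixes E :: "nat \<Rightarrow> complex"
  assumes N: "N > 0"
  shows "(\<Sum>k<N. (cmod (\<Sum>r<N. E r * char_exp (int r) (real k / real N)))\<^sup>2) = real N * (\<Sum>r<N. (cmod (E r))\<^sup>2)"
proof -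
  let ?w = "\<lambda>r k. char_exp r (real k / real N)"
  have ortho: "(\<Sum>k<N. ?w (int r - int s) k) = (if r = s then of_nat N else 0)" if "r < N" "s < N" for r s
  proof (cases "r = s")
    case False
    define z where "z = char_exp (int r - int s) (1 / real N)"
    have pw: "?w (int r - int s) k = z ^ k" for k
      by (simp add: z_def char_exp_def exp_of_nat_mult[symmetric] mult_ac)
    have "z ^ N = char_exp (int r - int s) 1"
      using pw[of N] N by simp
    also have "\<dots> = 1" using char_exp_periodic[of "int r - int s" 0] by (simp add: char_exp_def)
    finally have zN: "z ^ N = 1" .
    have "z \<noteq> 1"
    proof
      assume "z = 1"
      then obtain n :: int where n: "2 * pi * (real_of_int (int r - int s) / real N) = of_int n * (2 * pi)"
        by (auto simp: z_def char_exp_def exp_eq_1)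
      then have "(real_of_int (int r - int s) / real N - of_int n) * (2 * pi) = 0"
        unfolding left_diff_distrib by (simp add: mult_ac)
      then have "real_of_int (int r - int s) / real N = of_int n" by simp
      then have "real_of_int (int r - int s) = of_int (n * int N)" using N by (simp add: field_simps)
      then have eq: "int r - int s = n * int N" by (simp only: of_int_eq_iff)
      then have "\<bar>n * int N\<bar> < int N" using that by linarith
      then have "\<bar>n\<bar> * int N < 1 * int N" by (simp add: abs_mult)
      then have "\<bar>n\<bar> < 1" using N by simp
      then show False using eq False by simp
    qed
    then show ?thesis
      using sum_gp_strict[of z N] zN False by (simp add: pw)
  qed simp
  have "complex_of_real (\<Sum>k<N. (cmod (\<Sum>r<N. E r * ?w (int r) k))\<^sup>2) =
      (\<Sum>k<N. \<Sum>r<N. \<Sum>s<N. E r * cnj (E s) * ?w (int r - int s) k)"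
    unfolding of_real_sum complex_norm_square cnj_sum sum_product
    by (simp add: cnj_char_exp char_exp_add[symmetric] mult_ac mult.left_commute
        flip: diff_conv_add_uminus char_exp_add)
  also have "\<dots> = (\<Sum>r<N. \<Sum>s<N. E r * cnj (E s) * (\<Sum>k<N. ?w (int r - int s) k))"
    unfolding sum_distrib_left by (subst sum.swap, rule sum.cong[OF refl], subst sum.swap, rule refl)
  also have "\<dots> = (\<Sum>r<N. \<Sum>s<N. if r = s then of_nat N * (E r * cnj (E s)) else 0)"
    by (intro sum.cong refl) (simp add: ortho)
  also have "\<dots> = complex_of_real (real N * (\<Sum>r<N. (cmod (E r))\<^sup>2))"
    unfolding of_real_mult of_real_sum complex_norm_square by (simp add: sum_distrib_left)
  finally show ?thesis by (simp only: of_real_eq_iff)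
qed

text \<open>
  The exponentials at the points \<open>k / N\<close> only see the frequency modulo \<open>N\<close>, so the coefficients of
  each residue class may be summed first. This computes the energy of the inner products with all
  \<open>2 ^ j\<close> translates of a wavelet.
\<close>

lemma modulated_sums_parseval:
  fixes e :: "int \<Rightarrow> complex"
  assumes e: "e summable_on UNIV" "(\<lambda>k. cmod (e k)) summable_on UNIV" and N: "N > 0"
  shows "(\<Sum>k<N. (cmod (\<Sum>\<^sub>\<infinity>n. e n * char_exp n (real k / real N)))\<^sup>2) =
    real N * (\<Sum>r<N. (cmod (\<Sum>\<^sub>\<infinity>l. e (int r + int N * l)))\<^sup>2)"
proof -
  have "(\<Sum>\<^sub>\<infinity>n. e n * char_exp n (real k / real N)) =
      (\<Sum>r<N. (\<Sum>\<^sub>\<infinity>l. e (int r + int N * l)) * char_exp (int r) (real k / real N))" for k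
  proof -
    let ?d = "\<lambda>n. e n * char_exp n (real k / real N)"
    have per: "char_exp (int r + int N * l) (real k / real N) = char_exp (int r) (real k / real N)" for r l
    proof -
      have "char_exp (int N * l) (real k / real N) = exp (2 * pi * \<i> * of_int (l * int k))"
        using N by (simp add: char_exp_def mult_ac)
      also have "\<dots> = 1" by (auto simp: exp_eq_1 intro!: exI[of _ "l * int k"])
      finally show ?thesis by (simp add: char_exp_add)
    qed
    have "?d summable_on UNIV"
      by (rule abs_summable_summable) (simp add: norm_mult e(2))
    from infsumI[OF has_sum_residue_classes[OF this N]] show ?thesis
      by (simp add: per infsum_cmult_left')
  qed
  then show ?thesis using finite_parseval[OF N] by simp
qed

text \<open>
  The inequality for finite partial sums survives the limit. The hypothesis on \<open>x\<close> has the form in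
  which the energy bound for the masks is obtained.
\<close>

lemma cauchy_schwarz_infsum:
  fixes d :: "'a \<Rightarrow> complex" and x :: "'a \<Rightarrow> real"
  assumes s: "(\<lambda>l. d l * of_real (x l)) summable_on A"
    and d: "(\<lambda>l. (cmod (d l))\<^sup>2) summable_on A"
    and x: "\<And>F. finite F \<Longrightarrow> F \<subseteq> A \<Longrightarrow> (\<Sum>l\<in>F. (x l)\<^sup>2) \<le> 1"
  shows "(cmod (\<Sum>\<^sub>\<infinity>l\<in>A. d l * of_real (x l)))\<^sup>2 \<le> (\<Sum>\<^sub>\<infinity>l\<in>A. (cmod (d l))\<^sup>2)"
proof -
  have "((\<lambda>F. (cmod (\<Sum>l\<in>F. d l * of_real (x l)))\<^sup>2) \<longlongrightarrow> (cmod (\<Sum>\<^sub>\<infinity>l\<in>A. d l * of_real (x l)))\<^sup>2) (finite_subsets_at_top A)"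
    using has_sum_infsum[OF s] unfolding has_sum_def by (intro tendsto_intros)
  moreover have "\<forall>\<^sub>F F in finite_subsets_at_top A. (cmod (\<Sum>l\<in>F. d l * of_real (x l)))\<^sup>2 \<le> (\<Sum>\<^sub>\<infinity>l\<in>A. (cmod (d l))\<^sup>2)"
  proof (rule eventually_finite_subsets_at_top_weakI)
    fix F assume F: "finite F" "F \<subseteq> A"
    have "cmod (\<Sum>l\<in>F. d l * of_real (x l)) \<le> (\<Sum>l\<in>F. cmod (d l) * \<bar>x l\<bar>)"
      by (rule order_trans[OF norm_sum]) (simp add: norm_mult)
    then have "(cmod (\<Sum>l\<in>F. d l * of_real (x l)))\<^sup>2 \<le> (\<Sum>l\<in>F. cmod (d l) * \<bar>x l\<bar>)\<^sup>2"
      by (intro power_mono) auto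
    also have "\<dots> \<le> (\<Sum>l\<in>F. (cmod (d l))\<^sup>2) * (\<Sum>l\<in>F. \<bar>x l\<bar>\<^sup>2)"
      by (rule Cauchy_Schwarz_ineq_sum)
    also have "\<dots> \<le> (\<Sum>l\<in>F. (cmod (d l))\<^sup>2) * 1"
      using x[OF F] by (intro mult_left_mono) (auto intro: sum_nonneg)
    also have "\<dots> \<le> (\<Sum>\<^sub>\<infinity>l\<in>A. (cmod (d l))\<^sup>2)"
      using finite_sum_le_infsum[OF d F] by simp
    finally show "(cmod (\<Sum>l\<in>F. d l * of_real (x l)))\<^sup>2 \<le> (\<Sum>\<^sub>\<infinity>l\<in>A. (cmod (d l))\<^sup>2)" .
  qed
  ultimately show ?thesis
    by (rule tendsto_upperbound) simp
qed

section \<open>Energy splitting for masks with the quadrature mirror condition\<close>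

lemma periodic_int_mult:
  fixes f :: "int \<Rightarrow> 'a"
  assumes "\<And>k. f (k + p) = f k"
  shows "f (k + p * l) = f k"
proof (induction l arbitrary: k rule: int_induct[where k = 0])
  case (step1 i)
  have "f (k + p * (i + 1)) = f ((k + p * i) + p)" by (simp add: algebra_simps)
  with step1 assms show ?case by simp
next
  case (step2 i)
  have "f (k + p * (i - 1)) = f ((k + p * (i - 1)) + p)" using assms by simp
  also have "\<dots> = f (k + p * i)" by (simp add: algebra_simps)
  finally show ?case using step2 by simp
qed simp

lemma sum_double: "(\<Sum>l<2 * M. f l) = (\<Sum>l<M. f l + f (l + M))"
  for f :: "nat \<Rightarrow> 'a::comm_monoid_add" and M :: nat
proof -
  have "(\<Sum>l<M + M. f l) = (\<Sum>l<M. f l) + (\<Sum>l=M..<M + M. f l)"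
    by (subst atLeast0LessThan[symmetric])+ (simp add: sum.atLeastLessThan_concat)
  also have "(\<Sum>l=M..<M + M. f l) = (\<Sum>l<M. f (l + M))"
    using sum.shift_bounds_nat_ivl[of f 0 M M] by (simp add: atLeast0LessThan)
  finally show ?thesis by (simp add: mult_2 sum.distrib)
qed

lemma xi_hat_LIMSEQ:
  assumes "convergent_prod (\<lambda>r. \<nu> (j + 1 + r) k)"
  shows "(\<lambda>m. \<Prod>i<m. \<nu> (j + 1 + i) k) \<longlonglongrightarrow> xi_hat \<nu> j k"
proof -
  have "(\<lambda>m. \<Prod>i\<le>m. \<nu> (j + 1 + i) k) \<longlonglongrightarrow> xi_hat \<nu> j k"
    unfolding xi_hat_def by (rule convergent_prod_LIMSEQ[OF assms])
  then have "(\<lambda>m. \<Prod>i<Suc m. \<nu> (j + 1 + i) k) \<longlonglongrightarrow> xi_hat \<nu> j k"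
    by (simp only: lessThan_Suc_atMost)
  then show ?thesis by (subst (asm) filterlim_sequentially_Suc)
qed

lemma xi_hat_refinement:
  assumes "\<And>j. convergent_prod (\<lambda>r. \<nu> (j + 1 + r) k)"
  shows "xi_hat \<nu> j k = \<nu> (j + 1) k * xi_hat \<nu> (j + 1) k"
proof -
  have "(\<lambda>m. \<Prod>i<Suc m. \<nu> (j + 1 + i) k) \<longlonglongrightarrow> xi_hat \<nu> j k"
    by (rule LIMSEQ_Suc[OF xi_hat_LIMSEQ[of \<nu> j k, OF assms]])
  moreover have "(\<lambda>m. \<nu> (j + 1) k * (\<Prod>i<m. \<nu> (j + 1 + 1 + i) k)) \<longlonglongrightarrow> \<nu> (j + 1) k * xi_hat \<nu> (j + 1) k"
    by (intro tendsto_mult_left xi_hat_LIMSEQ[of \<nu> "j + 1" k] assms)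
  moreover have "(\<Prod>i<Suc m. \<nu> (j + 1 + i) k) = \<nu> (j + 1) k * (\<Prod>i<m. \<nu> (j + 1 + 1 + i) k)" for m
    by (subst prod.lessThan_Suc_shift) simp
  ultimately show ?thesis using LIMSEQ_unique by simp
qed

locale qmf_masks =
  fixes \<nu> :: "nat \<Rightarrow> int \<Rightarrow> real"
  assumes periodic: "j \<ge> 1 \<Longrightarrow> \<nu> j (k + 2 ^ j) = \<nu> j k"
    and qmf: "j \<ge> 1 \<Longrightarrow> (\<nu> j k)\<^sup>2 + (\<nu> j (k + 2 ^ (j - 1)))\<^sup>2 = 1"
    and conv: "convergent_prod (\<lambda>r. \<nu> (j + 1 + r) k)"
    and xi_lim: "(\<lambda>j. xi_hat \<nu> j k) \<longlonglongrightarrow> 1"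
    and xi_summable: "(\<lambda>k. \<bar>xi_hat \<nu> j k\<bar>) summable_on UNIV"
begin

lemma periodic_mult: "j \<ge> 1 \<Longrightarrow> \<nu> j (k + 2 ^ j * l) = \<nu> j k"
  by (rule periodic_int_mult) (rule periodic)

lemma mask_abs_le_1:
  assumes "j \<ge> 1"
  shows "\<bar>\<nu> j k\<bar> \<le> 1"
proof -
  have "(\<nu> j k)\<^sup>2 \<le> 1"
    using qmf[OF assms, of k] zero_le_power2[of "\<nu> j (k + 2 ^ (j - 1))"] by linarith
  then show ?thesis by (simp add: abs_square_le_1)
qed

lemma partial_products_LIMSEQ: "(\<lambda>m. \<Prod>i<m. \<nu> (j + 1 + i) k) \<longlonglongrightarrow> xi_hat \<nu> j k"
  by (rule xi_hat_LIMSEQ[of \<nu> j k, OF conv])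

lemma xi_refinement: "xi_hat \<nu> j k = \<nu> (j + 1) k * xi_hat \<nu> (j + 1) k"
  by (rule xi_hat_refinement[of \<nu> k j, OF conv])

text \<open>Each step of the induction merges the two halves of the sum by the quadrature mirror condition.\<close>

lemma partial_product_energy:
  "(\<Sum>l<2 ^ m. (\<Prod>i<m. \<nu> (j + 1 + i) (n + 2 ^ j * int l))\<^sup>2) = 1"
proof (induction m)
  case (Suc m)
  let ?P = "\<lambda>k. \<Prod>i<m. \<nu> (j + 1 + i) k"
  have P: "?P (k + 2 ^ (j + m)) = ?P k" for k
  proof (rule prod.cong[OF refl])
    fix i assume "i \<in> {..<m}"
    then have "(2::int) ^ (j + m) = 2 ^ (j + 1 + i) * 2 ^ (m - 1 - i)"
      by (subst power_add[symmetric]) (auto intro!: arg_cong[of _ _ "\<lambda>x. 2 ^ x"])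
    then show "\<nu> (j + 1 + i) (k + 2 ^ (j + m)) = \<nu> (j + 1 + i) k"
      by (simp only: periodic_mult le_add2 add.assoc[symmetric] trans_le_add1)
  qed
  have shift: "n + 2 ^ j * int (l + 2 ^ m) = n + 2 ^ j * int l + 2 ^ (j + m)" for l
    by (simp add: power_add algebra_simps)
  have "(\<Sum>l<2 ^ Suc m. (\<Prod>i<Suc m. \<nu> (j + 1 + i) (n + 2 ^ j * int l))\<^sup>2) =
     (\<Sum>l<2 ^ m. (?P (n + 2 ^ j * int l) * \<nu> (j + 1 + m) (n + 2 ^ j * int l))\<^sup>2 +
        (?P (n + 2 ^ j * int l) * \<nu> (j + 1 + m) (n + 2 ^ j * int l + 2 ^ (j + m)))\<^sup>2)"
    by (simp only: power_Suc sum_double prod.lessThan_Suc shift P)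
  also have "\<dots> = (\<Sum>l<2 ^ m. (?P (n + 2 ^ j * int l))\<^sup>2)"
  proof (rule sum.cong[OF refl])
    fix l
    show "(?P (n + 2 ^ j * int l) * \<nu> (j + 1 + m) (n + 2 ^ j * int l))\<^sup>2 +
        (?P (n + 2 ^ j * int l) * \<nu> (j + 1 + m) (n + 2 ^ j * int l + 2 ^ (j + m)))\<^sup>2 = (?P (n + 2 ^ j * int l))\<^sup>2"
      using qmf[of "j + 1 + m" "n + 2 ^ j * int l"]
      by (simp add: power_mult_distrib distrib_left[symmetric] del: of_nat_add)
  qed
  also have "\<dots> = 1" by (rule Suc.IH)
  finally show ?case .
qed simp

text \<open>
  The first \<open>m\<close> factors of \<open>xi_hat \<nu> j\<close> have energy exactly one on any block of \<open>2 ^ m\<close> consecutive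
  members of a residue class, and for large \<open>m\<close> such a block contains \<open>F\<close>.
\<close>

lemma xi_energy:
  assumes "finite F"
  shows "(\<Sum>l\<in>F. (xi_hat \<nu> j (n + 2 ^ j * l))\<^sup>2) \<le> 1"
proof (rule tendsto_upperbound)
  let ?P = "\<lambda>m k. \<Prod>i<m. \<nu> (j + 1 + i) k"
  show "(\<lambda>m. \<Sum>l\<in>F. (?P m (n + 2 ^ j * l))\<^sup>2) \<longlonglongrightarrow> (\<Sum>l\<in>F. (xi_hat \<nu> j (n + 2 ^ j * l))\<^sup>2)"
    by (intro tendsto_intros partial_products_LIMSEQ)
  obtain L :: int where L: "\<And>l. l \<in> F \<Longrightarrow> \<bar>l\<bar> \<le> L"
    using Max_ge[of "abs ` F"] assms by (meson finite_imageI imageI)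
  show "\<forall>\<^sub>F m in sequentially. (\<Sum>l\<in>F. (?P m (n + 2 ^ j * l))\<^sup>2) \<le> 1"
    using eventually_ge_at_top[of "nat (2 * L + 1)"]
  proof eventually_elim
    case (elim m)
    have "int m < 2 ^ m" using of_nat_less_two_power[of m, where 'a = int] by simp
    then have m: "2 * L + 1 \<le> 2 ^ m" using elim by linarith
    have "(\<Sum>l\<in>F. (?P m (n + 2 ^ j * l))\<^sup>2) \<le> (\<Sum>l\<in>(\<lambda>i. int i - L) ` {..<2 ^ m}. (?P m (n + 2 ^ j * l))\<^sup>2)"
    proof (rule sum_mono2)
      show "F \<subseteq> (\<lambda>i. int i - L) ` {..<2 ^ m}"
      proof
        fix l assume "l \<in> F"
        then have "- L \<le> l" "l \<le> L" using L[of l] by auto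
        then have "l = int (nat (l + L)) - L" "nat (l + L) < 2 ^ m"
          using m by (auto simp: nat_less_iff)
        then show "l \<in> (\<lambda>i. int i - L) ` {..<2 ^ m}" by blast
      qed
    qed auto
    also have "\<dots> = (\<Sum>i<2 ^ m. (?P m ((n - 2 ^ j * L) + 2 ^ j * int i))\<^sup>2)"
      by (subst sum.reindex) (auto simp: inj_on_def algebra_simps)
    also have "\<dots> = 1" by (rule partial_product_energy)
    finally show ?case .
  qed
qed simp

context
  fixes d :: "int \<Rightarrow> complex" and D :: real
  assumes d: "((\<lambda>k. (cmod (d k))\<^sup>2) has_sum D) UNIV"
begin

abbreviation folded :: "nat \<Rightarrow> int \<Rightarrow> complex" where
  "folded j n \<equiv> d n * of_real (xi_hat \<nu> j n)"

text \<open>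
  Up to normalisation, \<open>fold_coeff j\<close> is the discrete Fourier transform of the inner products with the
  translates \<open>\<phi>\<^sub>j (x - 2\<^sup>-\<^sup>j k)\<close>, so that \<open>fold_energy j\<close> is the energy of these inner products.
\<close>

definition fold_coeff :: "nat \<Rightarrow> int \<Rightarrow> complex" where
  "fold_coeff j r = (\<Sum>\<^sub>\<infinity>l. folded j (r + 2 ^ j * l))"

definition fold_energy :: "nat \<Rightarrow> real" where
  "fold_energy j = (\<Sum>r<2 ^ j. (cmod (fold_coeff j (int r)))\<^sup>2)"

lemma d_bounded: "cmod (d k) \<le> sqrt D"
  using finite_sum_le_has_sum[OF d, of "{k}"] by (intro real_le_rsqrt) auto

lemma abs_summable_d_xi: "(\<lambda>k. cmod (folded j k)) summable_on UNIV"
proof (rule summable_on_comparison_test)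
  show "(\<lambda>k. sqrt D * \<bar>xi_hat \<nu> j k\<bar>) summable_on UNIV"
    by (intro summable_on_cmult_right xi_summable)
  show "cmod (folded j k) \<le> sqrt D * \<bar>xi_hat \<nu> j k\<bar>" for k
    by (simp add: norm_mult mult_right_mono d_bounded)
qed auto

lemma summable_d_xi: "folded j summable_on UNIV"
  by (rule abs_summable_summable[OF abs_summable_d_xi])

lemma fold_coeff_periodic: "fold_coeff j (r + 2 ^ j * m) = fold_coeff j r"
proof -
  have "bij (\<lambda>l::int. m + l)"
    by (rule bij_betw_byWitness[where f' = "\<lambda>l. l - m"]) auto
  from infsum_reindex_bij_betw[OF this, of "\<lambda>l. folded j (r + 2 ^ j * l)"]
  show ?thesis by (simp add: fold_coeff_def algebra_simps)
qed

lemma fold_coeff_refinement: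
  "fold_coeff j r = of_real (\<nu> (j + 1) r) * fold_coeff (j + 1) r +
     of_real (\<nu> (j + 1) (r + 2 ^ j)) * fold_coeff (j + 1) (r + 2 ^ j)"
proof -
  have "fold_coeff j r = (\<Sum>\<^sub>\<infinity>l. folded j (r + 2 * 2 ^ j * l)) +
      (\<Sum>\<^sub>\<infinity>l. folded j (r + 2 ^ j + 2 * 2 ^ j * l))"
    using infsum_split_parity[OF summable_d_xi, of "2 ^ j" r j] by (simp add: fold_coeff_def)
  also have "\<dots> = (\<Sum>\<^sub>\<infinity>l. of_real (\<nu> (j + 1) r) * folded (j + 1) (r + 2 ^ (j + 1) * l)) +
      (\<Sum>\<^sub>\<infinity>l. of_real (\<nu> (j + 1) (r + 2 ^ j)) * folded (j + 1) (r + 2 ^ j + 2 ^ (j + 1) * l))"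
    using periodic_mult[of "j + 1"] by (simp add: xi_refinement[of j] mult_ac)
  finally show ?thesis by (simp add: fold_coeff_def infsum_cmult_right')
qed

lemma fold_energy_le: "fold_energy j \<le> D"
proof -
  have ds: "(\<lambda>k. (cmod (d k))\<^sup>2) summable_on UNIV" using d by (auto simp: summable_on_def)
  have "fold_energy j \<le> (\<Sum>r<2 ^ j. \<Sum>\<^sub>\<infinity>l. (cmod (d (int r + 2 ^ j * l)))\<^sup>2)"
    unfolding fold_energy_def fold_coeff_def
    by (intro sum_mono cauchy_schwarz_infsum summable_on_residue_class[OF summable_d_xi]
        summable_on_residue_class[OF ds] xi_energy) auto
  also have "\<dots> = D"
    using has_sum_unique[OF has_sum_residue_classes[OF ds, of "2 ^ j"] d] by simp
  finally show ?thesis .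
qed

text \<open>
  All other members of the residue class of \<open>n\<close> move to infinity, where the coefficients \<open>d\<close> have
  little energy.
\<close>

lemma fold_coeff_LIMSEQ: "(\<lambda>j. fold_coeff j n) \<longlonglongrightarrow> d n"
proof -
  have ds: "(\<lambda>k. (cmod (d k))\<^sup>2) summable_on UNIV" using d by (auto simp: summable_on_def)
  let ?t = "\<lambda>j. \<Sum>\<^sub>\<infinity>l\<in>-{0}. folded j (n + 2 ^ j * l)"
  have split: "fold_coeff j n = d n * of_real (xi_hat \<nu> j n) + ?t j" for j
  proof -
    have "(\<lambda>l. folded j (n + 2 ^ j * l)) summable_on UNIV"
      by (rule summable_on_residue_class[OF summable_d_xi]) simp
    then have "(\<lambda>l. folded j (n + 2 ^ j * l)) summable_on -{0}"
      using summable_on_subset_banach by blast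
    from infsum_insert[OF this, of 0] show ?thesis
      by (simp add: fold_coeff_def Compl_eq_Diff_UNIV insert_absorb)
  qed
  have tail: "\<forall>\<^sub>F j in sequentially. (cmod (?t j))\<^sup>2 < e" if e: "e > 0" for e :: real
  proof -
    obtain F where F: "finite F" "dist (\<Sum>k\<in>F. (cmod (d k))\<^sup>2) (\<Sum>\<^sub>\<infinity>k. (cmod (d k))\<^sup>2) \<le> e / 2"
      using infsum_finite_approximation[OF ds, of "e / 2"] e by auto
    have tailF: "(\<Sum>\<^sub>\<infinity>k\<in>-F. (cmod (d k))\<^sup>2) < e"
    proof -
      have "(\<Sum>\<^sub>\<infinity>k\<in>F \<union> -F. (cmod (d k))\<^sup>2) = (\<Sum>\<^sub>\<infinity>k\<in>F. (cmod (d k))\<^sup>2) + (\<Sum>\<^sub>\<infinity>k\<in>-F. (cmod (d k))\<^sup>2)"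
        by (intro infsum_Un_disjoint summable_on_subset_banach[OF ds]) auto
      then show ?thesis using F e by (simp add: dist_real_def)
    qed
    obtain L :: int where L: "\<And>l. l \<in> F \<Longrightarrow> \<bar>l - n\<bar> \<le> L"
      using Max_ge[of "(\<lambda>l. \<bar>l - n\<bar>) ` F"] F(1) by (meson finite_imageI imageI)
    show ?thesis
      using eventually_ge_at_top[of "nat (L + 1)"]
    proof eventually_elim
      case (elim j)
      have "int j < 2 ^ j" using of_nat_less_two_power[of j, where 'a = int] by simp
      then have j: "L < 2 ^ j" using elim by linarith
      have inj: "inj_on (\<lambda>l. n + 2 ^ j * l) (-{0})" by (auto simp: inj_on_def)
      have sub: "(\<lambda>l. n + 2 ^ j * l) ` (-{0}) \<subseteq> -F"
      proof clarify
        fix l :: int assume "l \<noteq> 0" "n + 2 ^ j * l \<in> F"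
        then have "\<bar>2 ^ j * l\<bar> \<le> L" using L[of "n + 2 ^ j * l"] by simp
        moreover have "\<bar>2 ^ j * l\<bar> \<ge> 2 ^ j * 1" unfolding abs_mult using \<open>l \<noteq> 0\<close> by (intro mult_mono) auto
        ultimately show False using j by simp
      qed
      have "(cmod (?t j))\<^sup>2 \<le> (\<Sum>\<^sub>\<infinity>l\<in>-{0}. (cmod (d (n + 2 ^ j * l)))\<^sup>2)"
      proof (rule cauchy_schwarz_infsum)
        show "(\<lambda>l. folded j (n + 2 ^ j * l)) summable_on -{0}"
          by (rule summable_on_subset_banach[OF summable_on_residue_class[OF summable_d_xi]]) auto
        show "(\<lambda>l. (cmod (d (n + 2 ^ j * l)))\<^sup>2) summable_on -{0}"
          by (rule summable_on_subset_banach[OF summable_on_residue_class[OF ds]]) auto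
      qed (rule xi_energy)
      also have "\<dots> = (\<Sum>\<^sub>\<infinity>k\<in>(\<lambda>l. n + 2 ^ j * l) ` (-{0}). (cmod (d k))\<^sup>2)"
        by (simp add: infsum_reindex[OF inj] o_def)
      also have "\<dots> \<le> (\<Sum>\<^sub>\<infinity>k\<in>-F. (cmod (d k))\<^sup>2)"
        using sub by (intro infsum_mono2 summable_on_subset_banach[OF ds]) auto
      also have "\<dots> < e" by (rule tailF)
      finally show ?case .
    qed
  qed
  have "(\<lambda>j. (cmod (?t j))\<^sup>2) \<longlonglongrightarrow> 0"
  proof (rule order_tendstoI)
    show "\<forall>\<^sub>F j in sequentially. a < (cmod (?t j))\<^sup>2" if "a < 0" for a
      using that by (intro always_eventually allI) (smt (verit) zero_le_power2)
  qed (rule tail)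
  then have "(\<lambda>j. cmod (?t j)) \<longlonglongrightarrow> 0"
    using tendsto_real_sqrt[of "\<lambda>j. (cmod (?t j))\<^sup>2" 0] by simp
  then have "?t \<longlonglongrightarrow> 0" by (rule tendsto_norm_zero_cancel)
  moreover have "(\<lambda>j. d n * of_real (xi_hat \<nu> j n)) \<longlonglongrightarrow> d n * of_real 1"
    by (intro tendsto_intros xi_lim)
  ultimately show ?thesis
    unfolding split using tendsto_add by fastforce
qed

text \<open>
  The upper bound holds at every level. Finitely many frequencies carry nearly all of \<open>D\<close>; they
  eventually lie in different residue classes, and there \<open>fold_coeff j\<close> converges.
\<close>

lemma fold_energy_LIMSEQ: "fold_energy \<longlonglongrightarrow> D"
proof (rule order_tendstoI)
  show "\<forall>\<^sub>F j in sequentially. fold_energy j < a" if "a > D" for a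
    using fold_energy_le that by (intro always_eventually allI) (meson order.strict_trans1)
  fix a assume a: "a < D"
  obtain F where F: "finite F" "a < (\<Sum>k\<in>F. (cmod (d k))\<^sup>2)"
    using order_tendstoD(1)[OF d[unfolded has_sum_def] a] unfolding eventually_finite_subsets_at_top by blast
  obtain L :: int where L: "\<And>l. l \<in> F \<Longrightarrow> \<bar>l\<bar> \<le> L"
    using Max_ge[of "abs ` F"] F(1) by (meson finite_imageI imageI)
  have "(\<lambda>j. \<Sum>k\<in>F. (cmod (fold_coeff j k))\<^sup>2) \<longlonglongrightarrow> (\<Sum>k\<in>F. (cmod (d k))\<^sup>2)"
    by (intro tendsto_intros fold_coeff_LIMSEQ)
  then have "\<forall>\<^sub>F j in sequentially. a < (\<Sum>k\<in>F. (cmod (fold_coeff j k))\<^sup>2)"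
    using F(2) by (rule order_tendstoD)
  then show "\<forall>\<^sub>F j in sequentially. a < fold_energy j"
    using eventually_ge_at_top[of "nat (2 * L + 1)"]
  proof eventually_elim
    case (elim j)
    have "int j < 2 ^ j" using of_nat_less_two_power[of j, where 'a = int] by simp
    then have j: "2 * L < 2 ^ j" using elim by linarith
    let ?m = "\<lambda>k. nat (k mod 2 ^ j)"
    have inj: "inj_on ?m F"
    proof (rule inj_onI)
      fix x y assume xy: "x \<in> F" "y \<in> F" "nat (x mod 2 ^ j) = nat (y mod 2 ^ j)"
      then have "x mod 2 ^ j = y mod 2 ^ j" by (simp add: eq_nat_nat_iff)
      then have "2 ^ j dvd (x - y)" by (simp add: mod_eq_dvd_iff)
      moreover have "\<bar>x - y\<bar> < 2 ^ j" using L[OF xy(1)] L[OF xy(2)] j by linarith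
      ultimately show "x = y" using dvd_imp_le_int[of "x - y" "2 ^ j"] by fastforce
    qed
    have m: "fold_coeff j (int (?m k)) = fold_coeff j k" for k
      using fold_coeff_periodic[of j "k mod 2 ^ j" "k div 2 ^ j"] by simp
    have "(\<Sum>k\<in>F. (cmod (fold_coeff j k))\<^sup>2) = (\<Sum>r\<in>?m ` F. (cmod (fold_coeff j (int r)))\<^sup>2)"
      by (subst sum.reindex[OF inj]) (simp only: o_def m)
    also have "\<dots> \<le> fold_energy j"
      unfolding fold_energy_def by (rule sum_mono2) (auto simp: nat_less_iff)
    finally show ?case using elim by simp
  qed
qed

text \<open>
  In each residue class modulo \<open>2 ^ j\<close> the low-pass and the high-pass mask combine the two classes
  modulo \<open>2 ^ (j + 1)\<close> above it by a rotation, up to a phase. Hence the energy at level \<open>j + 1\<close> splits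
  into the energy at level \<open>j\<close> and that of the wavelet coefficients.
\<close>

lemma fold_energy_step:
  defines "e \<equiv> \<lambda>j n. d n * cnj (psi_hat \<nu> j n)"
  shows "(\<Sum>k<2 ^ j. (cmod (\<Sum>\<^sub>\<infinity>n. e j n * char_exp n (real k / 2 ^ j)))\<^sup>2) = fold_energy (j + 1) - fold_energy j"
proof -
  let ?w = "\<lambda>n. char_exp (- n) (1 / 2 ^ (j + 1))"
  have c: "sqrt 2 * 2 powr (- real (j + 1) / 2) = 1 / sqrt (2 ^ j)"
  proof -
    have "sqrt 2 = 2 powr (1 / 2)" "sqrt (2 ^ j) = 2 powr (real j / 2)"
      by (simp_all add: powr_half_sqrt[symmetric] powr_powr powr_realpow[symmetric])
    moreover have "1 / 2 + - real (j + 1) / 2 = - (real j / 2)" by (simp add: field_simps)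
    ultimately show ?thesis by (simp only: powr_add[symmetric] powr_minus_divide[symmetric])
  qed
  have e_eq: "e j n = of_real (1 / sqrt (2 ^ j)) * ?w n * of_real (\<nu> (j + 1) (n + 2 ^ j)) *
      (folded (j + 1) n)" for n
  proof -
    have "cnj (exp (2 * pi * \<i> * of_int n / 2 ^ (j + 1))) = ?w n"
      by (simp add: char_exp_def exp_cnj)
    then have "e j n = of_real (sqrt 2 * 2 powr (- real (j + 1) / 2)) * ?w n * of_real (\<nu> (j + 1) (n + 2 ^ j)) *
      (folded (j + 1) n)"
      by (simp add: e_def psi_hat_def wavelet_mask_def scaling_mask_def phi_hat_def mult_ac)
    then show ?thesis by (simp only: c)
  qed
  have e_abs: "(\<lambda>n. cmod (e j n)) summable_on UNIV"
  proof (rule summable_on_comparison_test)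
    show "(\<lambda>n. 1 / sqrt (2 ^ j) * cmod (folded (j + 1) n)) summable_on UNIV"
      by (intro summable_on_cmult_right abs_summable_d_xi)
    fix n
    have "cmod (e j n) = 1 / sqrt (2 ^ j) * \<bar>\<nu> (j + 1) (n + 2 ^ j)\<bar> * cmod (folded (j + 1) n)"
      unfolding e_eq norm_mult[of _ "d n * _"] by (simp add: norm_mult norm_divide)
    also have "\<dots> \<le> 1 / sqrt (2 ^ j) * 1 * cmod (folded (j + 1) n)"
      by (intro mult_right_mono mult_left_mono mask_abs_le_1) auto
    finally show "cmod (e j n) \<le> 1 / sqrt (2 ^ j) * cmod (folded (j + 1) n)" by simp
  qed auto
  have e_sum: "e j summable_on UNIV" by (rule abs_summable_summable[OF e_abs])
  let ?X = "\<lambda>r. fold_coeff (j + 1) r" and ?Y = "\<lambda>r. fold_coeff (j + 1) (r + 2 ^ j)"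
  let ?a = "\<lambda>r. \<nu> (j + 1) r" and ?b = "\<lambda>r. \<nu> (j + 1) (r + 2 ^ j)"
  have G: "(\<Sum>\<^sub>\<infinity>l. e j (r + 2 ^ j * l)) =
      of_real (1 / sqrt (2 ^ j)) * ?w r * (of_real (?b r) * ?X r - of_real (?a r) * ?Y r)" for r
  proof -
    have w1: "?w (r + 2 ^ (j + 1) * l) = ?w r" for r l
    proof -
      have "?w (2 ^ (j + 1) * l) = exp (2 * pi * \<i> * of_int (- l))"
        by (simp add: char_exp_def mult_ac)
      also have "\<dots> = 1" by (subst exp_eq_1) (auto intro!: exI[of _ "- l"])
      finally show ?thesis using char_exp_add[of "- r" "- (2 ^ (j + 1) * l)" "1 / 2 ^ (j + 1)"] by simp
    qed
    have w2: "?w (r + 2 ^ j) = - ?w r"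
    proof -
      have "?w (2 ^ j) = exp (- (of_real pi * \<i>))"
        by (simp add: char_exp_def)
      also have "\<dots> = - 1" by (simp add: exp_minus)
      finally show ?thesis using char_exp_add[of "- r" "- (2 ^ j)" "1 / 2 ^ (j + 1)"] by simp
    qed
    have p: "\<nu> (j + 1) (r + 2 ^ (j + 1) * l) = \<nu> (j + 1) r" for r l by (rule periodic_mult) simp
    have p1: "\<nu> (j + 1) (r + 2 ^ (j + 1) * l + 2 ^ j) = \<nu> (j + 1) (r + 2 ^ j)" for l
      using p[of "r + 2 ^ j" l] by (simp add: algebra_simps)
    have p2: "\<nu> (j + 1) (r + 2 ^ j + 2 ^ (j + 1) * l + 2 ^ j) = \<nu> (j + 1) r" for l
      using p[of r "l + 1"] by (simp add: algebra_simps)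
    have "(\<Sum>\<^sub>\<infinity>l. e j (r + 2 ^ j * l)) = (\<Sum>\<^sub>\<infinity>l. e j (r + 2 ^ (j + 1) * l)) + (\<Sum>\<^sub>\<infinity>l. e j (r + 2 ^ j + 2 ^ (j + 1) * l))"
      using infsum_split_parity[OF e_sum, of "2 ^ j" r] by simp
    also have "(\<Sum>\<^sub>\<infinity>l. e j (r + 2 ^ (j + 1) * l)) = of_real (1 / sqrt (2 ^ j)) * ?w r * of_real (?b r) * ?X r"
      unfolding e_eq w1 p1 infsum_cmult_right' fold_coeff_def ..
    also have "(\<Sum>\<^sub>\<infinity>l. e j (r + 2 ^ j + 2 ^ (j + 1) * l)) = of_real (1 / sqrt (2 ^ j)) * (- ?w r) * of_real (?a r) * ?Y r"
      unfolding e_eq w1 w2 p2 infsum_cmult_right' fold_coeff_def ..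
    finally show ?thesis by (simp add: algebra_simps)
  qed
  have rotation: "(cmod (of_real b * x - of_real a * y))\<^sup>2 = (cmod x)\<^sup>2 + (cmod y)\<^sup>2 - (cmod (of_real a * x + of_real b * y))\<^sup>2"
    if "a\<^sup>2 + b\<^sup>2 = 1" for a b :: real and x y :: complex
  proof -
    have "(cmod (of_real b * x - of_real a * y))\<^sup>2 + (cmod (of_real a * x + of_real b * y))\<^sup>2
      = (a\<^sup>2 + b\<^sup>2) * ((cmod x)\<^sup>2 + (cmod y)\<^sup>2)"
      unfolding cmod_power2 by (simp add: power2_eq_square algebra_simps)
    then show ?thesis using that by simp
  qed
  have "(\<Sum>k<2 ^ j. (cmod (\<Sum>\<^sub>\<infinity>n. e j n * char_exp n (real k / 2 ^ j)))\<^sup>2) =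
      2 ^ j * (\<Sum>r<2 ^ j. (cmod (\<Sum>\<^sub>\<infinity>l. e j (int r + 2 ^ j * l)))\<^sup>2)"
    using modulated_sums_parseval[OF e_sum e_abs, of "2 ^ j"] by simp
  also have "\<dots> = (\<Sum>r<2 ^ j. (cmod (of_real (?b (int r)) * ?X (int r) - of_real (?a (int r)) * ?Y (int r)))\<^sup>2)"
    unfolding G sum_distrib_left
    by (intro sum.cong refl) (simp add: norm_mult norm_divide power_mult_distrib power_divide)
  also have "\<dots> = (\<Sum>r<2 ^ j. (cmod (?X (int r)))\<^sup>2 + (cmod (?Y (int r)))\<^sup>2 - (cmod (fold_coeff j (int r)))\<^sup>2)"
  proof (intro sum.cong refl)
    fix r
    have "(?a (int r))\<^sup>2 + (?b (int r))\<^sup>2 = 1" using qmf[of "j + 1" "int r"] by simp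
    from rotation[OF this] show "(cmod (of_real (?b (int r)) * ?X (int r) - of_real (?a (int r)) * ?Y (int r)))\<^sup>2 =
        (cmod (?X (int r)))\<^sup>2 + (cmod (?Y (int r)))\<^sup>2 - (cmod (fold_coeff j (int r)))\<^sup>2"
      unfolding fold_coeff_refinement[of j "int r"] .
  qed
  also have "\<dots> = fold_energy (j + 1) - fold_energy j"
    using sum_double[of "\<lambda>r. (cmod (?X (int r)))\<^sup>2" "2 ^ j"]
    by (simp add: fold_energy_def sum_subtractf)
  finally show ?thesis .
qed

end

end

context qmf_masks
begin

lemma phi_hat_summable: "(\<lambda>k. cmod (of_real (phi_hat \<nu> j k))) summable_on UNIV"
  using summable_on_cmult_right[OF xi_summable[of j], of "2 powr (- real j / 2)"]
  unfolding phi_hat_def norm_of_real abs_mult by simp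

lemma psi_hat_summable: "(\<lambda>k. cmod (psi_hat \<nu> j k)) summable_on UNIV"
proof (rule summable_on_comparison_test)
  show "(\<lambda>k. sqrt 2 * cmod (of_real (phi_hat \<nu> (j + 1) k))) summable_on UNIV"
    by (intro summable_on_cmult_right phi_hat_summable)
  fix k
  have "\<bar>\<nu> (j + 1) (k + 2 ^ j)\<bar> \<le> 1" by (rule mask_abs_le_1) simp
  moreover have "cmod (exp (2 * pi * \<i> * of_int k / 2 ^ (j + 1))) = 1"
    by (simp add: norm_exp_eq_Re)
  ultimately show "cmod (psi_hat \<nu> j k) \<le> sqrt 2 * cmod (of_real (phi_hat \<nu> (j + 1) k))"
    by (simp add: psi_hat_def wavelet_mask_def scaling_mask_def norm_mult abs_mult mult_left_le_one_le mult_right_mono mult_left_mono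
        del: power_Suc)
qed auto

lemma periodic_wavelets_trig_series:
  "periodic_wavelets \<nu> (\<lambda>j. trig_series (\<lambda>k. of_real (phi_hat \<nu> j k))) (\<lambda>j. trig_series (psi_hat \<nu> j))"
  unfolding periodic_wavelets_def
  using periodic qmf conv trig_series_periodic_L2[OF phi_hat_summable] trig_series_periodic_L2[OF psi_hat_summable]
    fourier_coeff_trig_series[OF phi_hat_summable] fourier_coeff_trig_series[OF psi_hat_summable] by blast

text \<open>The wavelet energies telescope to the difference of the limit and the first scaling energy.\<close>

theorem parseval_frame_trig_series:
  "parseval_frame system_index
     (wavelet_system (\<lambda>j. trig_series (\<lambda>k. of_real (phi_hat \<nu> j k))) (\<lambda>j. trig_series (psi_hat \<nu> j)))"
    (is "parseval_frame _ (wavelet_system ?\<phi> ?\<psi>)")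
proof -
  let ?\<Psi> = "\<lambda>j s k. psi_hat \<nu> j k * char_exp (- k) s"
  have shift: "(\<lambda>x. ?\<psi> j (x - s)) = trig_series (?\<Psi> j s)" for j s
    by (rule ext) (rule trig_series_shift)
  have summ: "(\<lambda>k. cmod (?\<Psi> j s k)) summable_on UNIV" for j s
    using psi_hat_summable[of j] by (simp add: norm_mult)
  have L2: "wavelet_system ?\<phi> ?\<psi> i \<in> periodic_L2" for i
    unfolding wavelet_system_def shift
    by (auto split: option.splits intro!: trig_series_periodic_L2 summ phi_hat_summable)
  have "((\<lambda>i. (cmod (L2_inner f (wavelet_system ?\<phi> ?\<psi> i)))\<^sup>2) has_sum (L2_norm f)\<^sup>2) system_index"
    if f: "f \<in> periodic_L2" for f
  proof -
    let ?d = "fourier_coeff f" and ?D = "(L2_norm f)\<^sup>2"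
    let ?a = "\<lambda>i. (cmod (L2_inner f (wavelet_system ?\<phi> ?\<psi> i)))\<^sup>2"
    note d = parseval_norm[OF f]
    let ?Q = "fold_energy ?d"
    have None: "?a None = ?Q 0"
    proof -
      have "L2_inner f (?\<phi> 0) = (\<Sum>\<^sub>\<infinity>k. ?d k * of_real (phi_hat \<nu> 0 k))"
        using L2_inner_trig_series[OF periodic_L2_sq_int[OF f] phi_hat_summable[of 0]] by (simp add: infsumI)
      then show ?thesis
        by (simp add: wavelet_system_def fold_energy_def[OF d] fold_coeff_def[OF d] phi_hat_def)
    qed
    have Some: "(\<Sum>k<2 ^ j. ?a (Some (j, k))) = ?Q (j + 1) - ?Q j" for j
    proof -
      have "L2_inner f (\<lambda>x. ?\<psi> j (x - s)) = (\<Sum>\<^sub>\<infinity>n. ?d n * cnj (psi_hat \<nu> j n) * char_exp n s)" for s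
        unfolding shift
        using L2_inner_trig_series[OF periodic_L2_sq_int[OF f] summ[of j s]]
        by (simp add: infsumI cnj_char_exp mult_ac)
      then show ?thesis
        using fold_energy_step[OF d, of j] by (simp add: wavelet_system_def)
    qed
    have "(\<lambda>J. \<Sum>j<J. ?Q (j + 1) - ?Q j) = (\<lambda>J. ?Q J - ?Q 0)"
      by (simp add: sum_lessThan_telescope)
    moreover have "(\<lambda>J. ?Q J - ?Q 0) \<longlonglongrightarrow> ?D - ?Q 0"
      by (intro tendsto_intros fold_energy_LIMSEQ[OF d])
    ultimately have "(\<lambda>j. ?Q (j + 1) - ?Q j) sums (?D - ?Q 0)"
      by (simp add: sums_def)
    moreover have "?Q (j + 1) - ?Q j \<ge> 0" for j
      unfolding Some[symmetric] by (rule sum_nonneg) auto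
    ultimately have tel: "((\<lambda>j. ?Q (j + 1) - ?Q j) has_sum (?D - ?Q 0)) UNIV"
      by (intro sums_nonneg_imp_has_sum)
    have rows: "((\<lambda>k. ?a (Some (j, k))) has_sum (?Q (j + 1) - ?Q j)) {..<2 ^ j}" for j
      using Some[of j] by (intro has_sum_finiteI) auto
    have "((\<lambda>p. ?a (Some p)) has_sum (?D - ?Q 0)) (SIGMA j:UNIV. {..<2 ^ j})"
    proof (rule has_sum_SigmaI[OF _ tel])
      show "(\<lambda>p. ?a (Some p)) summable_on (SIGMA j:UNIV. {..<2 ^ j})"
        by (rule summable_on_SigmaI[OF rows]) (use tel in \<open>auto simp: summable_on_def\<close>)
    qed (rule rows)
    then have "(?a has_sum (?D - ?Q 0)) (Some ` (SIGMA j:UNIV. {..<2 ^ j}))"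
      by (subst has_sum_reindex) (auto simp: o_def)
    from has_sum_insert[OF _ this, of None]
    have "(?a has_sum ?D) (insert None (Some ` (SIGMA j:UNIV. {..<2 ^ j})))"
      unfolding None by auto
    moreover have "(SIGMA j:UNIV. {..<2 ^ j}) = {(j, k :: nat). k < 2 ^ j}" by auto
    ultimately show ?thesis by (simp add: system_index_def)
  qed
  then show ?thesis
    using L2 by (simp add: parseval_frame_def)
qed

end

section \<open>The uncertainty constant of a coefficient sequence\<close>

definition seq_N :: "(int \<Rightarrow> real) \<Rightarrow> real" where "seq_N r = (\<Sum>\<^sub>\<infinity>k. (r k)\<^sup>2)"
definition seq_C :: "(int \<Rightarrow> real) \<Rightarrow> real" where "seq_C r = (\<Sum>\<^sub>\<infinity>k. r k * r (k + 1))"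
definition seq_M1 :: "(int \<Rightarrow> real) \<Rightarrow> real" where "seq_M1 r = (\<Sum>\<^sub>\<infinity>k. of_int k * (r k)\<^sup>2)"
definition seq_M2 :: "(int \<Rightarrow> real) \<Rightarrow> real" where "seq_M2 r = (\<Sum>\<^sub>\<infinity>k. (of_int k)\<^sup>2 * (r k)\<^sup>2)"

definition seq_UC :: "(int \<Rightarrow> real) \<Rightarrow> real" where
  "seq_UC r = sqrt (((seq_N r)\<^sup>2 / (seq_C r)\<^sup>2 - 1) * (seq_M2 r / seq_N r - (seq_M1 r)\<^sup>2 / (seq_N r)\<^sup>2))"

text \<open>These conditions make both variances finite.\<close>

definition localised :: "(int \<Rightarrow> real) \<Rightarrow> bool" where
  "localised r \<longleftrightarrow> (\<lambda>k. r k * r (k + 1)) summable_on UNIV \<and>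
     (\<lambda>k. (of_int k)\<^sup>2 * (r k)\<^sup>2) summable_on UNIV \<and> seq_C r \<noteq> 0"

text \<open>
  The phase factor and the constant \<open>A\<close> stand for a translation and a scalar multiple, which change
  neither variance.
\<close>

lemma UC_modulated:
  assumes c: "\<And>k. fourier_coeff f k = A * char_exp k t * of_real (r k)" and A: "A \<noteq> 0" and r: "localised r"
  shows "UC f = ereal (seq_UC r)"
proof -
  let ?A = "(cmod A)\<^sup>2"
  have A0: "?A \<noteq> 0" using A by simp
  have sq: "(cmod (fourier_coeff f k))\<^sup>2 = ?A * (r k)\<^sup>2" for k
    by (simp add: c norm_mult power_mult_distrib)
  have N: "(\<Sum>\<^sub>\<infinity>k. (cmod (fourier_coeff f k))\<^sup>2) = ?A * seq_N r"
    unfolding sq seq_N_def by (rule infsum_cmult_right')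
  have M1: "(\<Sum>\<^sub>\<infinity>k. of_int k * (cmod (fourier_coeff f k))\<^sup>2) = ?A * seq_M1 r"
    unfolding sq seq_M1_def by (subst infsum_cmult_right'[symmetric]) (simp add: mult_ac)
  have M2: "(\<Sum>\<^sub>\<infinity>k. (of_int k)\<^sup>2 * (cmod (fourier_coeff f k))\<^sup>2) = ?A * seq_M2 r"
    unfolding sq seq_M2_def by (subst infsum_cmult_right'[symmetric]) (simp add: mult_ac)
  have M2s: "(\<lambda>k. (of_int k)\<^sup>2 * (cmod (fourier_coeff f k))\<^sup>2 :: real) summable_on UNIV"
    using summable_on_cmult_right[of "\<lambda>k. (of_int k)\<^sup>2 * (r k)\<^sup>2" UNIV ?A] r
    by (simp add: sq localised_def mult_ac)
  have "fourier_coeff f k * cnj (fourier_coeff f (k + 1)) = (A * cnj A * char_exp (- 1) t) * of_real (r k * r (k + 1))" for k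
  proof -
    have "char_exp k t * char_exp (- (k + 1)) t = char_exp (- 1) t"
      by (simp add: char_exp_add[symmetric])
    then show ?thesis unfolding c complex_cnj_mult cnj_char_exp complex_cnj_complex_of_real of_real_mult
      by (metis (no_types, opaque_lifting) mult.assoc mult.left_commute)
  qed
  then have "(\<Sum>\<^sub>\<infinity>k. fourier_coeff f k * cnj (fourier_coeff f (k + 1))) =
      (A * cnj A * char_exp (- 1) t) * (\<Sum>\<^sub>\<infinity>k. of_real (r k * r (k + 1)))"
    by (simp only: infsum_cmult_right')
  also have "(\<Sum>\<^sub>\<infinity>k. complex_of_real (r k * r (k + 1))) = of_real (seq_C r)"
    unfolding seq_C_def using r by (intro infsumI has_sum_of_real has_sum_infsum) (simp add: localised_def)
  finally have C: "(\<Sum>\<^sub>\<infinity>k. fourier_coeff f k * cnj (fourier_coeff f (k + 1))) =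
      (A * cnj A * char_exp (- 1) t) * of_real (seq_C r)" .
  have C0: "(A * cnj A * char_exp (- 1) t) * of_real (seq_C r) \<noteq> 0"
    using A r norm_char_exp[of "-1" t] by (auto simp: localised_def simp del: norm_char_exp)
  have Cn: "cmod ((A * cnj A * char_exp (- 1) t) * of_real (seq_C r)) = ?A * \<bar>seq_C r\<bar>"
    by (simp add: norm_mult power2_eq_square)
  have vA: "var_A f = ereal (1 / (4 * pi\<^sup>2) * ((seq_N r)\<^sup>2 / (seq_C r)\<^sup>2 - 1))"
    unfolding var_A_def Let_def N C Cn using C0 A0 by (simp add: power_mult_distrib)
  have "var_F f = ereal (4 * pi\<^sup>2 * (?A * seq_M2 r) / (?A * seq_N r) - 4 * pi\<^sup>2 * (?A * seq_M1 r)\<^sup>2 / (?A * seq_N r)\<^sup>2)"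
    unfolding var_F_def Let_def N M1 M2 using M2s by simp
  also have "\<dots> = ereal (4 * pi\<^sup>2 * (seq_M2 r / seq_N r - (seq_M1 r)\<^sup>2 / (seq_N r)\<^sup>2))"
    using A0 by (simp add: power_mult_distrib right_diff_distrib)
  finally have vF: "var_F f = ereal (4 * pi\<^sup>2 * (seq_M2 r / seq_N r - (seq_M1 r)\<^sup>2 / (seq_N r)\<^sup>2))" .
  show ?thesis
    unfolding UC_def vA vF seq_UC_def by simp
qed

text \<open>The substitution \<open>x \<mapsto> \<lfloor>x s\<rfloor>\<close> pushes Lebesgue measure forward to \<open>1 / s\<close> times counting measure.\<close>

lemma floor_step_integral:
  fixes F :: "int \<Rightarrow> real"
  assumes s: "s > 0" and F: "F summable_on UNIV"
  shows "(\<integral>x. F \<lfloor>x * s\<rfloor> \<partial>lborel) = (\<Sum>\<^sub>\<infinity>k. F k) / s"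
proof -
  have m: "(\<lambda>x::real. \<lfloor>x * s\<rfloor>) \<in> lborel \<rightarrow>\<^sub>M count_space UNIV"
    by measurable
  have "distr lborel (count_space UNIV) (\<lambda>x. \<lfloor>x * s\<rfloor>) = density (count_space UNIV) (\<lambda>_. ennreal (1 / s))"
  proof (rule measure_eqI_countable[where A = UNIV])
    fix k :: int
    have "(\<lambda>x. \<lfloor>x * s\<rfloor>) -` {k} \<inter> space lborel = {of_int k / s..<(of_int k + 1) / s}"
    proof -
      have "\<lfloor>x * s\<rfloor> = k \<longleftrightarrow> of_int k / s \<le> x \<and> x < (of_int k + 1) / s" for x
        using s by (simp add: floor_eq_iff pos_divide_le_eq pos_less_divide_eq)
      then show ?thesis unfolding vimage_def by (simp add: set_eq_iff)
    qed
    then have "emeasure (distr lborel (count_space UNIV) (\<lambda>x. \<lfloor>x * s\<rfloor>)) {k} =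
        emeasure lborel {of_int k / s..<(of_int k + 1) / s}"
      by (subst emeasure_distr[OF m]) simp_all
    also have "\<dots> = ennreal ((of_int k + 1) / s - of_int k / s)"
      using s by (intro emeasure_lborel_Ico divide_right_mono) auto
    also have "(of_int k + 1) / s - of_int k / s = 1 / s"
      by (simp add: diff_divide_distrib[symmetric])
    also have "ennreal (1 / s) = emeasure (density (count_space UNIV) (\<lambda>_. ennreal (1 / s))) {k}"
      by (subst emeasure_density_const) auto
    finally show "emeasure (distr lborel (count_space UNIV) (\<lambda>x. \<lfloor>x * s\<rfloor>)) {k} =
        emeasure (density (count_space UNIV) (\<lambda>_. ennreal (1 / s))) {k}" .
  qed auto
  then have "(\<integral>x. F \<lfloor>x * s\<rfloor> \<partial>lborel) = (\<integral>k. F k \<partial>density (count_space UNIV) (\<lambda>_. ennreal (1 / s)))"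
    using integral_distr[OF m, of F] by simp
  also have "\<dots> = (\<integral>k. (1 / s) *\<^sub>R F k \<partial>count_space UNIV)"
    using s by (intro integral_density) auto
  also have "\<dots> = (1 / s) * infsetsum F UNIV"
    by (simp add: infsetsum_def)
  also have "infsetsum F UNIV = (\<Sum>\<^sub>\<infinity>k. F k)"
    by (rule infsetsum_infsum[OF abs_summable_equivalent[THEN iffD1, OF summable_on_iff_abs_summable_on_real[THEN iffD1, OF F]]])
  finally show ?thesis by simp
qed

section \<open>Riemann sums and the uncertainty constant of a profile\<close>

lemma exp_minus_abs_le: "exp (- \<bar>x\<bar>) \<le> 2 * inverse (1 + x\<^sup>2)" for x :: real
proof -
  have "1 + \<bar>x\<bar> + \<bar>x\<bar>\<^sup>2 / 2 \<le> exp \<bar>x\<bar>"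
    by (rule exp_lower_Taylor_quadratic) simp
  then have "(1 + x\<^sup>2) / 2 \<le> exp \<bar>x\<bar>" by simp
  then have "inverse (exp \<bar>x\<bar>) \<le> inverse ((1 + x\<^sup>2) / 2)"
    by (intro le_imp_inverse_le) (auto intro: add_pos_nonneg)
  then show ?thesis by (simp add: exp_minus field_simps)
qed

lemma integrable_exp_minus_abs: "integrable lborel (\<lambda>x::real. exp (- \<bar>x\<bar>))"
proof (rule Bochner_Integration.integrable_bound)
  have "integrable lborel (\<lambda>x::real. inverse (1 + x\<^sup>2))"
    using integrable_inverse_1_plus_square by (simp add: set_integrable_def)
  then show "integrable lborel (\<lambda>x::real. 2 * inverse (1 + x\<^sup>2))" by simp
  show "AE x::real in lborel. norm (exp (- \<bar>x\<bar>)) \<le> norm (2 * inverse (1 + x\<^sup>2))"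
    using exp_minus_abs_le by (intro AE_I2) (auto intro: order_trans[OF _ abs_ge_self])
qed simp

lemma summable_exp_minus_abs:
  assumes "s > 0"
  shows "(\<lambda>k::int. exp (- \<bar>of_int k\<bar> / s) :: real) summable_on UNIV"
proof -
  let ?e = "\<lambda>k::int. exp (- \<bar>of_int k\<bar> / s) :: real"
  define q where "q = exp (- 1 / s)"
  have q: "0 < q" "q < 1" using assms by (auto simp: q_def)
  have n: "?e (int n) = q ^ n" "?e (- int n) = q ^ n" for n
    by (simp_all add: q_def exp_of_nat_mult[symmetric])
  have geo: "(\<lambda>n. q ^ n) summable_on UNIV"
    using q by (intro norm_summable_imp_summable_on) simp
  have "?e \<circ> int = (\<lambda>n. q ^ n)" "?e \<circ> (\<lambda>n. - int n) = (\<lambda>n. q ^ n)"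
    by (rule ext, simp only: o_def n)+
  then have "?e summable_on range int" "?e summable_on range (\<lambda>n. - int n)"
    using geo summable_on_reindex[of int UNIV ?e] summable_on_reindex[of "\<lambda>n. - int n" UNIV ?e]
    by (simp_all add: inj_on_def)
  then have "?e summable_on (range int \<union> range (\<lambda>n. - int n))"
    by (rule summable_on_union)
  moreover have "range int \<union> range (\<lambda>n. - int n) = UNIV"
  proof -
    have "k \<in> range int \<union> range (\<lambda>n. - int n)" for k :: int
      by (cases k rule: int_cases2) auto
    then show ?thesis by blast
  qed
  ultimately show ?thesis by simp
qed

lemma floor_scaled_LIMSEQ:
  assumes "filterlim s at_top sequentially"
  shows "(\<lambda>n. of_int \<lfloor>x * s n\<rfloor> / s n) \<longlonglongrightarrow> (x :: real)"
proof -
  have inv: "(\<lambda>n. 1 / s n) \<longlonglongrightarrow> 0"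
    using tendsto_inverse_0_at_top[OF assms] by (simp add: inverse_eq_divide)
  have "\<forall>\<^sub>F n in sequentially. norm (of_int \<lfloor>x * s n\<rfloor> / s n - x) \<le> 1 / s n"
    using filterlim_at_top_dense[THEN iffD1, OF assms, THEN spec, of 0]
  proof eventually_elim
    case (elim n)
    have "of_int \<lfloor>x * s n\<rfloor> / s n - x = (of_int \<lfloor>x * s n\<rfloor> - x * s n) / s n"
      using elim by (simp add: field_simps)
    moreover have "\<bar>of_int \<lfloor>x * s n\<rfloor> - x * s n\<bar> \<le> 1" by linarith
    ultimately show ?case using elim by (simp add: divide_right_mono)
  qed
  then have "(\<lambda>n. of_int \<lfloor>x * s n\<rfloor> / s n - x) \<longlonglongrightarrow> 0"
    by (rule Lim_null_comparison[OF _ inv])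
  then show ?thesis by (rule LIM_zero_cancel)
qed

text \<open>
  A Riemann sum is the integral of a step function, so dominated convergence applies.
\<close>

lemma riemann_sum_LIMSEQ:
  fixes F :: "nat \<Rightarrow> int \<Rightarrow> real" and h :: "real \<Rightarrow> real"
  assumes s: "filterlim s at_top sequentially"
    and lim: "\<And>x. x \<noteq> 0 \<Longrightarrow> (\<lambda>n. F n \<lfloor>x * s n\<rfloor>) \<longlonglongrightarrow> h x"
    and h: "h \<in> borel_measurable lborel"
    and bound: "\<forall>\<^sub>F n in sequentially. \<forall>k. \<bar>F n k\<bar> \<le> B * exp (- \<bar>of_int k\<bar> / s n)"
  shows "(\<lambda>n. (\<Sum>\<^sub>\<infinity>k. F n k) / s n) \<longlonglongrightarrow> (\<integral>x. h x \<partial>lborel)"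
    and "\<forall>\<^sub>F n in sequentially. F n summable_on UNIV"
proof -
  have s1: "\<forall>\<^sub>F n in sequentially. s n \<ge> 1"
    using s by (simp add: filterlim_at_top)
  have summ: "F n summable_on UNIV" if "s n \<ge> 1" "\<forall>k. \<bar>F n k\<bar> \<le> B * exp (- \<bar>of_int k\<bar> / s n)" for n
  proof (rule abs_summable_summable[OF summable_on_comparison_test])
    show "(\<lambda>k. B * exp (- \<bar>of_int k\<bar> / s n)) summable_on UNIV"
      using that by (intro summable_on_cmult_right summable_exp_minus_abs) auto
  qed (use that in auto)
  show "\<forall>\<^sub>F n in sequentially. F n summable_on UNIV"
    using s1 bound by eventually_elim (rule summ)
  obtain n0 where n0: "\<And>n. n \<ge> n0 \<Longrightarrow> s n \<ge> 1" "\<And>n k. n \<ge> n0 \<Longrightarrow> \<bar>F n k\<bar> \<le> B * exp (- \<bar>of_int k\<bar> / s n)"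
    using eventually_conj[OF s1 bound] unfolding eventually_sequentially by blast
  have B: "B \<ge> 0"
    using n0(2)[of n0 0] by simp
  have "(\<lambda>n. \<integral>x. F (n + n0) \<lfloor>x * s (n + n0)\<rfloor> \<partial>lborel) \<longlonglongrightarrow> (\<integral>x. h x \<partial>lborel)"
  proof (rule integral_dominated_convergence[where w = "\<lambda>x. B * exp 1 * exp (- \<bar>x\<bar>)"])
    show "integrable lborel (\<lambda>x::real. B * exp 1 * exp (- \<bar>x\<bar>))"
      using integrable_exp_minus_abs by simp
    show "h \<in> borel_measurable lborel" by fact
    show "(\<lambda>x. F (n + n0) \<lfloor>x * s (n + n0)\<rfloor>) \<in> borel_measurable lborel" for n
      by (rule measurable_compose[where N = "count_space UNIV"]) measurable
    show "AE x in lborel. (\<lambda>n. F (n + n0) \<lfloor>x * s (n + n0)\<rfloor>) \<longlonglongrightarrow> h x"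
      using AE_lborel_singleton[of 0]
      by eventually_elim (rule LIMSEQ_ignore_initial_segment[OF lim])
    fix n
    have "\<bar>F (n + n0) \<lfloor>x * s (n + n0)\<rfloor>\<bar> \<le> B * exp 1 * exp (- \<bar>x\<bar>)" for x
    proof -
      let ?s = "s (n + n0)"
      have s: "?s \<ge> 1" using n0(1) by simp
      have "\<bar>x\<bar> * ?s - 1 \<le> \<bar>of_int \<lfloor>x * ?s\<rfloor>\<bar>"
      proof -
        have "\<bar>x\<bar> * ?s = \<bar>x * ?s\<bar>" using s by (simp add: abs_mult)
        then show ?thesis by linarith
      qed
      then have "\<bar>x\<bar> * ?s - ?s \<le> \<bar>of_int \<lfloor>x * ?s\<rfloor>\<bar>" using s by linarith
      then have "\<bar>x\<bar> - 1 \<le> \<bar>of_int \<lfloor>x * ?s\<rfloor>\<bar> / ?s"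
        using s by (simp add: pos_le_divide_eq left_diff_distrib)
      then have "exp (- \<bar>of_int \<lfloor>x * ?s\<rfloor>\<bar> / ?s) \<le> exp (1 + - \<bar>x\<bar>)" by simp
      then have "B * exp (- \<bar>of_int \<lfloor>x * ?s\<rfloor>\<bar> / ?s) \<le> B * (exp 1 * exp (- \<bar>x\<bar>))"
        unfolding exp_add by (rule mult_left_mono[OF _ B])
      then show ?thesis using n0(2)[of "n + n0" "\<lfloor>x * ?s\<rfloor>"] by (simp add: mult.assoc)
    qed
    then show "AE x in lborel. norm (F (n + n0) \<lfloor>x * s (n + n0)\<rfloor>) \<le> B * exp 1 * exp (- \<bar>x\<bar>)"
      by (intro AE_I2) simp
  qed
  moreover have "(\<integral>x. F (n + n0) \<lfloor>x * s (n + n0)\<rfloor> \<partial>lborel) = (\<Sum>\<^sub>\<infinity>k. F (n + n0) k) / s (n + n0)" for n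
    using n0(1)[of "n + n0"] n0(2)[of "n + n0"] by (intro floor_step_integral summ) auto
  ultimately have "(\<lambda>n. (\<Sum>\<^sub>\<infinity>k. F (n + n0) k) / s (n + n0)) \<longlonglongrightarrow> (\<integral>x. h x \<partial>lborel)"
    by simp
  then show "(\<lambda>n. (\<Sum>\<^sub>\<infinity>k. F n k) / s n) \<longlonglongrightarrow> (\<integral>x. h x \<partial>lborel)"
    by (rule LIMSEQ_offset)
qed

lemma infsum_increments:
  fixes r :: "int \<Rightarrow> real"
  assumes r2: "(\<lambda>k. (r k)\<^sup>2) summable_on UNIV"
  shows "(\<lambda>k. r k * r (k + 1)) summable_on UNIV"
    and "(\<Sum>\<^sub>\<infinity>k. (r (k + 1) - r k)\<^sup>2) = 2 * (seq_N r - seq_C r)"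
proof -
  have bij: "bij (\<lambda>k::int. k + 1)"
    by (rule bij_betw_byWitness[where f' = "\<lambda>l. l - 1"]) auto
  have r2': "(\<lambda>k. (r (k + 1))\<^sup>2) summable_on UNIV"
    using summable_on_reindex_bij_betw[OF bij, of "\<lambda>k. (r k)\<^sup>2"] r2 by simp
  have N': "(\<Sum>\<^sub>\<infinity>k. (r (k + 1))\<^sup>2) = seq_N r"
    using infsum_reindex_bij_betw[OF bij, of "\<lambda>k. (r k)\<^sup>2"] by (simp add: seq_N_def)
  show C: "(\<lambda>k. r k * r (k + 1)) summable_on UNIV"
  proof (rule abs_summable_summable[OF summable_on_comparison_test])
    show "(\<lambda>k. (r k)\<^sup>2 + (r (k + 1))\<^sup>2) summable_on UNIV" by (intro summable_on_add r2 r2')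
    show "norm (r k * r (k + 1)) \<le> (r k)\<^sup>2 + (r (k + 1))\<^sup>2" for k
    proof -
      have "2 * (\<bar>r k\<bar> * \<bar>r (k + 1)\<bar>) \<le> (r k)\<^sup>2 + (r (k + 1))\<^sup>2"
        using sum_squares_bound[of "\<bar>r k\<bar>" "\<bar>r (k + 1)\<bar>"] by simp
      moreover have "0 \<le> \<bar>r k\<bar> * \<bar>r (k + 1)\<bar>" by simp
      ultimately show ?thesis unfolding real_norm_def abs_mult by linarith
    qed
  qed auto
  have "(\<Sum>\<^sub>\<infinity>k. (r (k + 1) - r k)\<^sup>2) = (\<Sum>\<^sub>\<infinity>k. ((r (k + 1))\<^sup>2 + (r k)\<^sup>2) + (- 2) * (r k * r (k + 1)))"
    by (simp add: power2_diff algebra_simps)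
  also have "\<dots> = ((\<Sum>\<^sub>\<infinity>k. (r (k + 1))\<^sup>2) + (\<Sum>\<^sub>\<infinity>k. (r k)\<^sup>2)) + (- 2) * (\<Sum>\<^sub>\<infinity>k. r k * r (k + 1))"
    by (subst infsum_add infsum_cmult_right')
      (intro summable_on_add summable_on_cmult_right r2 r2' C | subst infsum_add infsum_cmult_right' | rule refl)+
  finally show "(\<Sum>\<^sub>\<infinity>k. (r (k + 1) - r k)\<^sup>2) = 2 * (seq_N r - seq_C r)"
    unfolding N' by (simp add: seq_N_def seq_C_def)
qed

text \<open>
  The increments satisfy \<open>\<Sum> (r (k + 1) - r k)\<^sup>2 = 2 (N - C)\<close>, so the angular factor
  \<open>N\<^sup>2 / C\<^sup>2 - 1 = (N - C) (N + C) / C\<^sup>2\<close> is governed by a Riemann sum for \<open>\<integral>g\<^sup>2\<close>, where \<open>g\<close>, the limit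
  of the scaled increments, plays the role of the derivative of \<open>f\<close>. The powers of \<open>s\<close> cancel between the two factors, and the limit is the uncertainty product of
  \<open>f\<close> on the real line.
\<close>

theorem profile_UC_LIMSEQ:
  fixes r :: "nat \<Rightarrow> int \<Rightarrow> real" and f g :: "real \<Rightarrow> real"
  assumes s: "filterlim s at_top sequentially"
    and f: "\<And>x. x \<noteq> 0 \<Longrightarrow> (\<lambda>n. r n \<lfloor>x * s n\<rfloor>) \<longlonglongrightarrow> f x"
    and g: "\<And>x. x \<noteq> 0 \<Longrightarrow> (\<lambda>n. s n * (r n (\<lfloor>x * s n\<rfloor> + 1) - r n \<lfloor>x * s n\<rfloor>)) \<longlonglongrightarrow> g x"
    and meas [measurable]: "f \<in> borel_measurable borel" "g \<in> borel_measurable borel"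
    and fb: "\<forall>\<^sub>F n in sequentially. \<forall>k. \<bar>r n k\<bar> \<le> B * exp (- \<bar>of_int k\<bar> / s n)"
    and gb: "\<forall>\<^sub>F n in sequentially. \<forall>k. \<bar>s n * (r n (k + 1) - r n k)\<bar> \<le> B * exp (- \<bar>of_int k\<bar> / s n)"
    and I0: "(\<integral>x. (f x)\<^sup>2 \<partial>lborel) = I0" and I1: "(\<integral>x. x * (f x)\<^sup>2 \<partial>lborel) = 0"
    and I2: "(\<integral>x. x\<^sup>2 * (f x)\<^sup>2 \<partial>lborel) = I2" and G: "(\<integral>x. (g x)\<^sup>2 \<partial>lborel) = G" and I0_pos: "I0 > 0"
  shows "\<forall>\<^sub>F n in sequentially. localised (r n)"
    and "(\<lambda>n. seq_UC (r n)) \<longlonglongrightarrow> sqrt (G * I2 / I0\<^sup>2)"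
proof -
  have s_pos: "\<forall>\<^sub>F n in sequentially. s n > 0"
    using filterlim_at_top_dense[THEN iffD1, OF s] by blast
  note u = floor_scaled_LIMSEQ[OF s]
  have weighted: "\<forall>\<^sub>F n in sequentially. \<forall>k. \<bar>(of_int k / s n) ^ m * (t n k)\<^sup>2\<bar> \<le> (2 * B\<^sup>2) * exp (- \<bar>of_int k\<bar> / s n)"
    if "\<forall>\<^sub>F n in sequentially. \<forall>k. \<bar>t n k\<bar> \<le> B * exp (- \<bar>of_int k\<bar> / s n)" "m \<le> 2" for t :: "nat \<Rightarrow> int \<Rightarrow> real" and m
    using that(1) s_pos
  proof eventually_elim
    case (elim n)
    show ?case
    proof
      fix k
      define y where "y = \<bar>of_int k\<bar> / s n"
      have y: "y \<ge> 0" using elim by (simp add: y_def)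
      have "1 + y + y\<^sup>2 / 2 \<le> exp y" by (rule exp_lower_Taylor_quadratic[OF y])
      then have "1 \<le> 2 * exp y" "y \<le> 2 * exp y" "y\<^sup>2 \<le> 2 * exp y"
        using y zero_le_power2[of y] by linarith+
      moreover have "m = 0 \<or> m = 1 \<or> m = 2" using that(2) by auto
      ultimately have ym: "y ^ m \<le> 2 * exp y" by auto
      have "\<bar>t n k\<bar>\<^sup>2 \<le> (B * exp (- y))\<^sup>2"
        using elim by (intro power_mono) (simp_all add: y_def)
      then have t: "(t n k)\<^sup>2 \<le> B\<^sup>2 * exp (- 2 * y)" by (simp add: power_mult_distrib exp_double[symmetric])
      have "\<bar>(of_int k / s n) ^ m * (t n k)\<^sup>2\<bar> = y ^ m * (t n k)\<^sup>2"
        using elim by (simp add: y_def abs_mult power_abs)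
      also have "\<dots> \<le> 2 * exp y * (B\<^sup>2 * exp (- 2 * y))"
        using ym t y by (intro mult_mono) auto
      also have "\<dots> = (2 * B\<^sup>2) * (exp y * exp (- 2 * y))" by simp
      also have "exp y * exp (- 2 * y) = exp (- y)" by (simp add: exp_add[symmetric])
      finally show "\<bar>(of_int k / s n) ^ m * (t n k)\<^sup>2\<bar> \<le> (2 * B\<^sup>2) * exp (- \<bar>of_int k\<bar> / s n)"
        by (simp add: y_def)
    qed
  qed
  have lim: "(\<lambda>n. (of_int \<lfloor>x * s n\<rfloor> / s n) ^ m * (r n \<lfloor>x * s n\<rfloor>)\<^sup>2) \<longlonglongrightarrow> x ^ m * (f x)\<^sup>2" if "x \<noteq> 0" for x m
    by (intro tendsto_mult tendsto_power u f that)
  have moment: "(\<lambda>n. (\<Sum>\<^sub>\<infinity>k. (of_int k / s n) ^ m * (r n k)\<^sup>2) / s n) \<longlonglongrightarrow> (\<integral>x. x ^ m * (f x)\<^sup>2 \<partial>lborel)"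
    "\<forall>\<^sub>F n in sequentially. (\<lambda>k. (of_int k / s n) ^ m * (r n k)\<^sup>2) summable_on UNIV" if "m \<le> 2" for m
    using riemann_sum_LIMSEQ[OF s lim _ weighted[OF fb that]] by simp_all
  have N: "(\<lambda>n. (\<Sum>\<^sub>\<infinity>k. (r n k)\<^sup>2) / s n) \<longlonglongrightarrow> I0"
    and Ns: "\<forall>\<^sub>F n in sequentially. (\<lambda>k. (r n k)\<^sup>2) summable_on UNIV"
    using moment[of 0] I0 by simp_all
  have M1: "(\<lambda>n. (\<Sum>\<^sub>\<infinity>k. (of_int k / s n) * (r n k)\<^sup>2) / s n) \<longlonglongrightarrow> 0"
    using moment(1)[of 1] I1 by simp
  have M2: "(\<lambda>n. (\<Sum>\<^sub>\<infinity>k. (of_int k / s n)\<^sup>2 * (r n k)\<^sup>2) / s n) \<longlonglongrightarrow> I2"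
    and M2s: "\<forall>\<^sub>F n in sequentially. (\<lambda>k. (of_int k / s n)\<^sup>2 * (r n k)\<^sup>2) summable_on UNIV"
    using moment[of 2] I2 by simp_all
  have D: "(\<lambda>n. (\<Sum>\<^sub>\<infinity>k. (s n * (r n (k + 1) - r n k))\<^sup>2) / s n) \<longlonglongrightarrow> G"
    unfolding G[symmetric]
    by (rule riemann_sum_LIMSEQ(1)[OF s _ _ weighted[OF gb, of 0, unfolded power_0 mult_1, OF zero_le]]) (auto intro!: tendsto_power g)
  define a where "a n = seq_N (r n) / s n" for n
  define b where "b n = seq_M1 (r n) / (s n)\<^sup>2" for n
  define c where "c n = seq_M2 (r n) / (s n) ^ 3" for n
  define d where "d n = s n * (seq_N (r n) - seq_C (r n))" for n
  define v where "v n = seq_C (r n) / s n" for n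
  have a: "a \<longlonglongrightarrow> I0" using N by (simp add: a_def [abs_def] seq_N_def)
  have b: "b \<longlonglongrightarrow> 0"
  proof -
    have "(\<Sum>\<^sub>\<infinity>k. (of_int k / s n) * (r n k)\<^sup>2) = (1 / s n) * seq_M1 (r n)" for n
      unfolding seq_M1_def by (subst infsum_cmult_right'[symmetric]) simp
    then show ?thesis using M1 by (simp add: b_def [abs_def] power2_eq_square)
  qed
  have c: "c \<longlonglongrightarrow> I2"
  proof -
    have "(\<Sum>\<^sub>\<infinity>k. (of_int k / s n)\<^sup>2 * (r n k)\<^sup>2) = (1 / s n)\<^sup>2 * seq_M2 (r n)" for n
      unfolding seq_M2_def by (subst infsum_cmult_right'[symmetric]) (simp add: power_divide)
    then show ?thesis using M2 by (simp add: c_def [abs_def] power2_eq_square power3_eq_cube)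
  qed
  have d: "d \<longlonglongrightarrow> G / 2"
  proof -
    have "\<forall>\<^sub>F n in sequentially. (\<Sum>\<^sub>\<infinity>k. (s n * (r n (k + 1) - r n k))\<^sup>2) / s n / 2 = d n"
      using Ns s_pos
    proof eventually_elim
      case (elim n)
      have "(\<Sum>\<^sub>\<infinity>k. (s n * (r n (k + 1) - r n k))\<^sup>2) = (s n)\<^sup>2 * (2 * (seq_N (r n) - seq_C (r n)))"
        unfolding power_mult_distrib infsum_cmult_right' infsum_increments(2)[OF elim(1)] ..
      then show ?case using elim by (simp add: d_def power2_eq_square)
    qed
    then show ?thesis
      by (rule Lim_transform_eventually[rotated]) (intro tendsto_intros D, simp)
  qed
  have v: "v \<longlonglongrightarrow> I0"
  proof -
    have inv: "(\<lambda>n. 1 / s n) \<longlonglongrightarrow> 0"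
      using tendsto_inverse_0_at_top[OF s] by (simp add: inverse_eq_divide)
    have "(\<lambda>n. a n - d n * (1 / s n) * (1 / s n)) \<longlonglongrightarrow> I0 - G / 2 * 0 * 0"
      by (intro tendsto_intros a d inv)
    moreover have "\<forall>\<^sub>F n in sequentially. a n - d n * (1 / s n) * (1 / s n) = v n"
      using s_pos by eventually_elim (simp add: a_def d_def v_def diff_divide_distrib)
    ultimately show ?thesis by (simp add: Lim_transform_eventually)
  qed
  have v_pos: "\<forall>\<^sub>F n in sequentially. v n > 0" and a_pos: "\<forall>\<^sub>F n in sequentially. a n > 0"
    using order_tendstoD(1)[OF v I0_pos] order_tendstoD(1)[OF a I0_pos] .
  show "\<forall>\<^sub>F n in sequentially. localised (r n)"
    using v_pos s_pos Ns M2s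
  proof eventually_elim
    case (elim n)
    have "(\<lambda>k. (s n)\<^sup>2 * ((of_int k / s n)\<^sup>2 * (r n k)\<^sup>2)) summable_on UNIV"
      by (rule summable_on_cmult_right[OF elim(4)])
    then have "(\<lambda>k. (of_int k)\<^sup>2 * (r n k)\<^sup>2) summable_on UNIV"
      using elim(2) by (simp add: power_divide)
    then show ?case
      using infsum_increments(1)[OF elim(3)] elim(1) by (auto simp: localised_def v_def)
  qed
  have "\<forall>\<^sub>F n in sequentially. sqrt (d n * (a n + v n) / (v n)\<^sup>2 * (c n / a n - (b n)\<^sup>2 / (a n)\<^sup>2)) = seq_UC (r n)"
    using v_pos a_pos s_pos
  proof eventually_elim
    case (elim n)
    let ?s = "s n"
    have e: "seq_N (r n) = ?s * a n" "seq_C (r n) = ?s * v n" "seq_M1 (r n) = ?s\<^sup>2 * b n" "seq_M2 (r n) = ?s ^ 3 * c n"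
      using elim by (auto simp: a_def v_def b_def c_def)
    have dd: "d n = ?s\<^sup>2 * (a n - v n)"
      unfolding d_def e by (simp add: power2_eq_square algebra_simps)
    have "(seq_N (r n))\<^sup>2 / (seq_C (r n))\<^sup>2 - 1 = (a n - v n) * (a n + v n) / (v n)\<^sup>2"
      unfolding e using elim by (simp add: field_simps power2_eq_square)
    moreover have "seq_M2 (r n) / seq_N (r n) - (seq_M1 (r n))\<^sup>2 / (seq_N (r n))\<^sup>2 = ?s\<^sup>2 * (c n / a n - (b n)\<^sup>2 / (a n)\<^sup>2)"
      unfolding e using elim by (simp add: field_simps power2_eq_square power3_eq_cube)
    ultimately show ?case unfolding seq_UC_def dd by (simp add: mult_ac)
  qed
  moreover have "(\<lambda>n. sqrt (d n * (a n + v n) / (v n)\<^sup>2 * (c n / a n - (b n)\<^sup>2 / (a n)\<^sup>2))) \<longlonglongrightarrow>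
      sqrt (G / 2 * (I0 + I0) / I0\<^sup>2 * (I2 / I0 - 0\<^sup>2 / I0\<^sup>2))"
    using I0_pos by (intro tendsto_intros a b c d v) auto
  moreover have "G / 2 * (I0 + I0) / I0\<^sup>2 * (I2 / I0 - 0\<^sup>2 / I0\<^sup>2) = G * I2 / I0\<^sup>2"
    using I0_pos by (simp add: field_simps power2_eq_square)
  ultimately show "(\<lambda>n. seq_UC (r n)) \<longlonglongrightarrow> sqrt (G * I2 / I0\<^sup>2)"
    by (simp add: Lim_transform_eventually)
qed

section \<open>The explicit masks\<close>

lemma nu_periodic: "nu a j (k + 2 ^ j) = nu a j k"
proof (cases "j \<le> 1")
  case False
  have "(k + 2 ^ j + 2 ^ (j - 2) - 1) mod 2 ^ j = (k + 2 ^ (j - 2) - 1) mod 2 ^ j"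
    using mod_add_self2[of "k + 2 ^ (j - 2) - 1" "2 ^ j"] by (simp add: algebra_simps)
  then show ?thesis using False by (simp add: nu_def)
qed (simp add: nu_def)

lemma nu_periodic_mult: "nu a j (k + 2 ^ j * l) = nu a j k"
  by (rule periodic_int_mult) (rule nu_periodic)

lemma two_power_split: "j \<ge> 2 \<Longrightarrow> (2::int) ^ j = 4 * 2 ^ (j - 2)" "j \<ge> 2 \<Longrightarrow> (2::int) ^ (j - 1) = 2 * 2 ^ (j - 2)"
proof -
  assume "j \<ge> 2"
  then obtain i where "j = i + 2" by (metis add.commute le_Suc_ex)
  then show "(2::int) ^ j = 4 * 2 ^ (j - 2)" "(2::int) ^ (j - 1) = 2 * 2 ^ (j - 2)" by auto
qed

definition nu_exponent :: "real \<Rightarrow> nat \<Rightarrow> int \<Rightarrow> real" where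
  "nu_exponent a j k = ((of_int k)\<^sup>2 + a\<^sup>2) / (real j * (real j - 1) * a)"

lemma nu_low:
  assumes "j \<ge> 2" "- (2 ^ (j - 2)) < k" "k \<le> 2 ^ (j - 2)"
  shows "nu a j k = exp (- nu_exponent a j k)"
proof -
  have "(k + 2 ^ (j - 2) - 1) mod 2 ^ j = k + 2 ^ (j - 2) - 1"
    using assms two_power_split[OF assms(1)] by (intro mod_pos_pos_trivial) auto
  then show ?thesis
    using assms unfolding nu_exponent_def minus_divide_left by (simp add: nu_def del: minus_add_distrib)
qed

lemma nu_high:
  assumes "j \<ge> 2" "- (2 ^ (j - 2)) < k" "k \<le> 2 ^ (j - 2)"
  shows "nu a j (k + 2 ^ (j - 1)) = sqrt (1 - exp (- 2 * nu_exponent a j k))"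
proof -
  have "(k + 2 ^ (j - 1) + 2 ^ (j - 2) - 1) mod 2 ^ j = k + 2 ^ (j - 1) + 2 ^ (j - 2) - 1"
    using assms two_power_split[OF assms(1)] by (intro mod_pos_pos_trivial) auto
  moreover have "\<not> k + 2 ^ (j - 1) \<le> 2 ^ (j - 2)" "\<not> j \<le> 1"
    using assms two_power_split[OF assms(1)] by auto
  ultimately show ?thesis
    unfolding nu_exponent_def times_divide_eq_right by (simp add: nu_def Let_def)
qed

text \<open>
  Modulo \<open>2 ^ j\<close> every frequency lies in the low-pass window or in its translate by \<open>2 ^ (j - 1)\<close>, and
  the shift by \<open>2 ^ (j - 1)\<close> exchanges the two.
\<close>

lemma nu_reduce:
  assumes "j \<ge> 2"
  obtains m where "- (2 ^ (j - 2)) < m" "m \<le> 2 ^ (j - 2)"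
    "nu a j k = nu a j m \<and> nu a j (k + 2 ^ (j - 1)) = nu a j (m + 2 ^ (j - 1)) \<or>
     nu a j k = nu a j (m + 2 ^ (j - 1)) \<and> nu a j (k + 2 ^ (j - 1)) = nu a j m"
proof -
  let ?P = "(2::int) ^ (j - 2)"
  note P = two_power_split[OF assms]
  define t where "t = k + ?P - 1"
  define m where "m = t mod 2 ^ (j - 1) - ?P + 1"
  define q where "q = t div 2 ^ (j - 1)"
  have k: "k = m + 2 ^ (j - 1) * q"
    using mult_div_mod_eq[of "2 ^ (j - 1)" t] unfolding m_def q_def t_def by linarith
  have "0 \<le> t mod 2 ^ (j - 1)" "t mod 2 ^ (j - 1) < 2 ^ (j - 1)" by simp_all
  then have m: "- ?P < m" "m \<le> ?P" using P(2) unfolding m_def by linarith+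
  show ?thesis
  proof (cases "even q")
    case True
    then obtain p where "q = 2 * p" by (elim evenE)
    then have "k = m + 2 ^ j * p" "k + 2 ^ (j - 1) = m + 2 ^ (j - 1) + 2 ^ j * p"
      using k P by auto
    then show ?thesis using that[OF m] nu_periodic_mult by metis
  next
    case False
    then obtain p where "q = 2 * p + 1" by (elim oddE)
    then have "k = m + 2 ^ (j - 1) + 2 ^ j * p" "k + 2 ^ (j - 1) = m + 2 ^ j * (p + 1)"
      using k P by (auto simp: algebra_simps)
    then show ?thesis using that[OF m] nu_periodic_mult by metis
  qed
qed

lemma nu_exponent_pos:
  assumes "a > 0" "j \<ge> 2"
  shows "nu_exponent a j k > 0"
proof -
  have "real j * (real j - 1) * a > 0" using assms by auto
  moreover have "(of_int k)\<^sup>2 + a\<^sup>2 > 0" using assms by (intro add_nonneg_pos) auto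
  ultimately show ?thesis by (simp add: nu_exponent_def)
qed

lemma nu_qmf:
  assumes a: "a > 0" and j: "j \<ge> 1"
  shows "(nu a j k)\<^sup>2 + (nu a j (k + 2 ^ (j - 1)))\<^sup>2 = 1"
proof (cases "j = 1")
  case True
  then show ?thesis by (simp add: nu_def)
next
  case False
  with j have j: "j \<ge> 2" by simp
  have "(nu a j m)\<^sup>2 + (nu a j (m + 2 ^ (j - 1)))\<^sup>2 = 1" if m: "- (2 ^ (j - 2)) < m" "m \<le> 2 ^ (j - 2)" for m
    unfolding nu_low[OF j m] nu_high[OF j m] using nu_exponent_pos[OF a j, of m]
    by (simp add: exp_double[symmetric])
  then show ?thesis using nu_reduce[OF j, of a k] by (metis add.commute)
qed

lemma nu_pos:
  assumes a: "a > 0"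
  shows "nu a j k > 0"
proof (cases "j \<le> 1")
  case True
  then show ?thesis by (simp add: nu_def)
next
  case False
  then have j: "j \<ge> 2" by simp
  have "nu a j m > 0 \<and> nu a j (m + 2 ^ (j - 1)) > 0" if m: "- (2 ^ (j - 2)) < m" "m \<le> 2 ^ (j - 2)" for m
    unfolding nu_low[OF j m] nu_high[OF j m] using nu_exponent_pos[OF a j, of m] by simp
  then show ?thesis using nu_reduce[OF j, of a k] by metis
qed

lemma nu_le_1:
  assumes "a > 0"
  shows "nu a j k \<le> 1"
proof (cases "j \<ge> 1")
  case True
  have "(nu a j k)\<^sup>2 \<le> 1"
    using nu_qmf[OF assms True, of k] zero_le_power2[of "nu a j (k + 2 ^ (j - 1))"] by linarith
  then show ?thesis by (simp add: power2_le_iff_abs_le abs_square_le_1)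
qed (simp add: nu_def)

text \<open>The exponents telescope, because \<open>1 / (r (r - 1)) = 1 / (r - 1) - 1 / r\<close>.\<close>

lemma xi_nu_main:
  assumes a: "a > 0" and j: "j \<ge> 1" and k: "\<bar>k\<bar> < 2 ^ (j - 1)"
  shows "convergent_prod (\<lambda>r. nu a (j + 1 + r) k)"
    and "xi_hat (nu a) j k = exp (- (((of_int k)\<^sup>2 + a\<^sup>2) / (a * real j)))"
proof -
  define q where "q = ((of_int k)\<^sup>2 + a\<^sup>2) / a"
  have f: "nu a (j + 1 + i) k = exp (- q * (1 / real (j + i) - 1 / real (j + i + 1)))" for i
  proof -
    have "(2::int) ^ (j - 1) \<le> 2 ^ (j + 1 + i - 2)" by (intro power_increasing) auto
    then have k': "- (2 ^ (j + 1 + i - 2)) < k" "k \<le> 2 ^ (j + 1 + i - 2)" using k by linarith+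
    have X: "real (j + 1 + i) = real (j + i) + 1" by simp
    have "1 / real (j + i) - 1 / real (j + i + 1) = 1 / (real (j + i) * (real (j + i) + 1))"
      using j by (simp add: field_simps)
    then have "nu_exponent a (j + 1 + i) k = q * (1 / real (j + i) - 1 / real (j + i + 1))"
      unfolding nu_exponent_def X q_def by (simp add: mult_ac)
    then show ?thesis
      using j by (subst nu_low[OF _ k']) simp_all
  qed
  have prod: "(\<Prod>i\<le>n. nu a (j + 1 + i) k) = exp (- q * (1 / real j - 1 / real (j + n + 1)))" for n
  proof (induction n)
    case 0
    show ?case using f[of 0] by simp
  next
    case (Suc n)
    have "(\<Prod>i\<le>Suc n. nu a (j + 1 + i) k) = exp (- q * (1 / real j - 1 / real (j + n + 1))
        + - q * (1 / real (j + Suc n) - 1 / real (j + Suc n + 1)))"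
      unfolding prod.atMost_Suc Suc exp_add f[of "Suc n"] ..
    also have "- q * (1 / real j - 1 / real (j + n + 1)) + - q * (1 / real (j + Suc n) - 1 / real (j + Suc n + 1))
        = - q * (1 / real j - 1 / real (j + Suc n + 1))"
      by (simp add: right_diff_distrib)
    finally show ?case .
  qed
  have "(\<lambda>n. 1 / real (j + n + 1)) \<longlonglongrightarrow> 0" by real_asymp
  then have "(\<lambda>n. exp (- q * (1 / real j - 1 / real (j + n + 1)))) \<longlonglongrightarrow> exp (- q * (1 / real j - 0))"
    by (intro tendsto_intros)
  then have raw: "raw_has_prod (\<lambda>r. nu a (j + 1 + r) k) 0 (exp (- q / real j))"
    unfolding raw_has_prod_def add_0_right prod by simp
  then show "convergent_prod (\<lambda>r. nu a (j + 1 + r) k)" by (auto simp: convergent_prod_def)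
  have "(\<lambda>r. nu a (j + 1 + r) k) has_prod (exp (- q / real j))" using raw by (simp add: has_prod_def)
  then show "xi_hat (nu a) j k = exp (- (((of_int k)\<^sup>2 + a\<^sup>2) / (a * real j)))"
    unfolding xi_hat_def by (simp add: has_prod_unique[symmetric] q_def)
qed

lemma eventually_abs_less_power: "\<forall>\<^sub>F j in sequentially. \<bar>k :: int\<bar> < 2 ^ (j - c)"
  using eventually_ge_at_top[of "nat \<bar>k\<bar> + c"]
proof eventually_elim
  case (elim j)
  have "int (j - c) < 2 ^ (j - c)" using of_nat_less_two_power[of "j - c", where 'a = int] by simp
  then show ?case using elim by linarith
qed

lemma nu_convergent_prod:
  assumes a: "a > 0"
  shows "convergent_prod (\<lambda>r. nu a (j + 1 + r) k)"
proof -
  obtain n where n: "n \<ge> max j 1" "\<bar>k\<bar> < 2 ^ (n - 1)"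
    using eventually_happens'[OF sequentially_bot eventually_conj[OF eventually_ge_at_top[of "max j 1"] eventually_abs_less_power[of k 1]]]
    by blast
  then have "convergent_prod (\<lambda>r. nu a (n + 1 + r) k)" using xi_nu_main(1)[OF a _ n(2)] by simp
  then have "convergent_prod (\<lambda>r. nu a (j + 1 + (r + (n - j))) k)"
    using n(1) by (simp add: add_ac)
  then show ?thesis by (rule convergent_prod_offset)
qed

lemma xi_nu_bounds:
  assumes a: "a > 0"
  shows "0 \<le> xi_hat (nu a) j k" "xi_hat (nu a) j k \<le> 1"
proof -
  have lim: "(\<lambda>m. \<Prod>i<m. nu a (j + 1 + i) k) \<longlonglongrightarrow> xi_hat (nu a) j k"
    by (rule xi_hat_LIMSEQ[of "nu a" j k, OF nu_convergent_prod[OF a]])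
  show "0 \<le> xi_hat (nu a) j k"
    using lim by (rule tendsto_lowerbound) (auto intro!: always_eventually prod_nonneg less_imp_le[OF nu_pos[OF a]])
  show "xi_hat (nu a) j k \<le> 1"
    using lim by (rule tendsto_upperbound) (auto intro!: always_eventually prod_le_1 less_imp_le[OF nu_pos[OF a]] nu_le_1[OF a])
qed

lemma xi_nu_mono:
  assumes a: "a > 0" and "j \<le> n"
  shows "xi_hat (nu a) j k \<le> xi_hat (nu a) n k"
  using assms(2)
proof (induction n rule: dec_induct)
  case (step n)
  have "xi_hat (nu a) n k = nu a (n + 1) k * xi_hat (nu a) (n + 1) k"
    by (rule xi_hat_refinement[of "nu a" k n, OF nu_convergent_prod[OF a]])
  also have "\<dots> \<le> 1 * xi_hat (nu a) (n + 1) k"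
    by (intro mult_right_mono nu_le_1 xi_nu_bounds a)
  finally show ?case using step by simp
qed simp

lemma square_le_two_power: "n\<^sup>2 \<le> 2 ^ (n + 1)" for n :: nat
proof (induction n rule: nat_less_induct)
  case (1 n)
  show ?case
  proof (cases "n \<le> 4")
    case True
    then have "n \<in> {0, 1, 2, 3, 4}" by auto
    then show ?thesis by auto
  next
    case False
    then obtain m where m: "n = Suc m" "m \<ge> 4" by (cases n) auto
    have "4 * m \<le> m * m" using m(2) by (intro mult_right_mono) auto
    moreover have "n\<^sup>2 = m * m + 2 * m + 1" using m(1) by (simp add: power2_eq_square)
    ultimately have "n\<^sup>2 \<le> 2 * m\<^sup>2" using m(2) unfolding power2_eq_square[of m] by linarith
    moreover have "m\<^sup>2 \<le> 2 ^ (m + 1)" using 1 m by simp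
    ultimately show ?thesis using m by simp
  qed
qed

text \<open>
  Such a frequency \<open>k\<close> lies in the outer part of the window of some level \<open>n \<ge> j\<close>, where the Gaussian of width \<open>sqrt (a n)\<close> is already tiny since
  \<open>\<bar>k\<bar>\<close> is about \<open>2 ^ n\<close>.
\<close>

lemma xi_nu_tail:
  assumes a: "0 < a" "a \<le> real j" and j: "j \<ge> 3" and k: "\<bar>k\<bar> \<ge> 2 ^ (j - 3)"
  shows "xi_hat (nu a) j k \<le> exp (- \<bar>of_int k\<bar> / 16)"
proof -
  have ex: "\<exists>n. n \<ge> j \<and> \<bar>k\<bar> < 2 ^ (n - 1)"
    using eventually_happens'[OF sequentially_bot eventually_conj[OF eventually_ge_at_top[of j] eventually_abs_less_power[of k 1]]]
    by blast
  define n where "n = (LEAST n. n \<ge> j \<and> \<bar>k\<bar> < 2 ^ (n - 1))"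
  have n: "n \<ge> j" "\<bar>k\<bar> < 2 ^ (n - 1)" using LeastI_ex[OF ex] by (auto simp: n_def)
  have k3: "\<bar>k\<bar> \<ge> 2 ^ (n - 3)"
  proof (cases "n = j")
    case False
    then have "n - 1 \<ge> j" "n - 1 < n" using n(1) j by auto
    then have "\<not> \<bar>k\<bar> < 2 ^ (n - 1 - 1)" 
      using not_less_Least[of "n - 1" "\<lambda>n. n \<ge> j \<and> \<bar>k\<bar> < 2 ^ (n - 1)"] unfolding n_def by blast
    moreover have "(2::int) ^ (n - 3) \<le> 2 ^ (n - 1 - 1)" by (intro power_increasing) auto
    ultimately show ?thesis by linarith
  qed (use k in simp)
  have "xi_hat (nu a) j k \<le> xi_hat (nu a) n k" by (rule xi_nu_mono[OF a(1) n(1)])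
  also have "\<dots> = exp (- (((of_int k)\<^sup>2 + a\<^sup>2) / (a * real n)))"
    using n j by (intro xi_nu_main a) auto
  also have "\<dots> \<le> exp (- \<bar>of_int k\<bar> / 16)"
  proof -
    have n3: "n = (n - 3) + 3" using n j by simp
    have "(n\<^sup>2 :: nat) \<le> 2 ^ ((n - 3) + 3 + 1)" using square_le_two_power[of n] n3 by simp
    then have "real (n\<^sup>2) \<le> real (16 * 2 ^ (n - 3))" by (subst of_nat_le_iff) (simp add: power_add)
    then have n2: "(real n)\<^sup>2 \<le> 16 * 2 ^ (n - 3)" by simp
    have "real_of_int (2 ^ (n - 3)) \<le> real_of_int \<bar>k\<bar>" using k3 by (simp only: of_int_le_iff)
    then have K: "2 ^ (n - 3) \<le> \<bar>real_of_int k\<bar>" by simp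
    have pos: "a * real n > 0" using a n j by simp
    have "\<bar>real_of_int k\<bar> * (a * real n) \<le> \<bar>real_of_int k\<bar> * (real n * real n)"
      using a n by (intro mult_left_mono mult_right_mono) auto
    also have "\<dots> \<le> \<bar>real_of_int k\<bar> * (16 * \<bar>real_of_int k\<bar>)"
      using n2 K by (intro mult_left_mono) (auto simp: power2_eq_square)
    also have "\<dots> \<le> 16 * ((of_int k)\<^sup>2 + a\<^sup>2)"
    proof -
      have "\<bar>real_of_int k\<bar> * (16 * \<bar>real_of_int k\<bar>) = 16 * \<bar>real_of_int k\<bar>\<^sup>2"
        by (simp only: power2_eq_square mult.left_commute)
      also have "\<dots> \<le> 16 * ((of_int k)\<^sup>2 + a\<^sup>2)" by simp
      finally show ?thesis .
    qed
    finally have "\<bar>real_of_int k\<bar> / 16 \<le> ((of_int k)\<^sup>2 + a\<^sup>2) / (a * real n)"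
      using pos by (simp add: pos_le_divide_eq)
    then show ?thesis by simp
  qed
  finally show ?thesis .
qed

lemma xi_nu_summable:
  assumes a: "a > 0"
  shows "(\<lambda>k. \<bar>xi_hat (nu a) j k\<bar>) summable_on UNIV"
proof -
  define J where "J = max j (max 3 (nat \<lceil>a\<rceil>))"
  have J: "J \<ge> j" "J \<ge> 3" "a \<le> real J" unfolding J_def by linarith+
  let ?B = "exp (2 ^ (J - 3) / 16)"
  show ?thesis
  proof (rule summable_on_comparison_test)
    show "(\<lambda>k::int. ?B * exp (- \<bar>of_int k\<bar> / 16) :: real) summable_on UNIV"
      by (intro summable_on_cmult_right summable_exp_minus_abs) simp
    fix k :: int
    have "xi_hat (nu a) j k \<le> ?B * exp (- \<bar>of_int k\<bar> / 16)"
    proof (cases "\<bar>k\<bar> \<ge> 2 ^ (J - 3)")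
      case True
      have "xi_hat (nu a) j k \<le> exp (- \<bar>of_int k\<bar> / 16)"
        using xi_nu_mono[OF a J(1), of k] xi_nu_tail[OF a J(3,2) True] by linarith
      also have "\<dots> \<le> ?B * exp (- \<bar>of_int k\<bar> / 16)" by simp
      finally show ?thesis .
    next
      case False
      then have "real_of_int \<bar>k\<bar> \<le> real_of_int (2 ^ (J - 3))" by (simp only: of_int_le_iff)
      then have "1 \<le> exp (2 ^ (J - 3) / 16 + - \<bar>real_of_int k\<bar> / 16)" by simp
      then show ?thesis using xi_nu_bounds(2)[OF a, of j k] unfolding exp_add by linarith
    qed
    then show "\<bar>xi_hat (nu a) j k\<bar> \<le> ?B * exp (- \<bar>of_int k\<bar> / 16)"
      using xi_nu_bounds(1)[OF a] by simp
  qed simp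
qed

lemma xi_nu_LIMSEQ:
  assumes a: "a > 0"
  shows "(\<lambda>j. xi_hat (nu a) j k) \<longlonglongrightarrow> 1"
proof -
  have "(\<lambda>j. exp (- ((((of_int k)\<^sup>2 + a\<^sup>2) / a) / real j))) \<longlonglongrightarrow> exp (- 0)"
    by (intro tendsto_intros tendsto_divide_0[OF tendsto_const] filterlim_at_top_imp_at_infinity filterlim_real_sequentially)
  moreover have "\<forall>\<^sub>F j in sequentially. exp (- ((((of_int k)\<^sup>2 + a\<^sup>2) / a) / real j)) = xi_hat (nu a) j k"
    using eventually_abs_less_power[of k 1] eventually_ge_at_top[of 1]
  proof eventually_elim
    case (elim j)
    then show ?case using xi_nu_main(2)[OF a, of j k] by simp
  qed
  ultimately show ?thesis by (simp add: Lim_transform_eventually)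
qed

lemma qmf_masks_nu: "a > 0 \<Longrightarrow> qmf_masks (nu a)"
  by unfold_locales (simp_all add: nu_periodic nu_qmf nu_convergent_prod xi_nu_LIMSEQ xi_nu_summable
      del: One_nat_def add_Suc add_Suc_right)

text \<open>
  A constant mask satisfies the quadrature mirror condition, and passing such a level only multiplies
  the scaling function by a constant. So below level \<open>J\<close> all of them are proportional to that of
  level \<open>J\<close>.
\<close>

definition flat_masks :: "nat \<Rightarrow> (nat \<Rightarrow> int \<Rightarrow> real) \<Rightarrow> nat \<Rightarrow> int \<Rightarrow> real" where
  "flat_masks J \<nu> j = (if j \<le> J then (\<lambda>_. sqrt (1 / 2)) else \<nu> j)"

lemma flat_masks_convergent_prod:
  assumes "qmf_masks \<nu>"
  shows "convergent_prod (\<lambda>r. flat_masks J \<nu> (j + 1 + r) k)"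
proof -
  have "convergent_prod (\<lambda>r. \<nu> ((j + J) + 1 + r) k)" by (rule qmf_masks.conv[OF assms])
  then have "convergent_prod (\<lambda>r. flat_masks J \<nu> (j + 1 + (r + J)) k)"
    by (simp add: flat_masks_def add_ac)
  then show ?thesis by (rule convergent_prod_offset)
qed

lemma xi_hat_flat_masks:
  assumes "qmf_masks \<nu>"
  shows "xi_hat (flat_masks J \<nu>) j k = sqrt (1 / 2) ^ (J - j) * xi_hat \<nu> (max j J) k"
proof (induction "J - j" arbitrary: j)
  case 0
  then show ?case by (simp add: xi_hat_def flat_masks_def max_absorb1)
next
  case (Suc d)
  have "j + 1 \<le> J" using Suc(2) by linarith
  then have "xi_hat (flat_masks J \<nu>) j k = sqrt (1 / 2) * xi_hat (flat_masks J \<nu>) (j + 1) k"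
    by (subst xi_hat_refinement[of "flat_masks J \<nu>" k j, OF flat_masks_convergent_prod[OF assms]]) (simp add: flat_masks_def)
  also have "xi_hat (flat_masks J \<nu>) (j + 1) k = sqrt (1 / 2) ^ (J - (j + 1)) * xi_hat \<nu> (max (j + 1) J) k"
    using Suc(2) by (intro Suc(1)) simp
  also have "max (j + 1) J = max j J" using Suc(2) by simp
  also have "sqrt (1 / 2) * (sqrt (1 / 2) ^ (J - (j + 1)) * xi_hat \<nu> (max j J) k) = sqrt (1 / 2) ^ Suc (J - (j + 1)) * xi_hat \<nu> (max j J) k"
    by (simp only: power_Suc mult.assoc)
  also have "Suc (J - (j + 1)) = J - j" using Suc(2) by simp
  finally show ?case .
qed

lemma qmf_masks_flat:
  assumes "qmf_masks \<nu>"
  shows "qmf_masks (flat_masks J \<nu>)"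
proof -
  interpret qmf_masks \<nu> by fact
  show ?thesis
  proof
    show "flat_masks J \<nu> j (k + 2 ^ j) = flat_masks J \<nu> j k" if "j \<ge> 1" for j k
      using periodic[OF that] by (simp add: flat_masks_def)
    show "(flat_masks J \<nu> j k)\<^sup>2 + (flat_masks J \<nu> j (k + 2 ^ (j - 1)))\<^sup>2 = 1" if "j \<ge> 1" for j k
      using qmf[OF that] by (simp add: flat_masks_def)
    show "convergent_prod (\<lambda>r. flat_masks J \<nu> (j + 1 + r) k)" for j k
      by (rule flat_masks_convergent_prod[OF assms])
    have "\<forall>\<^sub>F j in sequentially. xi_hat \<nu> j k = xi_hat (flat_masks J \<nu>) j k" for k
      using eventually_ge_at_top[of J] by eventually_elim (simp add: xi_hat_flat_masks[OF assms] max_absorb1)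
    then show "(\<lambda>j. xi_hat (flat_masks J \<nu>) j k) \<longlonglongrightarrow> 1" for k
      by (rule Lim_transform_eventually[OF xi_lim])
    show "(\<lambda>k. \<bar>xi_hat (flat_masks J \<nu>) j k\<bar>) summable_on UNIV" for j
      unfolding xi_hat_flat_masks[OF assms] abs_mult
      by (intro summable_on_cmult_right xi_summable)
  qed
qed

section \<open>Sampled profiles\<close>

text \<open>
  On the central window the sequence samples a smooth function at spacing \<open>1 / s\<close>, so that the mean
  value theorem controls its increments; outside, all values are negligible.
\<close>

lemma sampled_profile_UC_LIMSEQ:
  fixes r :: "nat \<Rightarrow> int \<Rightarrow> real" and f g :: "real \<Rightarrow> real" and C C' :: "nat \<Rightarrow> real \<Rightarrow> real" and K :: "nat \<Rightarrow> int"
  assumes s: "filterlim s at_top sequentially"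
    and K: "\<And>x. \<forall>\<^sub>F n in sequentially. \<bar>x\<bar> * s n + 2 \<le> real_of_int (K n)"
    and main: "\<forall>\<^sub>F n in sequentially. \<forall>k. \<bar>k\<bar> \<le> K n \<longrightarrow> r n k = C n (of_int k / s n)"
    and tail: "\<forall>\<^sub>F n in sequentially. \<forall>k. \<bar>k\<bar> \<ge> K n \<longrightarrow> s n * \<bar>r n k\<bar> \<le> B * exp (- \<bar>of_int k\<bar> / s n)"
    and C: "\<forall>\<^sub>F n in sequentially. \<forall>u. (C n has_real_derivative C' n u) (at u)"
    and Cb: "\<forall>\<^sub>F n in sequentially. \<forall>u. \<bar>C n u\<bar> \<le> B * exp (- \<bar>u\<bar>) \<and> \<bar>C' n u\<bar> \<le> B * exp (- \<bar>u\<bar>)"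
    and Cl: "\<And>x u. x \<noteq> 0 \<Longrightarrow> u \<longlonglongrightarrow> x \<Longrightarrow> (\<lambda>n. C n (u n)) \<longlonglongrightarrow> f x"
    and C'l: "\<And>x u. x \<noteq> 0 \<Longrightarrow> u \<longlonglongrightarrow> x \<Longrightarrow> (\<lambda>n. C' n (u n)) \<longlonglongrightarrow> g x"
    and meas: "f \<in> borel_measurable borel" "g \<in> borel_measurable borel"
    and I0: "(\<integral>x. (f x)\<^sup>2 \<partial>lborel) = I0" and I1: "(\<integral>x. x * (f x)\<^sup>2 \<partial>lborel) = 0"
    and I2: "(\<integral>x. x\<^sup>2 * (f x)\<^sup>2 \<partial>lborel) = I2" and G: "(\<integral>x. (g x)\<^sup>2 \<partial>lborel) = G" and I0_pos: "I0 > 0"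
  shows "\<forall>\<^sub>F n in sequentially. localised (r n)"
    and "(\<lambda>n. seq_UC (r n)) \<longlonglongrightarrow> sqrt (G * I2 / I0\<^sup>2)"
proof -
  have s1: "\<forall>\<^sub>F n in sequentially. s n \<ge> 1" using s by (simp add: filterlim_at_top)
  have inv: "(\<lambda>n. 1 / s n) \<longlonglongrightarrow> 0"
    using tendsto_inverse_0_at_top[OF s] by (simp add: inverse_eq_divide)
  have B: "B \<ge> 0"
  proof -
    obtain n where "\<forall>u. \<bar>C n u\<bar> \<le> B * exp (- \<bar>u\<bar>) \<and> \<bar>C' n u\<bar> \<le> B * exp (- \<bar>u\<bar>)"
      using eventually_happens'[OF sequentially_bot Cb] by blast
    then have "\<bar>C n 0\<bar> \<le> B * exp (- \<bar>0\<bar>)" by blast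
    then show ?thesis by simp
  qed
  have mvt: "\<exists>\<xi>. of_int k / s n \<le> \<xi> \<and> \<xi> \<le> of_int k / s n + 1 / s n \<and> s n * (r n (k + 1) - r n k) = C' n \<xi>"
    if "s n \<ge> 1" "\<forall>u. (C n has_real_derivative C' n u) (at u)"
      "\<forall>k. \<bar>k\<bar> \<le> K n \<longrightarrow> r n k = C n (of_int k / s n)" "\<bar>k\<bar> \<le> K n" "\<bar>k + 1\<bar> \<le> K n" for n k
  proof -
    let ?u = "of_int k / s n" and ?v = "of_int k / s n + 1 / s n"
    have "?u < ?v" using that(1) by simp
    from MVT2[OF this, of "C n" "C' n"] that(2)
    obtain \<xi> where \<xi>: "?u < \<xi>" "\<xi> < ?v" "C n ?v - C n ?u = (?v - ?u) * C' n \<xi>" by blast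
    have "r n (k + 1) = C n ?v" using that(3,5) by (simp add: add_divide_distrib)
    moreover have "r n k = C n ?u" using that(3,4) by simp
    ultimately have "s n * (r n (k + 1) - r n k) = C' n \<xi>"
      using \<xi>(3) that(1) by simp
    then show ?thesis using \<xi> by (intro exI[of _ \<xi>]) auto
  qed
  have window: "\<forall>\<^sub>F n in sequentially. \<bar>\<lfloor>x * s n\<rfloor>\<bar> \<le> K n \<and> \<bar>\<lfloor>x * s n\<rfloor> + 1\<bar> \<le> K n" for x
    using K[of x] s1
  proof eventually_elim
    case (elim n)
    have "\<bar>x * s n\<bar> = \<bar>x\<bar> * s n" using elim by (simp add: abs_mult)
    then have "\<bar>x * s n\<bar> + 2 \<le> of_int (K n)" using elim by simp
    then show ?case by linarith
  qed
  have fl: "(\<lambda>n. r n \<lfloor>x * s n\<rfloor>) \<longlonglongrightarrow> f x" if "x \<noteq> 0" for x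
  proof (rule Lim_transform_eventually[OF Cl[OF that floor_scaled_LIMSEQ[OF s]]])
    show "\<forall>\<^sub>F n in sequentially. C n (of_int \<lfloor>x * s n\<rfloor> / s n) = r n \<lfloor>x * s n\<rfloor>"
      using window[of x] main by eventually_elim simp
  qed
  have gl: "(\<lambda>n. s n * (r n (\<lfloor>x * s n\<rfloor> + 1) - r n \<lfloor>x * s n\<rfloor>)) \<longlonglongrightarrow> g x" if "x \<noteq> 0" for x
  proof -
    let ?k = "\<lambda>n. \<lfloor>x * s n\<rfloor>"
    have "\<forall>\<^sub>F n in sequentially. \<exists>\<xi>. of_int (?k n) / s n \<le> \<xi> \<and> \<xi> \<le> of_int (?k n) / s n + 1 / s n \<and>
        s n * (r n (?k n + 1) - r n (?k n)) = C' n \<xi>"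
      using s1 C main window[of x] by eventually_elim (rule mvt, auto)
    then obtain \<xi> where \<xi>: "\<forall>\<^sub>F n in sequentially. of_int (?k n) / s n \<le> \<xi> n \<and> \<xi> n \<le> of_int (?k n) / s n + 1 / s n \<and>
        s n * (r n (?k n + 1) - r n (?k n)) = C' n (\<xi> n)"
      unfolding eventually_ex by blast
    have "\<xi> \<longlonglongrightarrow> x"
    proof (rule tendsto_sandwich)
      show "\<forall>\<^sub>F n in sequentially. of_int (?k n) / s n \<le> \<xi> n" "\<forall>\<^sub>F n in sequentially. \<xi> n \<le> of_int (?k n) / s n + 1 / s n"
        using \<xi> by (auto elim: eventually_mono)
      show "(\<lambda>n. of_int (?k n) / s n) \<longlonglongrightarrow> x" by (rule floor_scaled_LIMSEQ[OF s])
      show "(\<lambda>n. of_int (?k n) / s n + 1 / s n) \<longlonglongrightarrow> x"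
        using tendsto_add[OF floor_scaled_LIMSEQ[OF s] inv] by simp
    qed
    from C'l[OF that this] show ?thesis
      by (rule Lim_transform_eventually) (use \<xi> in \<open>auto elim: eventually_mono\<close>)
  qed
  let ?B = "B * (1 + exp 1)"
  have B': "B \<le> ?B" "B * exp 1 \<le> ?B" using B by (auto simp: distrib_left)
  have fb: "\<forall>\<^sub>F n in sequentially. \<forall>k. \<bar>r n k\<bar> \<le> ?B * exp (- \<bar>of_int k\<bar> / s n)"
    using s1 main tail Cb
  proof eventually_elim
    case (elim n)
    show ?case
    proof
      fix k
      have "\<bar>r n k\<bar> \<le> B * exp (- \<bar>of_int k\<bar> / s n)"
      proof (cases "\<bar>k\<bar> \<le> K n")
        case True
        then have "r n k = C n (of_int k / s n)" using elim(2) by blast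
        moreover have "\<bar>C n (of_int k / s n)\<bar> \<le> B * exp (- \<bar>of_int k / s n\<bar>)" using elim(4) by blast
        ultimately show ?thesis using elim(1) by simp
      next
        case False
        then have "s n * \<bar>r n k\<bar> \<le> B * exp (- \<bar>of_int k\<bar> / s n)" using elim(3) by auto
        moreover have "1 * \<bar>r n k\<bar> \<le> s n * \<bar>r n k\<bar>" using elim(1) by (intro mult_right_mono) auto
        ultimately show ?thesis by linarith
      qed
      also have "\<dots> \<le> ?B * exp (- \<bar>of_int k\<bar> / s n)" using B' by (intro mult_right_mono) auto
      finally show "\<bar>r n k\<bar> \<le> ?B * exp (- \<bar>of_int k\<bar> / s n)" .
    qed
  qed
  have gb: "\<forall>\<^sub>F n in sequentially. \<forall>k. \<bar>s n * (r n (k + 1) - r n k)\<bar> \<le> ?B * exp (- \<bar>of_int k\<bar> / s n)"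
    using s1 main tail Cb C
  proof eventually_elim
    case (elim n)
    have near: "B * exp (- y) \<le> B * exp 1 * exp (- \<bar>of_int k\<bar> / s n)" if "y \<ge> \<bar>of_int k\<bar> / s n - 1 / s n" for y and k :: int
    proof -
      have "1 / s n \<le> 1" using elim(1) by simp
      then have "- y \<le> 1 + - \<bar>of_int k\<bar> / s n" using that by simp
      then have "exp (- y) \<le> exp 1 * exp (- \<bar>of_int k\<bar> / s n)" unfolding exp_add[symmetric] by simp
      then show ?thesis using B by (simp add: mult.assoc mult_left_mono)
    qed
    show ?case
    proof
      fix k
      show "\<bar>s n * (r n (k + 1) - r n k)\<bar> \<le> ?B * exp (- \<bar>of_int k\<bar> / s n)"
      proof (cases "\<bar>k\<bar> \<le> K n \<and> \<bar>k + 1\<bar> \<le> K n")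
        case True
        then obtain \<xi> where \<xi>: "of_int k / s n \<le> \<xi>" "\<xi> \<le> of_int k / s n + 1 / s n" "s n * (r n (k + 1) - r n k) = C' n \<xi>"
          using mvt[OF elim(1,5,2)] by blast
        have "\<bar>of_int k / s n\<bar> = \<bar>of_int k\<bar> / s n" "1 / s n \<ge> 0" using elim(1) by (auto simp: abs_divide)
        then have "\<bar>\<xi>\<bar> \<ge> \<bar>of_int k\<bar> / s n - 1 / s n" using \<xi>(1,2) by linarith
        from near[OF this] have "\<bar>C' n \<xi>\<bar> \<le> B * exp 1 * exp (- \<bar>of_int k\<bar> / s n)"
          using elim(4) order_trans by blast
        also have "\<dots> \<le> ?B * exp (- \<bar>of_int k\<bar> / s n)" using B' by (intro mult_right_mono) auto
        finally show ?thesis unfolding \<xi>(3) .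
      next
        case False
        then have "\<bar>k\<bar> \<ge> K n" "\<bar>k + 1\<bar> \<ge> K n" by linarith+
        then have t: "s n * \<bar>r n k\<bar> \<le> B * exp (- \<bar>of_int k\<bar> / s n)"
          "s n * \<bar>r n (k + 1)\<bar> \<le> B * exp (- (\<bar>of_int (k + 1)\<bar> / s n))"
          using elim(3) by auto
        have "\<bar>real_of_int (k + 1)\<bar> \<ge> \<bar>of_int k\<bar> - 1" by linarith
        then have "\<bar>real_of_int (k + 1)\<bar> / s n \<ge> \<bar>of_int k\<bar> / s n - 1 / s n"
          unfolding diff_divide_distrib[symmetric] using elim(1) by (intro divide_right_mono) auto
        note n = near[OF this]
        have "\<bar>s n * (r n (k + 1) - r n k)\<bar> = s n * \<bar>r n (k + 1) - r n k\<bar>"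
          using elim(1) by (simp add: abs_mult)
        also have "\<dots> \<le> s n * (\<bar>r n (k + 1)\<bar> + \<bar>r n k\<bar>)"
          using elim(1) by (intro mult_left_mono) auto
        also have "\<dots> \<le> B * exp 1 * exp (- \<bar>of_int k\<bar> / s n) + B * exp (- \<bar>of_int k\<bar> / s n)"
          unfolding distrib_left using t n by linarith
        also have "\<dots> = ?B * exp (- \<bar>of_int k\<bar> / s n)" by (simp add: algebra_simps)
        finally show ?thesis .
      qed
    qed
  qed
  show "\<forall>\<^sub>F n in sequentially. localised (r n)" "(\<lambda>n. seq_UC (r n)) \<longlonglongrightarrow> sqrt (G * I2 / I0\<^sup>2)"
    using profile_UC_LIMSEQ[OF s fl gl meas fb gb I0 I1 I2 G I0_pos] by auto
qed

lemma gaussian_moments: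
  "has_bochner_integral lborel (\<lambda>x::real. exp (- 2 * x\<^sup>2)) (sqrt (pi / 2))"
  "has_bochner_integral lborel (\<lambda>x::real. x\<^sup>2 * exp (- 2 * x\<^sup>2)) (sqrt (pi / 2) / 4)"
  "has_bochner_integral lborel (\<lambda>x::real. x ^ 4 * exp (- 2 * x\<^sup>2)) (3 * sqrt (pi / 2) / 16)"
  "has_bochner_integral lborel (\<lambda>x::real. x * exp (- 2 * x\<^sup>2)) 0"
  "has_bochner_integral lborel (\<lambda>x::real. x ^ 3 * exp (- 2 * x\<^sup>2)) 0"
proof -
  have half: "0 < (1 / 2 :: real)" by simp
  have d: "sqrt (pi / 2) * normal_density 0 (1 / 2) x = exp (- 2 * x\<^sup>2)" for x :: real
    by (simp add: normal_density_def power2_eq_square real_sqrt_divide)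
  have m: "has_bochner_integral lborel (\<lambda>x. p x * exp (- 2 * x\<^sup>2)) (sqrt (pi / 2) * v)"
    if "has_bochner_integral lborel (\<lambda>x. normal_density 0 (1 / 2) x * p x) v" for p v
  proof -
    have "(\<lambda>x. p x * exp (- 2 * x\<^sup>2)) = (\<lambda>x. sqrt (pi / 2) * (normal_density 0 (1 / 2) x * p x))"
      unfolding d[symmetric] by (simp add: mult_ac)
    then show ?thesis by (simp only:) (rule has_bochner_integral_mult_right, rule that)
  qed
  show "has_bochner_integral lborel (\<lambda>x::real. exp (- 2 * x\<^sup>2)) (sqrt (pi / 2))"
    using m[of "\<lambda>_. 1" 1] normal_moment_even[OF half, of 0 0] by simp
  show "has_bochner_integral lborel (\<lambda>x::real. x\<^sup>2 * exp (- 2 * x\<^sup>2)) (sqrt (pi / 2) / 4)"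
    using m[of "\<lambda>x. x\<^sup>2" "1/4"] normal_moment_even[OF half, of 0 1] by (simp add: power2_eq_square)
  show "has_bochner_integral lborel (\<lambda>x::real. x ^ 4 * exp (- 2 * x\<^sup>2)) (3 * sqrt (pi / 2) / 16)"
    using m[of "\<lambda>x. x ^ 4" "3/16"] normal_moment_even[OF half, of 0 2] by (simp add: power2_eq_square fact_numeral mult.commute)
  show "has_bochner_integral lborel (\<lambda>x::real. x * exp (- 2 * x\<^sup>2)) 0"
    using m[of "\<lambda>x. x" 0] normal_moment_odd[OF half, of 0 0] by simp
  show "has_bochner_integral lborel (\<lambda>x::real. x ^ 3 * exp (- 2 * x\<^sup>2)) 0"
    using m[of "\<lambda>x. x ^ 3" 0] normal_moment_odd[OF half, of 0 1] by simp
qed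

section \<open>Asymptotics of the scaling functions and wavelets\<close>

text \<open>
  The factors are chosen so that these sequences converge after rescaling by \<open>sqrt (a j)\<close>: the first one
  removes the constant \<open>exp (- a / j)\<close> from the Gaussian, the second one compensates the decay of the
  high-pass mask, whose square is about \<open>2 / (n - 1)\<close> times \<open>u\<^sup>2 + a / n\<close>.
\<close>

definition phi_profile :: "real \<Rightarrow> nat \<Rightarrow> int \<Rightarrow> real" where
  "phi_profile a j k = exp (a / real j) * xi_hat (nu a) j k"

definition psi_profile :: "real \<Rightarrow> nat \<Rightarrow> int \<Rightarrow> real" where
  "psi_profile a n k = sqrt ((real n - 1) / 2) * nu a n (k + 2 ^ (n - 1)) * phi_profile a n k"

lemma phi_profile_main:
  assumes a: "a > 0" and j: "j \<ge> 1" and k: "\<bar>k\<bar> < 2 ^ (j - 1)"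
  shows "phi_profile a j k = exp (- (of_int k / sqrt (a * real j))\<^sup>2)"
proof -
  have "a / real j + - (((of_int k)\<^sup>2 + a\<^sup>2) / (a * real j)) = - (of_int k / sqrt (a * real j))\<^sup>2"
    using a j by (simp add: power_divide field_simps power2_eq_square)
  then show ?thesis
    unfolding phi_profile_def xi_nu_main(2)[OF a j k] exp_add[symmetric] by simp
qed

lemma psi_profile_main:
  assumes a: "a > 0" and n: "n \<ge> 2" and k: "\<bar>k\<bar> < 2 ^ (n - 2)"
  defines "u \<equiv> of_int k / sqrt (a * real n)"
  shows "psi_profile a n k =
    sqrt ((real n - 1) / 2 * (1 - exp (- 2 * (u\<^sup>2 + a / real n) / (real n - 1)))) * exp (- u\<^sup>2)"
proof -
  have "(2::int) ^ (n - 2) \<le> 2 ^ (n - 1)" by (intro power_increasing) auto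
  then have k1: "\<bar>k\<bar> < 2 ^ (n - 1)" using k by linarith
  have "nu_exponent a n k = (u\<^sup>2 + a / real n) / (real n - 1)"
    using a n by (simp add: nu_exponent_def u_def power_divide field_simps power2_eq_square)
  then have e: "- 2 * nu_exponent a n k = - 2 * (u\<^sup>2 + a / real n) / (real n - 1)" by simp
  have "nu a n (k + 2 ^ (n - 1)) = sqrt (1 - exp (- 2 * nu_exponent a n k))"
    using k by (intro nu_high n) auto
  moreover have "phi_profile a n k = exp (- u\<^sup>2)"
    unfolding u_def using n by (intro phi_profile_main a k1) simp
  ultimately show ?thesis
    unfolding psi_profile_def e real_sqrt_mult by simp
qed

text \<open>
  The factor \<open>j\<^sup>2\<close> leaves room for the scale \<open>sqrt (a j) \<le> j\<close> and for the normalisation of the wavelet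
  profile, which is also at most \<open>j\<close>. It is absorbed since \<open>j\<^sup>2 \<le> 2 ^ (j + 1) \<le> 16 \<bar>k\<bar>\<close> and
  \<open>\<bar>k\<bar> \<le> 32 exp (\<bar>k\<bar> / 32)\<close>.
\<close>

lemma phi_profile_tail:
  assumes a: "0 < a" "a \<le> real j" and j: "j \<ge> 3" and k: "\<bar>k\<bar> \<ge> 2 ^ (j - 3)" and s: "s \<ge> 32"
  shows "(real j)\<^sup>2 * phi_profile a j k \<le> 512 * exp 1 * exp (- \<bar>of_int k\<bar> / s)"
proof -
  have "j = (j - 3) + 3" using j by simp
  then have "(j\<^sup>2 :: nat) \<le> 2 ^ ((j - 3) + 3 + 1)" using square_le_two_power[of j] by simp
  then have "real (j\<^sup>2) \<le> real (16 * 2 ^ (j - 3))" by (subst of_nat_le_iff) (simp add: power_add)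
  then have j2: "(real j)\<^sup>2 \<le> 16 * 2 ^ (j - 3)" by simp
  have "real_of_int (2 ^ (j - 3)) \<le> real_of_int \<bar>k\<bar>" using k by (simp only: of_int_le_iff)
  then have "2 ^ (j - 3) \<le> \<bar>real_of_int k\<bar>" by simp
  moreover have "\<bar>real_of_int k\<bar> / 32 \<le> exp (\<bar>real_of_int k\<bar> / 32)"
    using exp_ge_add_one_self[of "\<bar>real_of_int k\<bar> / 32"] by linarith
  ultimately have j2': "(real j)\<^sup>2 \<le> 512 * exp (\<bar>of_int k\<bar> / 32)" using j2 by linarith
  have "exp (a / real j) \<le> exp 1" using a j by simp
  then have "phi_profile a j k \<le> exp 1 * exp (- \<bar>of_int k\<bar> / 16)"
    unfolding phi_profile_def by (intro mult_mono xi_nu_tail a j k xi_nu_bounds) auto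
  then have "(real j)\<^sup>2 * phi_profile a j k \<le> (512 * exp (\<bar>of_int k\<bar> / 32)) * (exp 1 * exp (- \<bar>of_int k\<bar> / 16))"
    using j2' by (intro mult_mono) (auto simp: phi_profile_def xi_nu_bounds a)
  also have "\<dots> = 512 * exp 1 * exp (- \<bar>of_int k\<bar> / 32)"
  proof -
    have "exp (\<bar>real_of_int k\<bar> / 32) * exp (- \<bar>of_int k\<bar> / 16) = exp (- \<bar>of_int k\<bar> / 32)"
      unfolding exp_add[symmetric] by (rule arg_cong[of _ _ exp]) simp
    then show ?thesis by (simp add: mult_ac)
  qed
  also have "\<dots> \<le> 512 * exp 1 * exp (- \<bar>of_int k\<bar> / s)"
  proof -
    have "\<bar>real_of_int k\<bar> / s \<le> \<bar>of_int k\<bar> / 32" using s by (intro divide_left_mono) auto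
    then show ?thesis by simp
  qed
  finally show ?thesis .
qed

lemma phi_profile_nonneg: "a > 0 \<Longrightarrow> phi_profile a j k \<ge> 0"
  by (simp add: phi_profile_def xi_nu_bounds)

lemma gaussian_times_quadratic_bound: "(1 + 2 * \<bar>u\<bar> + 2 * u\<^sup>2) * exp (- u\<^sup>2) \<le> 4 * exp 1 * exp (- \<bar>u\<bar>)" for u :: real
proof -
  have q: "1 + \<bar>u\<bar> + \<bar>u\<bar>\<^sup>2 / 2 \<le> exp \<bar>u\<bar>" by (rule exp_lower_Taylor_quadratic) simp
  have "1 + 2 * \<bar>u\<bar> + 2 * u\<^sup>2 \<le> 4 * exp \<bar>u\<bar>" using q by simp
  then have "(1 + 2 * \<bar>u\<bar> + 2 * u\<^sup>2) * exp (- u\<^sup>2) \<le> 4 * exp \<bar>u\<bar> * exp (- u\<^sup>2)"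
    by (intro mult_right_mono) auto
  also have "\<dots> = 4 * exp (\<bar>u\<bar> + - u\<^sup>2)" by (simp only: exp_add mult.assoc)
  also have "\<dots> \<le> 4 * exp (1 + - \<bar>u\<bar>)"
  proof -
    have "0 \<le> (\<bar>u\<bar> - 1)\<^sup>2" by simp
    then have "\<bar>u\<bar> + - u\<^sup>2 \<le> 1 + - \<bar>u\<bar>" by (simp add: power2_diff)
    then show ?thesis by simp
  qed
  also have "\<dots> = 4 * exp 1 * exp (- \<bar>u\<bar>)" by (simp only: exp_add mult.assoc)
  finally show ?thesis .
qed

lemma filterlim_scale:
  assumes j: "filterlim j at_top sequentially" and a: "\<And>n. 1 < a n"
  shows "filterlim (\<lambda>n. sqrt (a n * real (j n))) at_top sequentially"
proof (rule filterlim_at_top_mono)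
  show "filterlim (\<lambda>n. sqrt (real (j n))) at_top sequentially"
    by (intro filterlim_compose[OF sqrt_at_top] filterlim_compose[OF filterlim_real_sequentially j])
  show "\<forall>\<^sub>F n in sequentially. sqrt (real (j n)) \<le> sqrt (a n * real (j n))"
  proof (intro always_eventually allI)
    fix n
    have "1 * real (j n) \<le> a n * real (j n)" using a[of n] by (intro mult_right_mono) auto
    then show "sqrt (real (j n)) \<le> sqrt (a n * real (j n))" by simp
  qed
qed

lemma scale_le: "0 < a \<Longrightarrow> a \<le> real j \<Longrightarrow> sqrt (a * real j) \<le> real j"
  using real_sqrt_le_mono[of "a * real j" "real j * real j"] mult_right_mono[of a "real j" "real j"] by simp

lemma window_contains_scale:
  assumes j: "filterlim j at_top sequentially" and a: "\<And>n. 1 < a n" "\<forall>\<^sub>F n in sequentially. a n \<le> real (j n)"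
  shows "\<forall>\<^sub>F n in sequentially. \<bar>x\<bar> * sqrt (a n * real (j n)) + 2 \<le> real_of_int (2 ^ (j n - 3))"
proof -
  have "\<forall>\<^sub>F m in sequentially. \<bar>x\<bar> * real m + 2 \<le> 2 ^ m / 8" by real_asymp
  then have "\<forall>\<^sub>F n in sequentially. \<bar>x\<bar> * real (j n) + 2 \<le> 2 ^ j n / 8"
    using j by (rule eventually_compose_filterlim)
  moreover have "\<forall>\<^sub>F n in sequentially. j n \<ge> 3" using j by (simp add: filterlim_at_top)
  ultimately show ?thesis using a(2)
  proof eventually_elim
    case (elim n)
    have "\<bar>x\<bar> * sqrt (a n * real (j n)) \<le> \<bar>x\<bar> * real (j n)"
      using a(1)[of n] elim by (intro mult_left_mono scale_le) auto
    moreover have "(2::real) ^ j n / 8 = 2 ^ (j n - 3)" using elim by (simp add: power_diff)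
    ultimately show ?case using elim by simp
  qed
qed

text \<open>The profile \<open>exp (- x\<^sup>2)\<close> attains the minimal uncertainty product on the real line.\<close>

lemma phi_profile_UC_LIMSEQ:
  fixes a :: "nat \<Rightarrow> real" and j :: "nat \<Rightarrow> nat"
  assumes j: "filterlim j at_top sequentially" and a: "\<And>n. 1 < a n" "\<And>n. a n \<le> real (j n)"
  shows "\<forall>\<^sub>F n in sequentially. localised (phi_profile (a n) (j n))"
    and "(\<lambda>n. seq_UC (phi_profile (a n) (j n))) \<longlonglongrightarrow> 1 / 2"
proof -
  let ?s = "\<lambda>n. sqrt (a n * real (j n))"
  let ?f = "\<lambda>x::real. exp (- x\<^sup>2)" and ?g = "\<lambda>x::real. - 2 * x * exp (- x\<^sup>2)"
  let ?B = "512 * exp 1 :: real"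
  note s = filterlim_scale[of j a, OF j a(1)]
  have s32: "\<forall>\<^sub>F n in sequentially. ?s n \<ge> 32" using s by (simp add: filterlim_at_top)
  have j3: "\<forall>\<^sub>F n in sequentially. j n \<ge> 3" using j by (simp add: filterlim_at_top)
  have K: "\<forall>\<^sub>F n in sequentially. \<bar>x\<bar> * ?s n + 2 \<le> real_of_int (2 ^ (j n - 3))" for x
    using a by (intro window_contains_scale j) auto
  have main: "\<forall>\<^sub>F n in sequentially. \<forall>k. \<bar>k\<bar> \<le> 2 ^ (j n - 3) \<longrightarrow> phi_profile (a n) (j n) k = ?f (of_int k / ?s n)"
    using j3
  proof eventually_elim
    case (elim n)
    have "(2::int) ^ (j n - 3) < 2 ^ (j n - 1)" using elim by (intro power_strict_increasing) auto
    show ?case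
    proof (intro allI impI phi_profile_main)
      show "\<bar>k\<bar> < 2 ^ (j n - 1)" if "\<bar>k\<bar> \<le> 2 ^ (j n - 3)" for k :: int
        using that \<open>(2::int) ^ (j n - 3) < 2 ^ (j n - 1)\<close> by linarith
    qed (use a(1)[of n] elim in auto)
  qed
  have tail: "\<forall>\<^sub>F n in sequentially. \<forall>k. \<bar>k\<bar> \<ge> 2 ^ (j n - 3) \<longrightarrow>
      ?s n * \<bar>phi_profile (a n) (j n) k\<bar> \<le> ?B * exp (- \<bar>of_int k\<bar> / ?s n)"
    using j3 s32
  proof eventually_elim
    case (elim n)
    have a0: "a n > 0" using a(1)[of n] by simp
    show ?case
    proof (intro allI impI)
      fix k :: int assume k: "\<bar>k\<bar> \<ge> 2 ^ (j n - 3)"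
      have "?s n \<le> real (j n)" using a0 a(2) by (rule scale_le)
      also have "\<dots> \<le> (real (j n))\<^sup>2" using elim by (simp add: self_le_power)
      finally have "?s n * \<bar>phi_profile (a n) (j n) k\<bar> \<le> (real (j n))\<^sup>2 * phi_profile (a n) (j n) k"
        using phi_profile_nonneg[OF a0, of "j n" k] by (simp add: mult_right_mono)
      also have "\<dots> \<le> ?B * exp (- \<bar>of_int k\<bar> / ?s n)"
        by (rule phi_profile_tail[OF a0 a(2) elim(1) k elim(2)])
      finally show "?s n * \<bar>phi_profile (a n) (j n) k\<bar> \<le> ?B * exp (- \<bar>of_int k\<bar> / ?s n)" .
    qed
  qed
  have bound: "\<bar>?f u\<bar> \<le> ?B * exp (- \<bar>u\<bar>) \<and> \<bar>?g u\<bar> \<le> ?B * exp (- \<bar>u\<bar>)" for u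
  proof -
    have "4 * exp 1 * exp (- \<bar>u\<bar>) \<le> ?B * exp (- \<bar>u\<bar>)" by (intro mult_right_mono) auto
    moreover have "1 * exp (- u\<^sup>2) \<le> (1 + 2 * \<bar>u\<bar> + 2 * u\<^sup>2) * exp (- u\<^sup>2)"
      "2 * \<bar>u\<bar> * exp (- u\<^sup>2) \<le> (1 + 2 * \<bar>u\<bar> + 2 * u\<^sup>2) * exp (- u\<^sup>2)"
      by (intro mult_right_mono; simp)+
    moreover note gaussian_times_quadratic_bound[of u]
    ultimately have "exp (- u\<^sup>2) \<le> ?B * exp (- \<bar>u\<bar>)" "2 * \<bar>u\<bar> * exp (- u\<^sup>2) \<le> ?B * exp (- \<bar>u\<bar>)" by linarith+
    then show ?thesis by (simp add: abs_mult)
  qed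
  have deriv: "(?f has_real_derivative ?g u) (at u)" for u
    by (auto intro!: derivative_eq_intros)
  have e: "(?f x)\<^sup>2 = exp (- 2 * x\<^sup>2)" for x by (simp add: exp_double[symmetric])
  have g2: "(?g x)\<^sup>2 = 4 * (x\<^sup>2 * exp (- 2 * x\<^sup>2))" for x
    unfolding power_mult_distrib e by simp
  have "(\<integral>x. 4 * (x\<^sup>2 * exp (- 2 * x\<^sup>2)) \<partial>lborel) = sqrt (pi / 2)"
    using gaussian_moments(2)[THEN has_bochner_integral_integral_eq] by simp
  then have G: "(\<integral>x. (?g x)\<^sup>2 \<partial>lborel) = sqrt (pi / 2)" unfolding g2 .
  have I: "(\<integral>x. (?f x)\<^sup>2 \<partial>lborel) = sqrt (pi / 2)" "(\<integral>x. x * (?f x)\<^sup>2 \<partial>lborel) = 0" "(\<integral>x. x\<^sup>2 * (?f x)\<^sup>2 \<partial>lborel) = sqrt (pi / 2) / 4"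
    unfolding e by (rule gaussian_moments[THEN has_bochner_integral_integral_eq])+
  have lim: "(\<lambda>n. ?f (u n)) \<longlonglongrightarrow> ?f x" "(\<lambda>n. ?g (u n)) \<longlonglongrightarrow> ?g x" if "u \<longlonglongrightarrow> x" for u x
    by (intro tendsto_intros that)+
  have meas: "?f \<in> borel_measurable borel" "?g \<in> borel_measurable borel" by measurable
  note R = sampled_profile_UC_LIMSEQ[where C = "\<lambda>_. ?f" and C' = "\<lambda>_. ?g" and r = "\<lambda>n. phi_profile (a n) (j n)",
      OF s K main tail always_eventually[OF allI[OF allI[OF deriv]]] always_eventually[OF allI[OF allI[OF bound]]]
        lim(1) lim(2) meas I(1,2,3) G]
  show "\<forall>\<^sub>F n in sequentially. localised (phi_profile (a n) (j n))"
    by (rule R(1)) auto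
  have "sqrt (sqrt (pi / 2) * (sqrt (pi / 2) / 4) / (sqrt (pi / 2))\<^sup>2) = sqrt (1 / 4)"
    by (simp add: power2_eq_square)
  also have "\<dots> = 1 / 2" by (simp add: real_sqrt_divide)
  finally have v: "sqrt (sqrt (pi / 2) * (sqrt (pi / 2) / 4) / (sqrt (pi / 2))\<^sup>2) = 1 / 2" .
  show "(\<lambda>n. seq_UC (phi_profile (a n) (j n))) \<longlonglongrightarrow> 1 / 2"
    unfolding v[symmetric] by (rule R(2)) auto
qed

text \<open>
  Convergence along every admissible sequence of parameters is convergence uniform in \<open>a\<close>.
\<close>

lemma phi_profile_UC_uniform:
  assumes e: "e > 0"
  obtains J where "\<And>j a. j \<ge> J \<Longrightarrow> 1 < a \<Longrightarrow> a \<le> real j \<Longrightarrow>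
    localised (phi_profile a j) \<and> \<bar>seq_UC (phi_profile a j) - 1 / 2\<bar> < e"
proof -
  let ?P = "\<lambda>a j. localised (phi_profile a j) \<and> \<bar>seq_UC (phi_profile a j) - 1 / 2\<bar> < e"
  have "\<exists>J. \<forall>j a. j \<ge> J \<and> 1 < a \<and> a \<le> real j \<longrightarrow> ?P a j"
  proof (rule ccontr)
    assume "\<not> ?thesis"
    then have "\<forall>J. \<exists>p. fst p \<ge> J \<and> 1 < snd p \<and> snd p \<le> real (fst p) \<and> \<not> ?P (snd p) (fst p)"
      by fastforce
    then obtain p where p: "\<And>J. fst (p J) \<ge> J" "\<And>J. 1 < snd (p J)" "\<And>J. snd (p J) \<le> real (fst (p J))"
      "\<And>J. \<not> ?P (snd (p J)) (fst (p J))" by metis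
    have "filterlim (\<lambda>n. fst (p n)) at_top sequentially"
      using filterlim_at_top_mono[OF filterlim_ident, of "\<lambda>n. fst (p n)"] p(1) by (simp add: always_eventually)
    note L = phi_profile_UC_LIMSEQ[of "\<lambda>n. fst (p n)" "\<lambda>n. snd (p n)", OF this p(2,3)]
    have "\<forall>\<^sub>F n in sequentially. \<bar>seq_UC (phi_profile (snd (p n)) (fst (p n))) - 1 / 2\<bar> < e"
      using tendstoD[OF L(2) e] by (simp add: dist_real_def)
    with L(1) have "\<forall>\<^sub>F n in sequentially. ?P (snd (p n)) (fst (p n))" by (rule eventually_conj)
    then show False using p(4) eventually_happens'[OF sequentially_bot] by blast
  qed
  then show ?thesis using that by blast
qed

text \<open>
  With \<open>m = n - 1\<close> and \<open>z = u\<^sup>2 + a / n\<close>, this function is the square of the rescaled high-pass mask.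
  It approaches \<open>z\<close> as \<open>m\<close> grows, and so the wavelet approaches \<open>\<bar>u\<bar> exp (- u\<^sup>2)\<close>.
\<close>

definition mask_square :: "real \<Rightarrow> real \<Rightarrow> real" where
  "mask_square m z = m / 2 * (1 - exp (- 2 * z / m))"

lemma mask_square_bounds:
  assumes "m > 0"
  shows "mask_square m z \<le> z" "z * exp (- 2 * z / m) \<le> mask_square m z"
proof -
  have "1 - exp (- 2 * z / m) \<le> 2 * z / m" using exp_ge_add_one_self[of "- 2 * z / m"] by simp
  then have "m / 2 * (1 - exp (- 2 * z / m)) \<le> m / 2 * (2 * z / m)"
    using assms by (intro mult_left_mono) auto
  then show "mask_square m z \<le> z" using assms by (simp add: mask_square_def)
  have "exp (- 2 * z / m) * (1 + 2 * z / m) \<le> exp (- 2 * z / m) * exp (2 * z / m)"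
    by (intro mult_left_mono exp_ge_add_one_self) auto
  then have "exp (- 2 * z / m) * (2 * z / m) \<le> 1 - exp (- 2 * z / m)"
    by (simp add: exp_add[symmetric] distrib_left)
  then have "m / 2 * (exp (- 2 * z / m) * (2 * z / m)) \<le> m / 2 * (1 - exp (- 2 * z / m))"
    using assms by (intro mult_left_mono) auto
  then show "z * exp (- 2 * z / m) \<le> mask_square m z" using assms by (simp add: mask_square_def mult_ac)
qed

lemma mask_square_pos: "m > 0 \<Longrightarrow> z > 0 \<Longrightarrow> mask_square m z > 0"
  by (simp add: mask_square_def)

lemma mask_square_LIMSEQ:
  assumes m: "filterlim m at_top sequentially" and z: "z \<longlonglongrightarrow> l"
  shows "(\<lambda>n. exp (- 2 * z n / m n)) \<longlonglongrightarrow> 1" "(\<lambda>n. mask_square (m n) (z n)) \<longlonglongrightarrow> l"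
proof -
  have "(\<lambda>n. exp (- 2 * z n / m n)) \<longlonglongrightarrow> exp 0"
    by (rule tendsto_exp[OF real_tendsto_divide_at_top[OF tendsto_mult[OF tendsto_const z] m]])
  then show E: "(\<lambda>n. exp (- 2 * z n / m n)) \<longlonglongrightarrow> 1" by simp
  have mp: "\<forall>\<^sub>F n in sequentially. m n > 0"
    using filterlim_at_top_dense[THEN iffD1, OF m] by blast
  show "(\<lambda>n. mask_square (m n) (z n)) \<longlonglongrightarrow> l"
  proof (rule tendsto_sandwich)
    show "\<forall>\<^sub>F n in sequentially. z n * exp (- 2 * z n / m n) \<le> mask_square (m n) (z n)"
      "\<forall>\<^sub>F n in sequentially. mask_square (m n) (z n) \<le> z n"
      using mask_square_bounds by (auto intro: eventually_mono[OF mp])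
    show "(\<lambda>n. z n * exp (- 2 * z n / m n)) \<longlonglongrightarrow> l" using tendsto_mult[OF z E] by simp
  qed (rule z)
qed

lemma psi_profile_tail:
  assumes a: "0 < a" "a \<le> real n" and n: "n \<ge> 3" and k: "\<bar>k\<bar> \<ge> 2 ^ (n - 3)" and s: "sqrt (a * real n) \<ge> 32"
  shows "sqrt (a * real n) * \<bar>psi_profile a n k\<bar> \<le> 512 * exp 1 * exp (- \<bar>of_int k\<bar> / sqrt (a * real n))"
proof -
  let ?s = "sqrt (a * real n)" and ?q = "sqrt ((real n - 1) / 2)" and ?v = "nu a n (k + 2 ^ (n - 1))"
  have v: "0 \<le> ?v" "?v \<le> 1" using nu_pos[OF a(1), of n "k + 2 ^ (n - 1)"] nu_le_1[OF a(1)] by auto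
  have q0: "?q \<ge> 0" using n by simp
  have "(real n - 1) / 2 \<le> (real n)\<^sup>2"
  proof -
    have "(x - 1) / 2 \<le> x\<^sup>2" if "x \<ge> 1" for x :: real
      using self_le_power[of x 2] that by simp
    then show ?thesis using n by simp
  qed
  then have q: "?q \<le> real n" by (intro real_le_lsqrt) auto
  have p: "phi_profile a n k \<ge> 0" by (rule phi_profile_nonneg[OF a(1)])
  have "?s * \<bar>psi_profile a n k\<bar> = ?s * (?q * ?v * phi_profile a n k)"
    unfolding psi_profile_def using q0 v(1) p by (simp add: abs_mult)
  also have "\<dots> \<le> real n * (real n * 1 * phi_profile a n k)"
  proof (rule mult_mono)
    show "?s \<le> real n" using a by (rule scale_le)
    show "?q * ?v * phi_profile a n k \<le> real n * 1 * phi_profile a n k"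
      using p v q by (intro mult_right_mono mult_mono) simp_all
    show "0 \<le> ?q * ?v * phi_profile a n k" using q0 v(1) p by simp
  qed simp
  also have "\<dots> = (real n)\<^sup>2 * phi_profile a n k" by (simp add: power2_eq_square)
  also have "\<dots> \<le> 512 * exp 1 * exp (- \<bar>of_int k\<bar> / ?s)"
    by (rule phi_profile_tail[OF a n k s])
  finally show ?thesis .
qed

definition wavelet_profile :: "real \<Rightarrow> nat \<Rightarrow> real \<Rightarrow> real" where
  "wavelet_profile a n u = sqrt (mask_square (real n - 1) (u\<^sup>2 + a / real n)) * exp (- u\<^sup>2)"

definition wavelet_profile_deriv :: "real \<Rightarrow> nat \<Rightarrow> real \<Rightarrow> real" where
  "wavelet_profile_deriv a n u =
     (let z = u\<^sup>2 + a / real n; w = sqrt (mask_square (real n - 1) z)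
      in (exp (- 2 * z / (real n - 1)) * u / w - 2 * u * w) * exp (- u\<^sup>2))"

lemma wavelet_profile_deriv:
  assumes a: "a > 0" and n: "n \<ge> 2"
  shows "(wavelet_profile a n has_real_derivative wavelet_profile_deriv a n u) (at u)"
proof -
  define m where "m = real n - 1"
  define c where "c = a / real n"
  have m: "m > 0" using n by (simp add: m_def)
  have c: "c > 0" using a n by (simp add: c_def)
  have z: "u\<^sup>2 + c > 0" using c by (intro add_nonneg_pos) auto
  let ?W = "\<lambda>u. mask_square m (u\<^sup>2 + c)"
  have W: "?W u > 0" by (rule mask_square_pos[OF m z])
  have z': "((\<lambda>u. u\<^sup>2 + c) has_real_derivative 2 * u) (at u)"
    by (auto intro!: derivative_eq_intros)
  have "((\<lambda>y. - 2 * y / m) has_real_derivative - 2 / m) (at z)" for z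
    using DERIV_cdivide[OF DERIV_cmult[OF DERIV_ident, of "- 2"], of m] by simp
  then have e: "((\<lambda>y. exp (- 2 * y / m)) has_real_derivative exp (- 2 * z / m) * (- 2 / m)) (at z)" for z
    by (rule DERIV_chain2[OF DERIV_exp])
  have "((\<lambda>y. m / 2 * (1 - exp (- 2 * y / m))) has_real_derivative m / 2 * (0 - exp (- 2 * z / m) * (- 2 / m))) (at z)" for z
    by (rule DERIV_cmult[OF DERIV_diff[OF DERIV_const e]])
  then have M: "(mask_square m has_real_derivative exp (- 2 * z / m)) (at z)" for z
    unfolding mask_square_def [abs_def] using m by simp
  have W': "(?W has_real_derivative exp (- 2 * (u\<^sup>2 + c) / m) * (2 * u)) (at u)"
    by (rule DERIV_chain2[where f = "mask_square m", OF M z'])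
  have "((\<lambda>u. sqrt (?W u)) has_real_derivative inverse (sqrt (?W u)) / 2 * (exp (- 2 * (u\<^sup>2 + c) / m) * (2 * u))) (at u)"
    by (rule DERIV_chain2[where f = sqrt, OF DERIV_real_sqrt[OF W] W'])
  then have D: "((\<lambda>u. sqrt (?W u)) has_real_derivative exp (- 2 * (u\<^sup>2 + c) / m) * u / sqrt (?W u)) (at u)"
  proof (rule DERIV_cong)
    show "inverse w / 2 * (p * (2 * u)) = p * u / w" for p w :: real
      by (cases "w = 0") (simp_all add: field_simps)
  qed
  have E: "((\<lambda>u. exp (- u\<^sup>2)) has_real_derivative - 2 * u * exp (- u\<^sup>2)) (at u)"
    by (auto intro!: derivative_eq_intros)
  have "((\<lambda>u. sqrt (?W u) * exp (- u\<^sup>2)) has_real_derivative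
      (exp (- 2 * (u\<^sup>2 + c) / m) * u / sqrt (?W u) - 2 * u * sqrt (?W u)) * exp (- u\<^sup>2)) (at u)"
  proof (rule DERIV_cong[OF DERIV_mult[OF D E]])
    show "p * x + - 2 * u * x * w = (p - 2 * u * w) * x" for p x w :: real by (simp add: algebra_simps)
  qed
  then show ?thesis
    unfolding wavelet_profile_def [abs_def] wavelet_profile_deriv_def Let_def m_def c_def .
qed

text \<open>
  The derivative of the square root stays bounded near \<open>u = 0\<close>, although the limit \<open>\<bar>u\<bar>\<close> has a kink
  there: \<open>\<bar>u\<bar> E \<le> w\<close> because \<open>mask_square m z \<ge> z E\<close>.
\<close>

lemma wavelet_profile_bounds:
  assumes a: "0 < a" "a \<le> real n" and n: "n \<ge> 2"
  shows "\<bar>wavelet_profile a n u\<bar> \<le> 4 * exp 1 * exp (- \<bar>u\<bar>)"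
    "\<bar>wavelet_profile_deriv a n u\<bar> \<le> 4 * exp 1 * exp (- \<bar>u\<bar>)"
proof -
  define m where "m = real n - 1"
  define z where "z = u\<^sup>2 + a / real n"
  define w where "w = sqrt (mask_square m z)"
  define E where "E = exp (- 2 * z / m)"
  have m: "m > 0" using n by (simp add: m_def)
  have "a / real n > 0" "a / real n \<le> 1" using a n by auto
  then have z: "z > 0" "u\<^sup>2 \<le> z" "z \<le> 1 + u\<^sup>2"
    using zero_le_power2[of u] unfolding z_def by linarith+
  have w0: "w > 0" unfolding w_def using mask_square_pos[OF m z(1)] by simp
  have "mask_square m z \<le> (1 + \<bar>u\<bar>)\<^sup>2"
  proof -
    have "mask_square m z \<le> z" by (rule mask_square_bounds(1)[OF m])
    also have "\<dots> \<le> 1 + u\<^sup>2 + 2 * \<bar>u\<bar>" using z by simp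
    also have "\<dots> = (1 + \<bar>u\<bar>)\<^sup>2" by (simp add: power2_sum)
    finally show ?thesis .
  qed
  then have w1: "w \<le> 1 + \<bar>u\<bar>" unfolding w_def by (intro real_le_lsqrt) auto
  have E: "0 < E" "E \<le> 1" using z m by (auto simp: E_def)
  have "(\<bar>u\<bar> * E)\<^sup>2 \<le> mask_square m z"
  proof -
    have "(\<bar>u\<bar> * E)\<^sup>2 = u\<^sup>2 * (E * E)" by (simp add: power_mult_distrib power2_eq_square[of E])
    also have "\<dots> \<le> z * (1 * E)"
      by (rule mult_mono) (use z E in \<open>simp_all add: mult_left_le_one_le\<close>)
    also have "\<dots> \<le> mask_square m z" using mask_square_bounds(2)[OF m, of z] by (simp add: E_def)
    finally show ?thesis .
  qed
  then have "\<bar>u\<bar> * E \<le> w" unfolding w_def by (rule real_le_rsqrt)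
  then have "\<bar>E * u\<bar> \<le> w" using E by (simp add: abs_mult mult.commute[of E])
  then have q: "\<bar>E * u / w\<bar> \<le> 1" using w0 by (simp add: abs_divide)
  have "\<bar>wavelet_profile a n u\<bar> = w * exp (- u\<^sup>2)"
    using w0 by (simp add: wavelet_profile_def w_def m_def z_def abs_mult)
  also have "\<dots> \<le> (1 + 2 * \<bar>u\<bar> + 2 * u\<^sup>2) * exp (- u\<^sup>2)"
  proof (rule mult_right_mono)
    show "w \<le> 1 + 2 * \<bar>u\<bar> + 2 * u\<^sup>2" using w1 zero_le_power2[of u] abs_ge_zero[of u] by linarith
  qed simp
  also have "\<dots> \<le> 4 * exp 1 * exp (- \<bar>u\<bar>)" by (rule gaussian_times_quadratic_bound)
  finally show "\<bar>wavelet_profile a n u\<bar> \<le> 4 * exp 1 * exp (- \<bar>u\<bar>)" .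
  have "\<bar>wavelet_profile_deriv a n u\<bar> = \<bar>E * u / w - 2 * u * w\<bar> * exp (- u\<^sup>2)"
    unfolding wavelet_profile_deriv_def Let_def m_def[symmetric] z_def[symmetric] E_def[symmetric] w_def[symmetric] abs_mult
    by simp
  also have "\<dots> \<le> (1 + 2 * \<bar>u\<bar> + 2 * u\<^sup>2) * exp (- u\<^sup>2)"
  proof (rule mult_right_mono)
    have "\<bar>2 * u * w\<bar> = 2 * \<bar>u\<bar> * w" using w0 by (simp add: abs_mult)
    also have "\<dots> \<le> 2 * \<bar>u\<bar> * (1 + \<bar>u\<bar>)" using w1 by (intro mult_left_mono) auto
    also have "\<dots> = 2 * \<bar>u\<bar> + 2 * u\<^sup>2" by (simp add: distrib_left power2_eq_square abs_mult_self_eq)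
    finally show "\<bar>E * u / w - 2 * u * w\<bar> \<le> 1 + 2 * \<bar>u\<bar> + 2 * u\<^sup>2" using q by linarith
  qed simp
  also have "\<dots> \<le> 4 * exp 1 * exp (- \<bar>u\<bar>)" by (rule gaussian_times_quadratic_bound)
  finally show "\<bar>wavelet_profile_deriv a n u\<bar> \<le> 4 * exp 1 * exp (- \<bar>u\<bar>)" .
qed

text \<open>
  The limiting profile \<open>\<bar>x\<bar> exp (- x\<^sup>2)\<close> has the same moments and the same squared derivative as the
  first Hermite function \<open>x exp (- x\<^sup>2)\<close>, whose uncertainty product is three times the minimal one.
\<close>

lemma psi_profile_UC_LIMSEQ:
  assumes a: "a > 1"
  shows "\<forall>\<^sub>F n in sequentially. localised (psi_profile a n)"
    and "(\<lambda>n. seq_UC (psi_profile a n)) \<longlonglongrightarrow> 3 / 2"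
proof -
  let ?s = "\<lambda>n. sqrt (a * real n)"
  let ?f = "\<lambda>x::real. \<bar>x\<bar> * exp (- x\<^sup>2)"
  let ?g = "\<lambda>x::real. (if x < 0 then - 1 else 1) * (1 - 2 * x\<^sup>2) * exp (- x\<^sup>2)"
  let ?B = "512 * exp 1 :: real"
  have id: "filterlim (\<lambda>n::nat. n) at_top sequentially" by (rule filterlim_ident)
  have s: "filterlim ?s at_top sequentially"
    by (rule filterlim_scale[OF id]) (rule a)
  have s32: "\<forall>\<^sub>F n in sequentially. ?s n \<ge> 32" using s by (simp add: filterlim_at_top)
  have an: "\<forall>\<^sub>F n in sequentially. a \<le> real n"
    using filterlim_real_sequentially by (simp add: filterlim_at_top)
  have n3: "\<forall>\<^sub>F n::nat in sequentially. n \<ge> 3" by (rule eventually_ge_at_top)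
  have K: "\<forall>\<^sub>F n in sequentially. \<bar>x\<bar> * ?s n + 2 \<le> real_of_int (2 ^ (n - 3))" for x
    using a an by (intro window_contains_scale id) auto
  have main: "\<forall>\<^sub>F n in sequentially. \<forall>k. \<bar>k\<bar> \<le> 2 ^ (n - 3) \<longrightarrow> psi_profile a n k = wavelet_profile a n (of_int k / ?s n)"
    using n3
  proof eventually_elim
    case (elim n)
    have P: "(2::int) ^ (n - 3) < 2 ^ (n - 2)" using elim by (intro power_strict_increasing) auto
    show ?case
    proof (intro allI impI)
      fix k :: int assume "\<bar>k\<bar> \<le> 2 ^ (n - 3)"
      then have k: "\<bar>k\<bar> < 2 ^ (n - 2)" using P by linarith
      show "psi_profile a n k = wavelet_profile a n (of_int k / ?s n)"
        unfolding wavelet_profile_def mask_square_def using a elim by (intro psi_profile_main k) auto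
    qed
  qed
  have tail: "\<forall>\<^sub>F n in sequentially. \<forall>k. \<bar>k\<bar> \<ge> 2 ^ (n - 3) \<longrightarrow>
      ?s n * \<bar>psi_profile a n k\<bar> \<le> ?B * exp (- \<bar>of_int k\<bar> / ?s n)"
    using n3 s32 an
  proof eventually_elim
    case (elim n)
    show ?case
      by (intro allI impI psi_profile_tail) (use a elim in simp_all)
  qed
  have deriv: "\<forall>\<^sub>F n in sequentially. \<forall>u. (wavelet_profile a n has_real_derivative wavelet_profile_deriv a n u) (at u)"
    using n3 by eventually_elim (use a in \<open>auto intro!: wavelet_profile_deriv\<close>)
  have bound: "\<forall>\<^sub>F n in sequentially. \<forall>u. \<bar>wavelet_profile a n u\<bar> \<le> ?B * exp (- \<bar>u\<bar>) \<and>
      \<bar>wavelet_profile_deriv a n u\<bar> \<le> ?B * exp (- \<bar>u\<bar>)"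
    using n3 an
  proof eventually_elim
    case (elim n)
    show ?case
    proof (intro allI)
      fix u :: real
      have "4 * exp 1 * exp (- \<bar>u\<bar>) \<le> ?B * exp (- \<bar>u\<bar>)" by (intro mult_right_mono) auto
      moreover have "0 < a" "a \<le> real n" "2 \<le> n" using a elim by auto
      note wavelet_profile_bounds[OF this, of u]
      ultimately show "\<bar>wavelet_profile a n u\<bar> \<le> ?B * exp (- \<bar>u\<bar>) \<and> \<bar>wavelet_profile_deriv a n u\<bar> \<le> ?B * exp (- \<bar>u\<bar>)"
        by linarith
    qed
  qed
  have m_lim: "filterlim (\<lambda>n. real n - 1) at_top sequentially" by real_asymp
  have lim: "(\<lambda>n. exp (- 2 * ((u n)\<^sup>2 + a / real n) / (real n - 1))) \<longlonglongrightarrow> 1"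
    "(\<lambda>n. sqrt (mask_square (real n - 1) ((u n)\<^sup>2 + a / real n))) \<longlonglongrightarrow> \<bar>x\<bar>" if u: "u \<longlonglongrightarrow> x" for u x
  proof -
    have "(\<lambda>n. a / real n) \<longlonglongrightarrow> 0" by real_asymp
    then have z: "(\<lambda>n. (u n)\<^sup>2 + a / real n) \<longlonglongrightarrow> x\<^sup>2"
      using tendsto_add[OF tendsto_power[OF u, of 2]] by fastforce
    show "(\<lambda>n. exp (- 2 * ((u n)\<^sup>2 + a / real n) / (real n - 1))) \<longlonglongrightarrow> 1"
      by (rule mask_square_LIMSEQ(1)[OF m_lim z])
    show "(\<lambda>n. sqrt (mask_square (real n - 1) ((u n)\<^sup>2 + a / real n))) \<longlonglongrightarrow> \<bar>x\<bar>"
      using tendsto_real_sqrt[OF mask_square_LIMSEQ(2)[OF m_lim z]] by simp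
  qed
  have Cl: "(\<lambda>n. wavelet_profile a n (u n)) \<longlonglongrightarrow> ?f x" if "x \<noteq> 0" "u \<longlonglongrightarrow> x" for u x
    unfolding wavelet_profile_def by (intro tendsto_intros lim(2)[OF that(2)] that(2))
  have C'l: "(\<lambda>n. wavelet_profile_deriv a n (u n)) \<longlonglongrightarrow> ?g x" if x: "x \<noteq> 0" and u: "u \<longlonglongrightarrow> x" for u x
  proof -
    have "(\<lambda>n. wavelet_profile_deriv a n (u n)) \<longlonglongrightarrow> (1 * x / \<bar>x\<bar> - 2 * x * \<bar>x\<bar>) * exp (- x\<^sup>2)"
      unfolding wavelet_profile_deriv_def Let_def using x by (intro tendsto_intros lim(1)[OF u] lim(2)[OF u] u) auto
    moreover have "1 * x / \<bar>x\<bar> - 2 * x * \<bar>x\<bar> = (if x < 0 then - 1 else 1) * (1 - 2 * x\<^sup>2)"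
      using x by (auto simp: power2_eq_square)
    ultimately show ?thesis by simp
  qed
  have meas: "?f \<in> borel_measurable borel" "?g \<in> borel_measurable borel" by measurable
  have e: "(exp (- x\<^sup>2))\<^sup>2 = exp (- 2 * x\<^sup>2)" for x :: real by (simp add: exp_double[symmetric])
  have f2: "(?f x)\<^sup>2 = x\<^sup>2 * exp (- 2 * x\<^sup>2)" for x
    unfolding power_mult_distrib e by simp
  have g2: "(?g x)\<^sup>2 = exp (- 2 * x\<^sup>2) - 4 * (x\<^sup>2 * exp (- 2 * x\<^sup>2)) + 4 * (x ^ 4 * exp (- 2 * x\<^sup>2))" for x
  proof -
    have "(?g x)\<^sup>2 = (1 - 2 * x\<^sup>2)\<^sup>2 * exp (- 2 * x\<^sup>2)"
      unfolding power_mult_distrib e by simp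
    also have "(1 - 2 * x\<^sup>2)\<^sup>2 = 1 - 4 * x\<^sup>2 + 4 * x ^ 4"
      by (simp add: power2_eq_square algebra_simps power4_eq_xxxx)
    finally show ?thesis by (simp add: algebra_simps)
  qed
  note gm = gaussian_moments[THEN integrable.intros] and gi = gaussian_moments[THEN has_bochner_integral_integral_eq]
  have G: "(\<integral>x. (?g x)\<^sup>2 \<partial>lborel) = 3 * sqrt (pi / 2) / 4"
    unfolding g2 using gm gi by simp
  have I0: "(\<integral>x. (?f x)\<^sup>2 \<partial>lborel) = sqrt (pi / 2) / 4"
    unfolding f2 by (rule gi(2))
  have "x * (?f x)\<^sup>2 = x ^ 3 * exp (- 2 * x\<^sup>2)" for x
    unfolding f2 by (simp add: power2_eq_square power3_eq_cube)
  then have I1: "(\<integral>x. x * (?f x)\<^sup>2 \<partial>lborel) = 0" using gi(5) by simp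
  have "x\<^sup>2 * (?f x)\<^sup>2 = x ^ 4 * exp (- 2 * x\<^sup>2)" for x
    unfolding f2 by (simp add: power2_eq_square power4_eq_xxxx)
  then have I2: "(\<integral>x. x\<^sup>2 * (?f x)\<^sup>2 \<partial>lborel) = 3 * sqrt (pi / 2) / 16" using gi(3) by simp
  note R = sampled_profile_UC_LIMSEQ[where C = "wavelet_profile a" and C' = "wavelet_profile_deriv a" and r = "psi_profile a",
      OF s K main tail deriv bound Cl C'l meas I0 I1 I2 G]
  show "\<forall>\<^sub>F n in sequentially. localised (psi_profile a n)"
    by (rule R(1)) auto
  have "sqrt (3 * sqrt (pi / 2) / 4 * (3 * sqrt (pi / 2) / 16) / (sqrt (pi / 2) / 4)\<^sup>2) = sqrt (9 / 4)"
    by (simp add: power2_eq_square)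
  also have "\<dots> = 3 / 2" by (simp add: real_sqrt_divide)
  finally have v: "sqrt (3 * sqrt (pi / 2) / 4 * (3 * sqrt (pi / 2) / 16) / (sqrt (pi / 2) / 4)\<^sup>2) = 3 / 2" .
  show "(\<lambda>n. seq_UC (psi_profile a n)) \<longlonglongrightarrow> 3 / 2"
    unfolding v[symmetric] by (rule R(2)) auto
qed

lemma UC_scaling_function:
  assumes "qmf_masks \<nu>" and xi: "\<And>k. xi_hat \<nu> j k = c * r k" and c: "c \<noteq> 0" and r: "localised r"
  shows "UC (trig_series (\<lambda>k. of_real (phi_hat \<nu> j k))) = ereal (seq_UC r)"
proof (rule UC_modulated[OF _ _ r])
  interpret qmf_masks \<nu> by fact
  show "fourier_coeff (trig_series (\<lambda>k. of_real (phi_hat \<nu> j k))) k = of_real (2 powr (- real j / 2) * c) * char_exp k 0 * of_real (r k)" for k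
    unfolding fourier_coeff_trig_series[OF phi_hat_summable] by (simp add: phi_hat_def xi char_exp_def)
qed (use c in simp)

lemma UC_wavelet_function:
  assumes "qmf_masks \<nu>" and xi: "\<And>k. \<nu> (j + 1) (k + 2 ^ j) * xi_hat \<nu> (j + 1) k = c * r k"
    and c: "c \<noteq> 0" and r: "localised r"
  shows "UC (trig_series (psi_hat \<nu> j)) = ereal (seq_UC r)"
proof (rule UC_modulated[OF _ _ r])
  interpret qmf_masks \<nu> by fact
  let ?p = "2 powr (- real (j + 1) / 2)"
  show "fourier_coeff (trig_series (psi_hat \<nu> j)) k = of_real (sqrt 2 * ?p * c) * char_exp k (1 / 2 ^ (j + 1)) * of_real (r k)" for k
  proof -
    have "psi_hat \<nu> j k = char_exp k (1 / 2 ^ (j + 1)) * of_real (sqrt 2 * ?p * (\<nu> (j + 1) (k + 2 ^ j) * xi_hat \<nu> (j + 1) k))"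
      by (simp add: psi_hat_def wavelet_mask_def scaling_mask_def phi_hat_def char_exp_def mult_ac)
    then show ?thesis
      unfolding fourier_coeff_trig_series[OF psi_hat_summable] xi by (simp add: mult_ac)
  qed
qed (use c in simp)

lemma ereal_SUP_tendsto:
  fixes U :: "'a \<Rightarrow> 'i \<Rightarrow> ereal" and c :: real
  assumes close: "\<And>e. e > 0 \<Longrightarrow> \<forall>\<^sub>F n in F. \<forall>i\<in>I. \<exists>x. U n i = ereal x \<and> \<bar>x - c\<bar> < e" and I: "I \<noteq> {}"
  shows "((\<lambda>n. SUP i\<in>I. U n i) \<longlongrightarrow> ereal c) F"
proof (rule order_tendstoI)
  fix y assume "y < ereal c"
  then obtain b where b: "y < ereal b" "ereal b < ereal c" using ereal_dense2 by blast
  then have "c - b > 0" by simp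
  from close[OF this] show "\<forall>\<^sub>F n in F. y < (SUP i\<in>I. U n i)"
  proof eventually_elim
    case (elim n)
    from I obtain i where i: "i \<in> I" by blast
    with elim obtain x where x: "U n i = ereal x" "\<bar>x - c\<bar> < c - b" by blast
    then have "ereal b < U n i" by simp
    also have "\<dots> \<le> (SUP i\<in>I. U n i)" using i by (rule SUP_upper)
    finally show ?case using b(1) by (rule less_trans[rotated])
  qed
next
  fix y assume "y > ereal c"
  then obtain b where b: "ereal c < ereal b" "ereal b < y" using ereal_dense2 by blast
  then have "b - c > 0" by simp
  from close[OF this] show "\<forall>\<^sub>F n in F. (SUP i\<in>I. U n i) < y"
  proof eventually_elim
    case (elim n)
    have "(SUP i\<in>I. U n i) \<le> ereal b"
    proof (rule SUP_least)
      fix i assume "i \<in> I"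
      with elim obtain x where "U n i = ereal x" "\<bar>x - c\<bar> < b - c" by blast
      then show "U n i \<le> ereal b" by simp
    qed
    then show ?case using b(2) by (rule le_less_trans)
  qed
qed

lemma xi_hat_phi_profile: "xi_hat (nu a) j k = exp (- (a / real j)) * phi_profile a j k"
  by (simp add: phi_profile_def exp_add[symmetric] flip: mult.assoc)

lemma wavelet_UC_LIMSEQ:
  assumes a: "a > 1" and \<nu>: "qmf_masks \<nu>" and eq: "\<And>j. j > J \<Longrightarrow> \<nu> j = nu a j" "\<And>j. j \<ge> J \<Longrightarrow> xi_hat \<nu> j = xi_hat (nu a) j"
  shows "(\<lambda>j. UC (trig_series (psi_hat \<nu> j))) \<longlonglongrightarrow> ereal (3 / 2)"
proof (rule Lim_transform_eventually)
  note L = psi_profile_UC_LIMSEQ[OF a]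
  show "(\<lambda>j. ereal (seq_UC (psi_profile a (Suc j)))) \<longlonglongrightarrow> ereal (3 / 2)"
    by (intro tendsto_ereal LIMSEQ_Suc L(2))
  have "\<forall>\<^sub>F j in sequentially. localised (psi_profile a (Suc j))"
    using L(1) eventually_sequentially_Suc[of "\<lambda>n. localised (psi_profile a n)"] by simp
  then show "\<forall>\<^sub>F j in sequentially. ereal (seq_UC (psi_profile a (Suc j))) = UC (trig_series (psi_hat \<nu> j))"
    using eventually_ge_at_top[of "max 1 J"]
  proof eventually_elim
    case (elim j)
    let ?q = "sqrt (real j / 2) * exp (a / real (Suc j))"
    have q: "?q \<noteq> 0" using elim by simp
    show ?case
    proof (rule UC_wavelet_function[OF \<nu> _ _ elim(1), where c = "1 / ?q", symmetric])
      fix k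
      have "psi_profile a (Suc j) k = ?q * (nu a (Suc j) (k + 2 ^ j) * xi_hat (nu a) (Suc j) k)"
        by (simp add: psi_profile_def phi_profile_def)
      then show "\<nu> (j + 1) (k + 2 ^ j) * xi_hat \<nu> (j + 1) k = 1 / ?q * psi_profile a (Suc j) k"
        using q elim(2) by (simp add: eq)
    qed (use q in simp)
  qed
qed

section \<open>The two families\<close>

text \<open>
  For \<open>a\<close> large compared with \<open>4 ^ j\<close> the Gaussian of width \<open>sqrt (a j)\<close> does not fit into the window
  of length \<open>2 ^ j\<close>. Making all levels up to \<open>a\<close> flat removes this range: only pairs with
  \<open>a \<le> j\<close> remain to be estimated.
\<close>

definition tame_masks :: "real \<Rightarrow> nat \<Rightarrow> int \<Rightarrow> real" where
  "tame_masks a = flat_masks (nat \<lceil>a\<rceil>) (nu a)"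

abbreviation scaling_fn :: "(nat \<Rightarrow> int \<Rightarrow> real) \<Rightarrow> nat \<Rightarrow> real \<Rightarrow> complex" where
  "scaling_fn \<nu> j \<equiv> trig_series (\<lambda>k. of_real (phi_hat \<nu> j k))"

abbreviation wavelet_fn :: "(nat \<Rightarrow> int \<Rightarrow> real) \<Rightarrow> nat \<Rightarrow> real \<Rightarrow> complex" where
  "wavelet_fn \<nu> j \<equiv> trig_series (psi_hat \<nu> j)"

lemma qmf_masks_tame: "a > 0 \<Longrightarrow> qmf_masks (tame_masks a)"
  unfolding tame_masks_def by (rule qmf_masks_flat[OF qmf_masks_nu])

lemma UC_scaling_nu:
  assumes "a > 0" "localised (phi_profile a j)"
  shows "UC (scaling_fn (nu a) j) = ereal (seq_UC (phi_profile a j))"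
  by (rule UC_scaling_function[OF qmf_masks_nu[OF assms(1)] xi_hat_phi_profile _ assms(2)]) simp

lemma UC_scaling_tame:
  assumes a: "a > 0" and loc: "localised (phi_profile a (max j (nat \<lceil>a\<rceil>)))"
  shows "UC (scaling_fn (tame_masks a) j) = ereal (seq_UC (phi_profile a (max j (nat \<lceil>a\<rceil>))))"
proof (rule UC_scaling_function[OF qmf_masks_tame[OF a] _ _ loc])
  let ?J = "nat \<lceil>a\<rceil>"
  show "xi_hat (tame_masks a) j k = (sqrt (1 / 2) ^ (?J - j) * exp (- (a / real (max j ?J)))) * phi_profile a (max j ?J) k" for k
    unfolding tame_masks_def xi_hat_flat_masks[OF qmf_masks_nu[OF a]]
    by (subst xi_hat_phi_profile) (simp only: mult.assoc)
qed simp

text \<open>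
  On a flat level the high-pass mask is constant up to its phase, which amounts to a translation. The
  wavelet is therefore a translate of a multiple of the scaling function at level \<open>\<lceil>a\<rceil>\<close>.
\<close>

lemma UC_wavelet_tame:
  assumes a: "a > 0" and j: "j + 1 \<le> nat \<lceil>a\<rceil>" and loc: "localised (phi_profile a (nat \<lceil>a\<rceil>))"
  shows "UC (wavelet_fn (tame_masks a) j) = ereal (seq_UC (phi_profile a (nat \<lceil>a\<rceil>)))"
proof (rule UC_wavelet_function[OF qmf_masks_tame[OF a] _ _ loc])
  let ?J = "nat \<lceil>a\<rceil>"
  have J: "max (j + 1) ?J = ?J" using j by (rule max_absorb2)
  have "tame_masks a (j + 1) (k + 2 ^ j) = sqrt (1 / 2)" for k
    using j by (simp add: tame_masks_def flat_masks_def)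
  moreover have "xi_hat (tame_masks a) (j + 1) k = sqrt (1 / 2) ^ (?J - (j + 1)) * (exp (- (a / real ?J)) * phi_profile a ?J k)" for k
    unfolding tame_masks_def xi_hat_flat_masks[OF qmf_masks_nu[OF a]] J
    by (subst xi_hat_phi_profile) (rule refl)
  ultimately show "tame_masks a (j + 1) (k + 2 ^ j) * xi_hat (tame_masks a) (j + 1) k =
      (sqrt (1 / 2) * sqrt (1 / 2) ^ (?J - (j + 1)) * exp (- (a / real ?J))) * phi_profile a ?J k" for k
    by (simp only: mult.assoc)
qed simp

abbreviation UC_near_half :: "real \<Rightarrow> (real \<Rightarrow> complex) \<Rightarrow> bool" where
  "UC_near_half e f \<equiv> \<exists>x. UC f = ereal x \<and> \<bar>x - 1 / 2\<bar> < e"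

lemma le_of_nat_ceiling: "a \<le> real (nat \<lceil>a\<rceil>)"
  by linarith

lemma UC_uniformly_close:
  assumes e: "e > 0"
  obtains J where "\<And>j a. 1 < a \<Longrightarrow> J \<le> max j (nat \<lceil>a\<rceil>) \<Longrightarrow>
    UC_near_half e (scaling_fn (tame_masks a) j)"
    "\<And>j a. 1 < a \<Longrightarrow> J \<le> nat \<lceil>a\<rceil> \<Longrightarrow> j + 1 \<le> nat \<lceil>a\<rceil> \<Longrightarrow>
    UC_near_half e (wavelet_fn (tame_masks a) j)"
    "\<And>j a. 1 < a \<Longrightarrow> J \<le> j \<Longrightarrow> a \<le> real j \<Longrightarrow>
    UC_near_half e (scaling_fn (nu a) j)"
proof -
  obtain J where J: "\<And>j a. j \<ge> J \<Longrightarrow> 1 < a \<Longrightarrow> a \<le> real j \<Longrightarrow>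
    localised (phi_profile a j) \<and> \<bar>seq_UC (phi_profile a j) - 1 / 2\<bar> < e"
    using phi_profile_UC_uniform[OF e] by blast
  show ?thesis
  proof (rule that)
    fix a :: real and j :: nat
    assume a: "1 < a"
    then have a0: "a > 0" by simp
    {
      assume "J \<le> max j (nat \<lceil>a\<rceil>)"
      moreover have "a \<le> real (max j (nat \<lceil>a\<rceil>))" using le_of_nat_ceiling[of a] by simp
      ultimately show "UC_near_half e (scaling_fn (tame_masks a) j)"
        using J[of "max j (nat \<lceil>a\<rceil>)" a] a UC_scaling_tame[OF a0] by blast
    next
      assume "J \<le> nat \<lceil>a\<rceil>" "j + 1 \<le> nat \<lceil>a\<rceil>"
      then show "UC_near_half e (wavelet_fn (tame_masks a) j)"
        using J[of "nat \<lceil>a\<rceil>" a] a le_of_nat_ceiling[of a] UC_wavelet_tame[OF a0] by blast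
    next
      assume "J \<le> j" "a \<le> real j"
      then show "UC_near_half e (scaling_fn (nu a) j)"
        using J[of j a] a UC_scaling_nu[OF a0] by blast
    }
  qed
qed

theorem theorem4:
  shows
    "(\<exists>(\<nu> :: real \<Rightarrow> nat \<Rightarrow> int \<Rightarrow> real)
       (\<phi> :: real \<Rightarrow> nat \<Rightarrow> real \<Rightarrow> complex) (\<psi> :: real \<Rightarrow> nat \<Rightarrow> real \<Rightarrow> complex).
        (\<forall>a>1. periodic_wavelets (\<nu> a) (\<phi> a) (\<psi> a)) \<and>
        (\<forall>a>1. \<nu> a 1 = nu a 1 \<and> (\<forall>\<^sub>F j in sequentially. \<nu> a j = nu a j)) \<and>
        (\<forall>a>1. parseval_frame system_index (wavelet_system (\<phi> a) (\<psi> a))) \<and>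
        ((\<lambda>j. SUP a\<in>{1<..}. UC (\<phi> a j)) \<longlongrightarrow> ereal (1 / 2)) sequentially \<and>
        ((\<lambda>a. SUP j\<in>{1..}. UC (\<phi> a j)) \<longlongrightarrow> ereal (1 / 2)) at_top \<and>
        (\<forall>a>1. ((\<lambda>j. UC (\<psi> a j)) \<longlongrightarrow> ereal (3 / 2)) sequentially) \<and>
        (\<forall>j\<ge>1. ((\<lambda>a. UC (\<psi> a j)) \<longlongrightarrow> ereal (1 / 2)) at_top)) \<and>
     (\<exists>(\<phi> :: real \<Rightarrow> nat \<Rightarrow> real \<Rightarrow> complex) (\<psi> :: real \<Rightarrow> nat \<Rightarrow> real \<Rightarrow> complex).
        (\<forall>a>1. periodic_wavelets (nu a) (\<phi> a) (\<psi> a)) \<and>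
        (\<forall>a>1. parseval_frame system_index (wavelet_system (\<phi> a) (\<psi> a))) \<and>
        (\<forall>b>1. ((\<lambda>j. SUP a\<in>{1<..b}. UC (\<phi> a j)) \<longlongrightarrow> ereal (1 / 2)) sequentially) \<and>
        (\<forall>a>1. ((\<lambda>j. UC (\<psi> a j)) \<longlongrightarrow> ereal (3 / 2)) sequentially))"
proof (rule conjI, goal_cases)
  case 1
  have large: "\<forall>\<^sub>F a :: real in at_top. n \<le> nat \<lceil>a\<rceil> \<and> 1 < a" for n :: nat
    using eventually_ge_at_top[of "real n"] eventually_gt_at_top[of "1 :: real"]
    by eventually_elim (intro conjI; linarith)
  have tame_wavelets: "periodic_wavelets (tame_masks a) (scaling_fn (tame_masks a)) (wavelet_fn (tame_masks a))"
    and tame_frame: "parseval_frame system_index (wavelet_system (scaling_fn (tame_masks a)) (wavelet_fn (tame_masks a)))"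
    if "a > 1" for a
    using qmf_masks.periodic_wavelets_trig_series[OF qmf_masks_tame, of a]
      qmf_masks.parseval_frame_trig_series[OF qmf_masks_tame, of a] that by auto
  have tame_nu: "tame_masks a 1 = nu a 1 \<and> (\<forall>\<^sub>F j in sequentially. tame_masks a j = nu a j)" if "a > 1" for a
  proof
    have "1 \<le> nat \<lceil>a\<rceil>" using that by linarith
    then show "tame_masks a 1 = nu a 1" by (auto simp: tame_masks_def flat_masks_def nu_def)
    show "\<forall>\<^sub>F j in sequentially. tame_masks a j = nu a j"
      using eventually_gt_at_top[of "nat \<lceil>a\<rceil>"]
      by eventually_elim (simp add: tame_masks_def flat_masks_def)
  qed
  have sup_a: "((\<lambda>j. SUP a\<in>{1<..}. UC (scaling_fn (tame_masks a) j)) \<longlongrightarrow> ereal (1 / 2)) sequentially"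
  proof (rule ereal_SUP_tendsto)
    fix e :: real assume "e > 0"
    then obtain J where J: "\<And>j a. 1 < a \<Longrightarrow> J \<le> max j (nat \<lceil>a\<rceil>) \<Longrightarrow>
        UC_near_half e (scaling_fn (tame_masks a) j)"
      using UC_uniformly_close by metis
    show "\<forall>\<^sub>F j in sequentially. \<forall>a\<in>{1<..}. UC_near_half e (scaling_fn (tame_masks a) j)"
      using eventually_ge_at_top[of J]
    proof eventually_elim
      case (elim j)
      then have "J \<le> max j (nat \<lceil>a\<rceil>)" for a :: real by simp
      then show ?case using J by blast
    qed
  qed auto
  have sup_j: "((\<lambda>a. SUP j\<in>{1..}. UC (scaling_fn (tame_masks a) j)) \<longlongrightarrow> ereal (1 / 2)) at_top"
  proof (rule ereal_SUP_tendsto)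
    fix e :: real assume "e > 0"
    then obtain J where J: "\<And>j a. 1 < a \<Longrightarrow> J \<le> max j (nat \<lceil>a\<rceil>) \<Longrightarrow>
        UC_near_half e (scaling_fn (tame_masks a) j)"
      using UC_uniformly_close by metis
    show "\<forall>\<^sub>F a in at_top. \<forall>j\<in>{1..}. UC_near_half e (scaling_fn (tame_masks a) j)"
      using large[of J]
    proof eventually_elim
      case (elim a)
      then have "J \<le> max j (nat \<lceil>a\<rceil>)" for j by (intro max.coboundedI2) simp
      then show ?case using J elim by blast
    qed
  qed auto
  have psi_a: "((\<lambda>a. UC (wavelet_fn (tame_masks a) j)) \<longlongrightarrow> ereal (1 / 2)) at_top" for j
  proof -
    \<comment> \<open>A supremum over one point, so that the criterion for suprema applies.\<close>
    have "((\<lambda>a. SUP i\<in>{()}. UC (wavelet_fn (tame_masks a) j)) \<longlongrightarrow> ereal (1 / 2)) at_top"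
    proof (rule ereal_SUP_tendsto)
      fix e :: real assume "e > 0"
      then obtain J where J: "\<And>j a. 1 < a \<Longrightarrow> J \<le> nat \<lceil>a\<rceil> \<Longrightarrow> j + 1 \<le> nat \<lceil>a\<rceil> \<Longrightarrow>
          UC_near_half e (wavelet_fn (tame_masks a) j)"
        using UC_uniformly_close by metis
      show "\<forall>\<^sub>F a in at_top. \<forall>i\<in>{()}. UC_near_half e (wavelet_fn (tame_masks a) j)"
        using large[of J] large[of "j + 1"] by eventually_elim (use J in blast)
    qed auto
    then show ?thesis by simp
  qed
  have psi_j: "((\<lambda>j. UC (wavelet_fn (tame_masks a) j)) \<longlongrightarrow> ereal (3 / 2)) sequentially" if "a > 1" for a
  proof (rule wavelet_UC_LIMSEQ[OF that qmf_masks_tame])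
    show "tame_masks a j = nu a j" if "j > nat \<lceil>a\<rceil>" for j
      using that by (simp add: tame_masks_def flat_masks_def)
    show "xi_hat (tame_masks a) j = xi_hat (nu a) j" if "j \<ge> nat \<lceil>a\<rceil>" for j
      using that \<open>a > 1\<close> unfolding tame_masks_def
      by (intro ext) (simp add: xi_hat_flat_masks[OF qmf_masks_nu] max_absorb1)
  qed (use that in simp)
  show ?case
    using tame_wavelets tame_nu tame_frame sup_a sup_j psi_j psi_a
    by (intro exI[of _ tame_masks] exI[of _ "\<lambda>a. scaling_fn (tame_masks a)"]
        exI[of _ "\<lambda>a. wavelet_fn (tame_masks a)"] conjI allI impI) blast+
next
  case 2
  have wavelets: "periodic_wavelets (nu a) (scaling_fn (nu a)) (wavelet_fn (nu a))"
    and frame: "parseval_frame system_index (wavelet_system (scaling_fn (nu a)) (wavelet_fn (nu a)))"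
    if "a > 1" for a
    using qmf_masks.periodic_wavelets_trig_series[OF qmf_masks_nu, of a]
      qmf_masks.parseval_frame_trig_series[OF qmf_masks_nu, of a] that by auto
  have sup_a: "((\<lambda>j. SUP a\<in>{1<..b}. UC (scaling_fn (nu a) j)) \<longlongrightarrow> ereal (1 / 2)) sequentially" if b: "b > 1" for b
  proof (rule ereal_SUP_tendsto)
    fix e :: real assume "e > 0"
    then obtain J where J: "\<And>j a. 1 < a \<Longrightarrow> J \<le> j \<Longrightarrow> a \<le> real j \<Longrightarrow>
        UC_near_half e (scaling_fn (nu a) j)"
      using UC_uniformly_close by metis
    show "\<forall>\<^sub>F j in sequentially. \<forall>a\<in>{1<..b}. UC_near_half e (scaling_fn (nu a) j)"
      using eventually_ge_at_top[of "max J (nat \<lceil>b\<rceil>)"]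
    proof eventually_elim
      case (elim j)
      then have "b \<le> real j" "J \<le> j" by linarith+
      show ?case
      proof
        fix a assume "a \<in> {1<..b}"
        then have "1 < a" "a \<le> real j" using \<open>b \<le> real j\<close> by auto
        then show "UC_near_half e (scaling_fn (nu a) j)" using J \<open>J \<le> j\<close> by blast
      qed
    qed
  qed (use b in auto)
  have psi_j: "((\<lambda>j. UC (wavelet_fn (nu a) j)) \<longlongrightarrow> ereal (3 / 2)) sequentially" if "a > 1" for a
    by (rule wavelet_UC_LIMSEQ[OF that qmf_masks_nu, where J = 0]) (use that in simp_all)
  show ?case
    using wavelets frame sup_a psi_j
    by (intro exI[of _ "\<lambda>a. scaling_fn (nu a)"] exI[of _ "\<lambda>a. wavelet_fn (nu a)"] conjI allI impI) blast+
qed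

end
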